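(* Let $\varphi$ be an inner function. Then the following assertions hold: (i) $\varphi$ is a finite Blaschke product if and only if $P_\varphi \in Gr_{res}$; in this case $P_\varphi\in Gr_{res}^{-k}$, where $k$ is the number of zeros of $\varphi$ in the unit disk (counted with multiplicity). (ii) $\varphi$ is not a finite Blaschke product if and only if $P_\varphi \in \mathbb{E}_1$.
   Context: $L^2=L^2(\mathbb{T})$ on the unit circle $\mathbb{T}$; $H^2\subset L^2$ is the Hardy space, $H^2_-=L^2\ominus H^2$, and $P_+$, $P_-$ are the orthogonal projections of $L^2$ onto $H^2$, $H^2_-$. An inner function is a $\varphi\in H^2$ with $|\varphi|=1$ a.e. on $\mathbb{T}$; $P_\varphi$ denotes the orthogonal projection of $L^2$ onto the closed subspace $\varphi H^2$. A finite Blaschke product is a finite (possibly empty) product, up to a unimodular multiplicative constant, of factors $b_a(z)=\frac{\overline a}{|a|}\frac{a-z}{1-\overline a z}$ ($0<|a|<1$) and $b_0(z)=z$. The compact restricted Grassmannian $Gr_{res}$ is the set of closed subspaces $W\subset L^2$ (identified with their orthogonal projections $P_W$) such that $P_+|_W:W\to H^2$ is a Fredholm operator and $P_-|_W:W\to H^2_-$ is compact. For $j\in\mathbb{Z}$, $Gr_{res}^j$ is the set of $W\in Gr_{res}$ such that $P_+|_W:W\to H^2$ has Fredholm index ($\dim\ker-\dim\mathrm{coker}$) equal to $j$. Let $\mathcal{B}_{cc}=\{T\in\mathcal{B}(L^2): TP_+-P_+T\text{ is compact}\}$ and let $\pi$ be the quotient map of $\mathcal{B}(L^2)$ onto the Calkin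 algebra. The essential class $\mathbb{E}_1$ is the set of orthogonal projections $P\in\mathcal{B}_{cc}$ such that, as a matrix with respect to $\pi(P_+)$ and $\pi(P_-)$, $\pi(P)=\begin{pmatrix} p&0\\0&0\end{pmatrix}$ with $p$ a projection satisfying $p\neq0$ and $p\neq1$ (where $1$ stands for $\pi(P_+)$). *)

theory Defs
  imports "HOL-Complex_Analysis.Complex_Analysis" "HOL-Algebra.QuotRing"
begin

section \<open>The Hilbert space \<open>L\<^sup>2(\<T>)\<close>\<close>

(* normalized arc length on the unit circle *)
definition circle :: "complex measure" where
  "circle = distr (uniform_measure lborel {0..2*pi}) (restrict_space borel (sphere 0 1)) cis"

definition square_integrable :: "(complex \<Rightarrow> complex) \<Rightarrow> bool" where
  "square_integrable f \<longleftrightarrow>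
     f \<in> borel_measurable circle \<and> integrable circle (\<lambda>z. (cmod (f z))\<^sup>2)"

definition L2_eq :: "(complex \<Rightarrow> complex) \<Rightarrow> (complex \<Rightarrow> complex) \<Rightarrow> bool" where
  "L2_eq f g \<longleftrightarrow> square_integrable f \<and> square_integrable g \<and> (AE z in circle. f z = g z)"

lemma L2_eqI:
  "square_integrable f \<Longrightarrow> square_integrable g \<Longrightarrow> (\<And>z. f z = g z) \<Longrightarrow> L2_eq f g"
  by (simp add: L2_eq_def)

lemma square_integrable_zero: "square_integrable (\<lambda>_. 0)"
  by (simp add: square_integrable_def)

lemma square_integrable_scale:
  assumes "square_integrable f"
  shows "square_integrable (\<lambda>z. c * f z)"
  using assms by (auto simp: square_integrable_def norm_mult power_mult_distrib)

lemma square_integrable_prod: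
  assumes "square_integrable f" "square_integrable g"
  shows "integrable circle (\<lambda>z. f z * cnj (g z))"
proof (rule Bochner_Integration.integrable_bound)
  show "integrable circle (\<lambda>z. (cmod (f z))\<^sup>2 + (cmod (g z))\<^sup>2)"
    using assms by (simp add: square_integrable_def)
  have [measurable]: "f \<in> borel_measurable circle" "g \<in> borel_measurable circle"
    using assms by (simp_all add: square_integrable_def)
  show "(\<lambda>z. f z * cnj (g z)) \<in> borel_measurable circle"
  proof (rule borel_measurable_times)
    show "(\<lambda>z. cnj (g z)) \<in> borel_measurable circle"
      by (rule measurable_compose[OF _ borel_measurable_continuous_onI])
         (auto intro!: continuous_intros)
  qed measurable
  show "AE z in circle. norm (f z * cnj (g z)) \<le> norm ((cmod (f z))\<^sup>2 + (cmod (g z))\<^sup>2)"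
  proof (rule AE_I2)
    fix z
    have "2 * (cmod (f z) * cmod (g z)) \<le> (cmod (f z))\<^sup>2 + (cmod (g z))\<^sup>2"
      using sum_squares_bound[of "cmod (f z)" "cmod (g z)"] by (simp add: mult.assoc)
    moreover have "0 \<le> cmod (f z) * cmod (g z)" by simp
    ultimately have "cmod (f z) * cmod (g z) \<le> (cmod (f z))\<^sup>2 + (cmod (g z))\<^sup>2" by linarith
    then show "norm (f z * cnj (g z)) \<le> norm ((cmod (f z))\<^sup>2 + (cmod (g z))\<^sup>2)"
      by (simp add: norm_mult)
  qed
qed

lemma square_integrable_add:
  assumes "square_integrable f" "square_integrable g"
  shows "square_integrable (\<lambda>z. f z + g z)"
proof -
  have [measurable]: "f \<in> borel_measurable circle" "g \<in> borel_measurable circle"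
    using assms by (simp_all add: square_integrable_def)
  have "integrable circle (\<lambda>z. (cmod (f z + g z))\<^sup>2)"
  proof (rule Bochner_Integration.integrable_bound)
    show "integrable circle (\<lambda>z. 2 * (cmod (f z))\<^sup>2 + 2 * (cmod (g z))\<^sup>2)"
      using assms by (simp add: square_integrable_def)
    show "AE z in circle. norm ((cmod (f z + g z))\<^sup>2)
        \<le> norm (2 * (cmod (f z))\<^sup>2 + 2 * (cmod (g z))\<^sup>2)"
    proof (rule AE_I2)
      fix z
      have "(cmod (f z + g z))\<^sup>2 \<le> (cmod (f z) + cmod (g z))\<^sup>2"
        by (intro power_mono norm_triangle_ineq) simp
      also have "\<dots> \<le> 2 * (cmod (f z))\<^sup>2 + 2 * (cmod (g z))\<^sup>2"
        using sum_squares_bound[of "cmod (f z)" "cmod (g z)"] by (simp add: power2_sum)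
      finally show "norm ((cmod (f z + g z))\<^sup>2) \<le> norm (2 * (cmod (f z))\<^sup>2 + 2 * (cmod (g z))\<^sup>2)"
        by simp
    qed
  qed measurable
  then show ?thesis
    by (simp add: square_integrable_def)
qed

lemma square_integrable_uminus:
  "square_integrable f \<Longrightarrow> square_integrable (\<lambda>z. - f z)"
  using square_integrable_scale[of f "-1"] by simp

quotient_type L2 = "complex \<Rightarrow> complex" / partial: L2_eq
proof (rule part_equivpI)
  show "\<exists>f. L2_eq f f"
    using square_integrable_zero by (auto simp: L2_eq_def)
  show "symp L2_eq"
    by (auto simp: symp_def L2_eq_def)
  show "transp L2_eq"
    by (rule transpI) (auto simp: L2_eq_def)
qed

instantiation L2 :: real_vector
begin

lift_definition zero_L2 :: L2 is "\<lambda>_. 0"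
  by (simp add: L2_eq_def square_integrable_zero)

lift_definition plus_L2 :: "L2 \<Rightarrow> L2 \<Rightarrow> L2" is "\<lambda>f g z. f z + g z"
  by (auto simp: L2_eq_def square_integrable_add)

lift_definition uminus_L2 :: "L2 \<Rightarrow> L2" is "\<lambda>f z. - f z"
  by (auto simp: L2_eq_def square_integrable_uminus)

lift_definition minus_L2 :: "L2 \<Rightarrow> L2 \<Rightarrow> L2" is "\<lambda>f g z. f z - g z"
  using square_integrable_add[OF _ square_integrable_uminus] by (auto simp: L2_eq_def)

lift_definition scaleR_L2 :: "real \<Rightarrow> L2 \<Rightarrow> L2" is "\<lambda>r f z. of_real r * f z"
  by (auto simp: L2_eq_def square_integrable_scale)

instance
proof
  fix a b c :: L2 and r s :: real
  note si = square_integrable_add square_integrable_scale square_integrable_uminus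
    square_integrable_add[OF _ square_integrable_uminus, simplified] square_integrable_zero
  show "a + b + c = a + (b + c)"
    by transfer (intro L2_eqI si; simp add: L2_eq_def algebra_simps)
  show "a + b = b + a"
    by transfer (intro L2_eqI si; simp add: L2_eq_def algebra_simps)
  show "0 + a = a"
    by transfer (auto simp: L2_eq_def)
  show "- a + a = 0"
    by transfer (auto simp: L2_eq_def square_integrable_zero)
  show "a - b = a + - b"
    by transfer (intro L2_eqI si; simp add: L2_eq_def algebra_simps)
  show "r *\<^sub>R (a + b) = r *\<^sub>R a + r *\<^sub>R b"
    by transfer (intro L2_eqI si; simp add: L2_eq_def algebra_simps)
  show "(r + s) *\<^sub>R a = r *\<^sub>R a + s *\<^sub>R a"
    by transfer (intro L2_eqI si; simp add: L2_eq_def algebra_simps)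
  show "r *\<^sub>R s *\<^sub>R a = (r * s) *\<^sub>R a"
    by transfer (intro L2_eqI si; simp add: L2_eq_def algebra_simps)
  show "1 *\<^sub>R a = a"
    by transfer (auto simp: L2_eq_def)
qed

end

lift_definition scaleC :: "complex \<Rightarrow> L2 \<Rightarrow> L2" (infixr "*\<^sub>C" 75) is "\<lambda>c f z. c * f z"
  by (auto simp: L2_eq_def square_integrable_scale)

lemma scaleC_of_real: "of_real r *\<^sub>C f = r *\<^sub>R f"
  by transfer (auto simp: L2_eq_def square_integrable_scale)

global_interpretation L2: vector_space scaleC
proof
  fix a b :: complex and x y :: L2
  note si = square_integrable_add square_integrable_scale
  show "a *\<^sub>C (x + y) = a *\<^sub>C x + a *\<^sub>C y"
    by transfer (intro L2_eqI si; simp add: L2_eq_def algebra_simps)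
  show "(a + b) *\<^sub>C x = a *\<^sub>C x + b *\<^sub>C x"
    by transfer (intro L2_eqI si; simp add: L2_eq_def algebra_simps)
  show "a *\<^sub>C b *\<^sub>C x = (a * b) *\<^sub>C x"
    by transfer (intro L2_eqI si; simp add: L2_eq_def algebra_simps)
  show "1 *\<^sub>C x = x"
    by transfer (auto simp: L2_eq_def)
qed

(* linear in the first argument *)
lift_definition cinner :: "L2 \<Rightarrow> L2 \<Rightarrow> complex" is
  "\<lambda>f g. integral\<^sup>L circle (\<lambda>z. f z * cnj (g z))"
proof -
  fix f f' g g' assume A: "L2_eq f f'" "L2_eq g g'"
  have "integrable circle (\<lambda>z. f z * cnj (g z))" "integrable circle (\<lambda>z. f' z * cnj (g' z))"
    using A by (auto simp: L2_eq_def intro!: square_integrable_prod)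
  then have "(\<lambda>z. f z * cnj (g z)) \<in> borel_measurable circle"
    "(\<lambda>z. f' z * cnj (g' z)) \<in> borel_measurable circle" by auto
  then show "integral\<^sup>L circle (\<lambda>z. f z * cnj (g z)) = integral\<^sup>L circle (\<lambda>z. f' z * cnj (g' z))"
    by (rule integral_cong_AE) (use A in \<open>auto simp: L2_eq_def\<close>)
qed

lemma cinner_commute: "cinner f g = cnj (cinner g f)"
  by transfer (simp flip: Bochner_Integration.integral_cnj add: mult.commute)

lemma cinner_add_left: "cinner (f + g) h = cinner f h + cinner g h"
  by transfer (auto simp: L2_eq_def distrib_right square_integrable_prod)

lemma cinner_scaleC_left: "cinner (c *\<^sub>C f) h = c * cinner f h"
  by transfer (auto simp: L2_eq_def mult.assoc)

lemma cinner_self: "cinner f f = of_real (Re (cinner f f))"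
  by (metis cinner_commute of_real_Re Reals_cnj_iff)

lemma cinner_self_ge_0: "Re (cinner f f) \<ge> 0"
  by transfer (simp only: complex_norm_square[symmetric] integral_complex_of_real Re_complex_of_real,
    simp)

lemma cinner_self_eq_0: "Re (cinner f f) = 0 \<longleftrightarrow> f = 0"
proof (transfer)
  fix f assume f: "L2_eq f f"
  have "Re (integral\<^sup>L circle (\<lambda>z. f z * cnj (f z))) = integral\<^sup>L circle (\<lambda>z. (cmod (f z))\<^sup>2)"
    by (simp only: complex_norm_square[symmetric] integral_complex_of_real Re_complex_of_real)
  moreover have "\<dots> = 0 \<longleftrightarrow> (AE z in circle. (cmod (f z))\<^sup>2 = 0)"
    using f by (intro integral_nonneg_eq_0_iff_AE) (auto simp: L2_eq_def square_integrable_def)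
  ultimately show "Re (integral\<^sup>L circle (\<lambda>z. f z * cnj (f z))) = 0 \<longleftrightarrow> L2_eq f (\<lambda>_. 0)"
    using f by (simp add: L2_eq_def square_integrable_zero)
qed

(* the underlying real Hilbert space supplies norm and topology *)
instantiation L2 :: real_inner
begin

definition inner_L2 :: "L2 \<Rightarrow> L2 \<Rightarrow> real" where "inner_L2 f g = Re (cinner f g)"
definition norm_L2 :: "L2 \<Rightarrow> real" where "norm_L2 f = sqrt (inner f f)"
definition sgn_L2 :: "L2 \<Rightarrow> L2" where "sgn_L2 f = f /\<^sub>R norm f"
definition dist_L2 :: "L2 \<Rightarrow> L2 \<Rightarrow> real" where "dist_L2 f g = norm (f - g)"
definition uniformity_L2 :: "(L2 \<times> L2) filter" where
  "uniformity_L2 = (INF e\<in>{0 <..}. principal {(x, y). dist x y < e})"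
definition open_L2 :: "L2 set \<Rightarrow> bool" where
  "open_L2 S \<longleftrightarrow> (\<forall>x\<in>S. \<forall>\<^sub>F (x', y) in uniformity. x' = x \<longrightarrow> y \<in> S)"

instance
proof
  fix x y z :: L2 and r :: real and S :: "L2 set"
  show "dist x y = norm (x - y)" by (simp add: dist_L2_def)
  show "sgn x = x /\<^sub>R norm x" by (simp add: sgn_L2_def)
  show "(uniformity :: (L2 \<times> L2) filter) = (INF e\<in>{0 <..}. principal {(x, y). dist x y < e})"
    by (simp add: uniformity_L2_def)
  show "open S \<longleftrightarrow> (\<forall>x\<in>S. \<forall>\<^sub>F (x', y) in uniformity. x' = x \<longrightarrow> y \<in> S)"
    by (simp add: open_L2_def)
  show "inner x y = inner y x"
    unfolding inner_L2_def by (subst cinner_commute) simp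
  show "inner (x + y) z = inner x z + inner y z"
    by (simp add: inner_L2_def cinner_add_left)
  show "inner (r *\<^sub>R x) y = r * inner x y"
    by (simp add: inner_L2_def cinner_scaleC_left flip: scaleC_of_real)
  show "0 \<le> inner x x" by (simp add: inner_L2_def cinner_self_ge_0)
  show "inner x x = 0 \<longleftrightarrow> x = 0" by (simp add: inner_L2_def cinner_self_eq_0)
  show "norm x = sqrt (inner x x)" by (simp add: norm_L2_def)
qed

end

section \<open>Operators\<close>

definition bounded_op :: "(L2 \<Rightarrow> L2) \<Rightarrow> bool" where
  "bounded_op T \<longleftrightarrow> bounded_linear T \<and> (\<forall>c f. T (c *\<^sub>C f) = c *\<^sub>C T f)"

(* T restricted to V is a compact operator: it maps the unit ball of V to a relatively compact set *)
definition compact_on :: "L2 set \<Rightarrow> (L2 \<Rightarrow> L2) \<Rightarrow> bool" where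
  "compact_on V T \<longleftrightarrow> compact (closure (T ` (V \<inter> cball 0 1)))"

definition is_orth_proj :: "(L2 \<Rightarrow> L2) \<Rightarrow> bool" where
  "is_orth_proj P \<longleftrightarrow> bounded_op P \<and> P \<circ> P = P \<and> (\<forall>f g. cinner (P f) g = cinner f (P g))"

definition closed_subspace :: "L2 set \<Rightarrow> bool" where
  "closed_subspace W \<longleftrightarrow> L2.subspace W \<and> closed W"

definition orth_proj :: "L2 set \<Rightarrow> L2 \<Rightarrow> L2" where
  "orth_proj W f = (THE g. g \<in> W \<and> (\<forall>h\<in>W. cinner (f - g) h = 0))"

definition fin_dim :: "L2 set \<Rightarrow> bool" where
  "fin_dim V \<longleftrightarrow> (\<exists>B. finite B \<and> V \<subseteq> L2.span B)"

definition fin_codim :: "L2 set \<Rightarrow> L2 set \<Rightarrow> bool" where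
  "fin_codim U W \<longleftrightarrow> (\<exists>B. finite B \<and> B \<subseteq> W \<and> W \<subseteq> L2.span (U \<union> B))"

(* the dimension of the quotient space W/U: the least number of vectors whose cosets span it *)
definition codim :: "L2 set \<Rightarrow> L2 set \<Rightarrow> nat" where
  "codim U W = (LEAST n. \<exists>B. finite B \<and> card B = n \<and> B \<subseteq> W \<and> W \<subseteq> L2.span (U \<union> B))"

definition ker_on :: "L2 set \<Rightarrow> (L2 \<Rightarrow> L2) \<Rightarrow> L2 set" where
  "ker_on V T = {f \<in> V. T f = 0}"

(* T restricted to V is a Fredholm operator from V to W *)
definition fredholm :: "L2 set \<Rightarrow> L2 set \<Rightarrow> (L2 \<Rightarrow> L2) \<Rightarrow> bool" where
  "fredholm V W T \<longleftrightarrow> bounded_op T \<and> T ` V \<subseteq> W \<and>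
     fin_dim (ker_on V T) \<and> closed (T ` V) \<and> fin_codim (T ` V) W"

definition fredholm_index :: "L2 set \<Rightarrow> L2 set \<Rightarrow> (L2 \<Rightarrow> L2) \<Rightarrow> int" where
  "fredholm_index V W T = int (L2.dim (ker_on V T)) - int (codim (T ` V) W)"

section \<open>The Calkin algebra\<close>

definition BL2 :: "(L2 \<Rightarrow> L2) ring" where
  "BL2 = \<lparr>carrier = {T. bounded_op T}, mult = (\<circ>), one = id,
     zero = (\<lambda>_. 0), add = (\<lambda>S T f. S f + T f)\<rparr>"

definition compact_ops :: "(L2 \<Rightarrow> L2) set" where
  "compact_ops = {T. bounded_op T \<and> compact_on UNIV T}"

definition calkin :: "(L2 \<Rightarrow> L2) set ring" where
  "calkin = BL2 Quot compact_ops"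

definition calkin_map :: "(L2 \<Rightarrow> L2) \<Rightarrow> (L2 \<Rightarrow> L2) set" where
  "calkin_map T = compact_ops +>\<^bsub>BL2\<^esub> T"

definition adjoint_op :: "(L2 \<Rightarrow> L2) \<Rightarrow> L2 \<Rightarrow> L2" where
  "adjoint_op T = (THE S. bounded_op S \<and> (\<forall>f g. cinner (T f) g = cinner f (S g)))"

definition calkin_star :: "(L2 \<Rightarrow> L2) set \<Rightarrow> (L2 \<Rightarrow> L2) set" where
  "calkin_star X = adjoint_op ` X"

definition calkin_projection :: "(L2 \<Rightarrow> L2) set \<Rightarrow> bool" where
  "calkin_projection p \<longleftrightarrow> p \<in> carrier calkin \<and> p \<otimes>\<^bsub>calkin\<^esub> p = p \<and> calkin_star p = p"

lemma bounded_opI: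
  assumes "\<And>f g. T (f + g) = T f + T g" "\<And>c f. T (c *\<^sub>C f) = c *\<^sub>C T f"
    "\<And>f. norm (T f) \<le> norm f * K"
  shows "bounded_op T"
  unfolding bounded_op_def
proof (intro conjI allI bounded_linear_intro[where K = K])
  show "T (r *\<^sub>R f) = r *\<^sub>R T f" for r f
    using assms(2)[of "of_real r"] by (simp add: scaleC_of_real)
qed (use assms in auto)

lemma norm_scaleC: "norm (c *\<^sub>C f) = cmod c * norm f"
proof -
  have "cinner (c *\<^sub>C f) (c *\<^sub>C f) = c * cnj (c * cinner f f)"
    by (metis cinner_scaleC_left cinner_commute)
  also have "\<dots> = of_real ((cmod c)\<^sup>2) * cinner f f"
    by (simp only: complex_cnj_mult cinner_commute[of f f, symmetric] complex_norm_square mult.assoc)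
  finally show ?thesis
    by (simp add: norm_L2_def inner_L2_def real_sqrt_mult del: of_real_power)
qed

lemma bounded_op_scaleC: "bounded_op ((*\<^sub>C) c)"
  by (rule bounded_opI[where K = "cmod c"])
     (simp_all add: L2.scale_right_distrib L2.scale_left_commute norm_scaleC)

lemma bounded_op_zero: "bounded_op (\<lambda>_. 0)"
  by (simp add: bounded_op_def bounded_linear_zero)

lemma bounded_op_id: "bounded_op id"
  by (simp add: bounded_op_def bounded_linear_ident id_def)

lemma bounded_op_comp: "bounded_op S \<Longrightarrow> bounded_op T \<Longrightarrow> bounded_op (S \<circ> T)"
  by (simp add: bounded_op_def bounded_linear_compose comp_def)

lemma bounded_op_add: "bounded_op S \<Longrightarrow> bounded_op T \<Longrightarrow> bounded_op (\<lambda>f. S f + T f)"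
  by (simp add: bounded_op_def bounded_linear_add L2.scale_right_distrib)

lemma bounded_op_uminus: "bounded_op S \<Longrightarrow> bounded_op (\<lambda>f. - S f)"
  by (simp add: bounded_op_def bounded_linear_minus)

lemma ring_BL2: "ring BL2"
proof (rule ringI)
  show "abelian_group BL2"
  proof (rule abelian_groupI)
    fix T assume "T \<in> carrier BL2"
    then show "\<exists>S\<in>carrier BL2. S \<oplus>\<^bsub>BL2\<^esub> T = \<zero>\<^bsub>BL2\<^esub>"
      by (intro bexI[of _ "\<lambda>f. - T f"]) (auto simp: BL2_def bounded_op_uminus)
  qed (auto simp: BL2_def bounded_op_add bounded_op_zero ac_simps)
  show "monoid BL2"
    by (rule monoidI) (auto simp: BL2_def bounded_op_comp bounded_op_id comp_assoc)
qed (auto simp: BL2_def bounded_op_def fun_eq_iff linear_simps)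

lemma compact_on_if_subset:
  assumes "compact K" "T ` (V \<inter> cball 0 1) \<subseteq> K"
  shows "compact_on V T"
proof -
  have "closure (T ` (V \<inter> cball 0 1)) \<subseteq> K"
    using assms by (simp add: closure_minimal compact_imp_closed)
  then have "K \<inter> closure (T ` (V \<inter> cball 0 1)) = closure (T ` (V \<inter> cball 0 1))" by blast
  then show ?thesis
    using compact_Int_closed[OF assms(1) closed_closure[of "T ` (V \<inter> cball 0 1)"]]
    by (simp add: compact_on_def)
qed

lemma compact_on_add:
  assumes "compact_on V S" "compact_on V T"
  shows "compact_on V (\<lambda>f. S f + T f)"
proof (rule compact_on_if_subset)
  show "compact {x + y |x y. x \<in> closure (S ` (V \<inter> cball 0 1)) \<and> y \<in> closure (T ` (V \<inter> cball 0 1))}"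
    using assms by (intro compact_sums) (simp_all add: compact_on_def)
  show "(\<lambda>f. S f + T f) ` (V \<inter> cball 0 1) \<subseteq>
      {x + y |x y. x \<in> closure (S ` (V \<inter> cball 0 1)) \<and> y \<in> closure (T ` (V \<inter> cball 0 1))}"
    using closure_subset[of "S ` (V \<inter> cball 0 1)"] closure_subset[of "T ` (V \<inter> cball 0 1)"]
    by blast
qed

lemma compact_on_comp_left:
  assumes "bounded_linear S" "compact_on V T"
  shows "compact_on V (S \<circ> T)"
proof (rule compact_on_if_subset)
  show "compact (S ` closure (T ` (V \<inter> cball 0 1)))"
    using assms by (intro compact_continuous_image linear_continuous_on) (simp_all add: compact_on_def)
  show "(S \<circ> T) ` (V \<inter> cball 0 1) \<subseteq> S ` closure (T ` (V \<inter> cball 0 1))"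
    unfolding image_comp[symmetric] by (intro image_mono closure_subset)
qed

lemma compact_on_comp_right:
  assumes "compact_on UNIV S" "bounded_linear S" "bounded_linear T"
  shows "compact_on UNIV (S \<circ> T)"
proof -
  obtain K where K: "K > 0" "\<And>f. norm (T f) \<le> norm f * K"
    using bounded_linear.pos_bounded[OF assms(3)] by blast
  show ?thesis
  proof (rule compact_on_if_subset)
    show "compact ((\<lambda>x. K *\<^sub>R x) ` closure (S ` (UNIV \<inter> cball 0 1)))"
      using assms(1) by (intro compact_scaling) (simp add: compact_on_def)
    show "(S \<circ> T) ` (UNIV \<inter> cball 0 1) \<subseteq> (\<lambda>x. K *\<^sub>R x) ` closure (S ` (UNIV \<inter> cball 0 1))"
    proof clarify
      fix f :: L2 assume f: "f \<in> cball 0 1"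
      have "norm (T f) \<le> K"
        using K(2)[of f] mult_right_mono[of "norm f" 1 K] K(1) f
        by (smt (verit) mem_cball_0 mult_1)
      then have "norm ((1 / K) *\<^sub>R T f) \<le> 1"
        using K(1) by (simp add: divide_simps)
      then have "S ((1 / K) *\<^sub>R T f) \<in> closure (S ` (UNIV \<inter> cball 0 1))"
        by (intro subsetD[OF closure_subset] imageI) simp
      moreover have "(S \<circ> T) f = K *\<^sub>R S ((1 / K) *\<^sub>R T f)"
        using K(1) linear_simps(5)[OF assms(2)] by simp
      ultimately show "(S \<circ> T) f \<in> (\<lambda>x. K *\<^sub>R x) ` closure (S ` (UNIV \<inter> cball 0 1))"
        by blast
    qed
  qed
qed

lemma ideal_compact_ops: "ideal compact_ops BL2"
proof (rule idealI[OF ring_BL2])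
  interpret ring BL2 by (rule ring_BL2)
  show "subgroup compact_ops (add_monoid BL2)"
  proof (rule add.subgroupI)
    show "compact_ops \<subseteq> carrier BL2" by (auto simp: compact_ops_def BL2_def)
    have "compact_on UNIV (\<lambda>_. 0)"
      by (rule compact_on_if_subset[of "{0}"]) auto
    then show "compact_ops \<noteq> {}"
      using bounded_op_zero by (auto simp: compact_ops_def)
    fix T assume T: "T \<in> compact_ops"
    have "bounded_op (\<lambda>f. - T f)"
      using T by (simp add: compact_ops_def bounded_op_uminus)
    then have "\<ominus>\<^bsub>BL2\<^esub> T = (\<lambda>f. - T f)"
      using T by (intro minus_equality) (auto simp: BL2_def compact_ops_def)
    moreover have "compact_on UNIV (uminus \<circ> T)"
      using T by (intro compact_on_comp_left) (auto simp: compact_ops_def bounded_linear_minus)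
    ultimately show "\<ominus>\<^bsub>BL2\<^esub> T \<in> compact_ops"
      using T by (simp add: compact_ops_def bounded_op_uminus comp_def)
    fix S assume S: "S \<in> compact_ops"
    show "T \<oplus>\<^bsub>BL2\<^esub> S \<in> compact_ops"
      using S T by (simp add: compact_ops_def BL2_def bounded_op_add compact_on_add)
  qed
  fix S T assume "S \<in> compact_ops" "T \<in> carrier BL2"
  then have ST: "bounded_op S" "bounded_op T" "compact_on UNIV S"
    by (simp_all add: compact_ops_def BL2_def)
  then have "compact_on UNIV (T \<circ> S)" "compact_on UNIV (S \<circ> T)"
    by (simp_all add: bounded_op_def compact_on_comp_left compact_on_comp_right)
  with ST show "T \<otimes>\<^bsub>BL2\<^esub> S \<in> compact_ops" "S \<otimes>\<^bsub>BL2\<^esub> T \<in> compact_ops"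
    by (simp_all add: compact_ops_def BL2_def bounded_op_comp)
qed

section \<open>Hardy space, inner functions and finite Blaschke products\<close>

lift_definition fourier :: "L2 \<Rightarrow> int \<Rightarrow> complex" is
  "\<lambda>f n. integral\<^sup>L circle (\<lambda>z. f z * cnj (z powi n))"
proof (rule ext)
  fix f g n assume A: "L2_eq f g"
  have m: "(\<lambda>z. cnj (z powi n)) \<in> borel_measurable circle"
  proof -
    have "continuous_on (sphere (0::complex) 1) (\<lambda>z. cnj (z powi n))"
      by (intro continuous_intros) auto
    then show ?thesis
      by (simp add: circle_def borel_measurable_continuous_on_restrict)
  qed
  show "integral\<^sup>L circle (\<lambda>z. f z * cnj (z powi n)) = integral\<^sup>L circle (\<lambda>z. g z * cnj (z powi n))"
    by (rule integral_cong_AE)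
       (use A m in \<open>auto simp: L2_eq_def square_integrable_def intro!: borel_measurable_times\<close>)
qed

definition Hardy :: "L2 set" where
  "Hardy = {f. \<forall>n<0. fourier f n = 0}"

definition Hardy_minus :: "L2 set" where
  "Hardy_minus = {f. \<forall>g\<in>Hardy. cinner f g = 0}"

definition P_plus :: "L2 \<Rightarrow> L2" where "P_plus = orth_proj Hardy"
definition P_minus :: "L2 \<Rightarrow> L2" where "P_minus = orth_proj Hardy_minus"

lift_definition L2_represents :: "(complex \<Rightarrow> complex) \<Rightarrow> L2 \<Rightarrow> bool" is
  "\<lambda>g f. AE z in circle. f z = g z"
proof -
  fix f f' g :: "complex \<Rightarrow> complex"
  assume "L2_eq f f'"
  then have "AE z in circle. f z = f' z" by (simp add: L2_eq_def)
  then show "(AE z in circle. f z = g z) = (AE z in circle. f' z = g z)"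
    by (intro eventually_subst) (auto elim: eventually_mono)
qed

lift_definition unimodular :: "L2 \<Rightarrow> bool" is "\<lambda>f. AE z in circle. cmod (f z) = 1"
proof -
  fix f g assume "L2_eq f g"
  then have "AE z in circle. f z = g z" by (simp add: L2_eq_def)
  then show "(AE z in circle. cmod (f z) = 1) = (AE z in circle. cmod (g z) = 1)"
    by (intro eventually_subst) (auto elim: eventually_mono)
qed

(* h = f g almost everywhere; a relation, since the product need not lie in the space *)
lift_definition is_product :: "L2 \<Rightarrow> L2 \<Rightarrow> L2 \<Rightarrow> bool" is
  "\<lambda>f g h. AE z in circle. h z = f z * g z"
proof -
  fix f f' g g' h h' assume "L2_eq f f'" "L2_eq g g'" "L2_eq h h'"
  then have "AE z in circle. f z = f' z \<and> g z = g' z \<and> h z = h' z" by (simp add: L2_eq_def)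
  then show "(AE z in circle. h z = f z * g z) = (AE z in circle. h' z = f' z * g' z)"
    by (intro eventually_subst) (auto elim: eventually_mono)
qed

definition inner_function :: "L2 \<Rightarrow> bool" where
  "inner_function \<phi> \<longleftrightarrow> \<phi> \<in> Hardy \<and> unimodular \<phi>"

definition mult_Hardy :: "L2 \<Rightarrow> L2 set" where
  "mult_Hardy \<phi> = {h. \<exists>f\<in>Hardy. is_product \<phi> f h}"

definition P_inner :: "L2 \<Rightarrow> L2 \<Rightarrow> L2" where
  "P_inner \<phi> = orth_proj (mult_Hardy \<phi>)"

definition blaschke_factor :: "complex \<Rightarrow> complex \<Rightarrow> complex" where
  "blaschke_factor a z =
     (if a = 0 then z else cnj a / of_real (cmod a) * ((a - z) / (1 - cnj a * z)))"

definition finite_blaschke_product :: "L2 \<Rightarrow> bool" where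
  "finite_blaschke_product \<phi> \<longleftrightarrow>
     (\<exists>c as. cmod c = 1 \<and> (\<forall>a\<in>set as. cmod a < 1) \<and>
        L2_represents (\<lambda>z. c * (\<Prod>a\<leftarrow>as. blaschke_factor a z)) \<phi>)"

(* the holomorphic function on the unit disk whose boundary function is \<phi> *)
definition disk_extension :: "L2 \<Rightarrow> complex \<Rightarrow> complex" where
  "disk_extension \<phi> w = (\<Sum>n. fourier \<phi> (int n) * w ^ n)"

(* zeros in the unit disk, counted with multiplicity (meaningful if there are finitely many) *)
definition zero_count :: "L2 \<Rightarrow> nat" where
  "zero_count \<phi> =
     (\<Sum>w\<in>{w\<in>ball 0 1. disk_extension \<phi> w = 0}. nat (zorder (disk_extension \<phi>) w))"

section \<open>The restricted Grassmannian and the essential class\<close>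

definition Gr_spaces :: "L2 set set" where
  "Gr_spaces = {W. closed_subspace W \<and> fredholm W Hardy P_plus \<and> compact_on W P_minus}"

(* subspaces are identified with their orthogonal projections *)
definition Gr_res :: "(L2 \<Rightarrow> L2) set" where
  "Gr_res = orth_proj ` Gr_spaces"

definition Gr_res_index :: "int \<Rightarrow> (L2 \<Rightarrow> L2) set" where
  "Gr_res_index j = orth_proj ` {W \<in> Gr_spaces. fredholm_index W Hardy P_plus = j}"

definition B_cc :: "(L2 \<Rightarrow> L2) set" where
  "B_cc = {T. bounded_op T \<and> (\<lambda>f. T (P_plus f) - P_plus (T f)) \<in> compact_ops}"

definition essential_class_1 :: "(L2 \<Rightarrow> L2) set" where
  "essential_class_1 = {P \<in> B_cc. is_orth_proj P \<and>
     (let a = calkin_map P; e = calkin_map P_plus; e' = calkin_map P_minus in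
       \<exists>p. calkin_projection p \<and> p \<noteq> \<zero>\<^bsub>calkin\<^esub> \<and> p \<noteq> e \<and>
         e \<otimes>\<^bsub>calkin\<^esub> a \<otimes>\<^bsub>calkin\<^esub> e = p \<and>
         e \<otimes>\<^bsub>calkin\<^esub> a \<otimes>\<^bsub>calkin\<^esub> e' = \<zero>\<^bsub>calkin\<^esub> \<and>
         e' \<otimes>\<^bsub>calkin\<^esub> a \<otimes>\<^bsub>calkin\<^esub> e = \<zero>\<^bsub>calkin\<^esub> \<and>
         e' \<otimes>\<^bsub>calkin\<^esub> a \<otimes>\<^bsub>calkin\<^esub> e' = \<zero>\<^bsub>calkin\<^esub>)}"

end

theory Submission
  imports Defs "HOL-Probability.Probability_Measure"
    "HOL-Computational_Algebra.Fundamental_Theorem_Algebra"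
begin

text \<open>Write \<open>\<phi>\<close> as multiplication by a unimodular \<open>u\<close> and \<open>M = u H\<^sup>2 \<subseteq> H\<^sup>2\<close>. Since \<open>P\<^sub>+\<close> is the
  identity on \<open>M\<close> and \<open>P\<^sub>-\<close> vanishes there, \<open>M\<close> belongs to the restricted Grassmannian iff it has
  finite codimension in \<open>H\<^sup>2\<close>, with index minus that codimension, and \<open>P\<^sub>\<phi>\<close> belongs to the essential
  class iff \<open>P\<^sub>+ - P\<^sub>\<phi>\<close> is not compact. For a finite Blaschke product the Takenaka-Malmquist vectors
  \<open>b\<^sub>1 \<dots> b\<^sub>j k(a\<^sub>j\<^sub>+\<^sub>1)\<close>, with \<open>k(a)\<close> the reproducing kernels, are an orthogonal basis of
  \<open>H\<^sup>2 \<ominus> M\<close>, so the codimension is the number of zeros. Conversely, finite codimension of \<open>M\<close> and compactness of \<open>P\<^sub>+ - P\<^sub>\<phi>\<close> each force \<open>M\<close>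
  to contain a nonzero polynomial \<open>p = u f\<close>, because finitely many linear conditions leave a nonzero
  polynomial; dividing out the roots of \<open>p\<close> one at a time shows that \<open>u\<close> is a finite Blaschke product.\<close>

section \<open>Completeness of \<open>L\<^sup>2\<close>\<close>

text \<open>No factorization theory of inner functions and no boundary limits enter. The value of
  \<open>f\<close> in \<open>Hardy\<close> at \<open>a\<close> is the number
  \<open>cinner f (szego a)\<close>, and divisibility by \<open>z - a\<close> is read off from a
  first-order recursion for Fourier coefficients. This rests on completeness of the exponentials in
  \<open>L2\<close>: \<open>Hardy\<close> is defined by coefficients, whereas its invariance under
  \<open>u\<close> is proved by orthogonality. Finitely many conditions suffice for the polynomial
  because they force the residual of \<open>p\<close> modulo \<open>M\<close> to vanish. In finite
  codimension the residual lies in a finite-dimensional span to which it is orthogonal; under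
  compactness it is a fixed vector of the difference of \<open>P_plus\<close> and
  \<open>orth_proj M\<close>, and the fixed vectors of a compact operator are separated by finitely
  many functionals. The essential class also demands p \<noteq> 0, that is, a projection onto
  \<open>M\<close> that is not compact; this holds because \<open>M\<close> contains
  \<open>u\<close> times every polynomial.\<close>

lemma L2_cases:
  obtains f where "square_integrable f" "x = abs_L2 f"
proof (induction x rule: L2.abs_induct)
  case (1 f)
  then show ?case
    using 1(1) by (auto simp: L2_eq_def)
qed

lemma L2_eq_refl: "square_integrable f \<Longrightarrow> L2_eq f f"
  by (simp add: L2_eq_def)

lemma abs_L2_eq_iff:
  assumes "square_integrable f" "square_integrable g"
  shows "abs_L2 f = abs_L2 g \<longleftrightarrow> (AE z in circle. f z = g z)"
  using Quotient3_rel[OF Quotient3_L2, of f g] assms by (auto simp: L2_eq_def)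

lemma square_integrable_diff:
  "square_integrable f \<Longrightarrow> square_integrable g \<Longrightarrow> square_integrable (\<lambda>z. f z - g z)"
  using square_integrable_add[OF _ square_integrable_uminus] by simp

lemma abs_L2_diff:
  "square_integrable f \<Longrightarrow> square_integrable g \<Longrightarrow> abs_L2 f - abs_L2 g = abs_L2 (\<lambda>z. f z - g z)"
  by (rule minus_L2.abs_eq) (auto intro: L2_eq_refl)

lemma norm_abs_L2:
  assumes "square_integrable f"
  shows "(norm (abs_L2 f))\<^sup>2 = (\<integral>z. (cmod (f z))\<^sup>2 \<partial>circle)"
proof -
  have "(norm (abs_L2 f))\<^sup>2 = Re (cinner (abs_L2 f) (abs_L2 f))"
    by (simp add: power2_norm_eq_inner inner_L2_def)
  also have "\<dots> = Re (\<integral>z. f z * cnj (f z) \<partial>circle)"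
    using assms by (simp add: cinner.abs_eq L2_eq_refl)
  also have "\<dots> = (\<integral>z. (cmod (f z))\<^sup>2 \<partial>circle)"
    by (simp only: complex_norm_square[symmetric] integral_complex_of_real Re_complex_of_real)
  finally show ?thesis .
qed

lemma space_circle [simp]: "space circle = sphere 0 1"
  by (simp add: circle_def)

lemma sets_circle [measurable_cong]: "sets circle = sets (restrict_space borel (sphere 0 1))"
  by (simp add: circle_def)

lemma measurable_cis_circle: "cis \<in> uniform_measure lborel {0..2*pi} \<rightarrow>\<^sub>M restrict_space borel (sphere 0 1)"
proof (rule measurable_restrict_space2)
  have "cis \<in> borel_measurable borel"
    by (intro borel_measurable_continuous_onI continuous_intros)
  then show "cis \<in> borel_measurable (uniform_measure lborel {0..2*pi})"
    by (simp cong: measurable_cong_sets)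
qed auto

lemma prob_space_circle: "prob_space circle"
  unfolding circle_def
  by (intro prob_space.prob_space_distr prob_space_uniform_measure measurable_cis_circle) auto

interpretation circle: prob_space circle
  by (rule prob_space_circle)

lemma square_integrable_const: "square_integrable (\<lambda>_. c)"
  by (simp add: square_integrable_def)

text \<open>The measure has total mass 1, so the inequality is nonnegativity of the variance of
  \<open>cmod (f z)\<close>.\<close>

lemma integrable_norm_if_square_integrable:
  assumes "square_integrable f"
  shows "integrable circle f"
    and "(\<integral>z. cmod (f z) \<partial>circle) \<le> norm (abs_L2 f)"
proof -
  show int: "integrable circle f"
    using square_integrable_prod[OF assms square_integrable_const[of 1]] by simp
  have "(\<integral>z. cmod (f z) \<partial>circle)\<^sup>2 \<le> (\<integral>z. (cmod (f z))\<^sup>2 \<partial>circle)"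
    using circle.variance_eq[of "\<lambda>z. cmod (f z)"] int assms
      Bochner_Integration.integral_nonneg[of circle "\<lambda>x. (cmod (f x) - (\<integral>z. cmod (f z) \<partial>circle))\<^sup>2"]
    by (simp add: square_integrable_def)
  also have "\<dots> = (norm (abs_L2 f))\<^sup>2"
    using norm_abs_L2[OF assms] by simp
  finally show "(\<integral>z. cmod (f z) \<partial>circle) \<le> norm (abs_L2 f)"
    by (rule power2_le_imp_le) simp
qed

text \<open>Riesz-Fischer. A Cauchy sequence is Cauchy in L1 as well, hence has a subsequence
  converging almost everywhere. Fatou's lemma along it carries bounds on mutual distances over to
  distances from the limit function.\<close>

instance L2 :: complete_space
proof
  fix X :: "nat \<Rightarrow> L2" assume X: "Cauchy X"
  have "\<forall>n. \<exists>f. square_integrable f \<and> X n = abs_L2 f"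
    by (metis L2_cases)
  then obtain f where f: "\<And>n. square_integrable (f n)" and Xf: "\<And>n. X n = abs_L2 (f n)"
    by metis
  have [measurable]: "f n \<in> borel_measurable circle" for n
    using f[of n] by (simp add: square_integrable_def)
  have X_dist: "dist (X m) (X n) = norm (abs_L2 (\<lambda>z. f m z - f n z))" for m n
    by (simp add: dist_norm Xf abs_L2_diff f)
  have "\<exists>N. \<forall>i\<ge>N. \<forall>j\<ge>N. (LINT z|circle. norm (f i z - f j z)) < e" if e: "e > 0" for e
  proof -
    obtain N where N: "\<And>m n. m \<ge> N \<Longrightarrow> n \<ge> N \<Longrightarrow> dist (X m) (X n) < e"
      using metric_CauchyD[OF X e] by blast
    have "(LINT z|circle. norm (f i z - f j z)) < e" if "i \<ge> N" "j \<ge> N" for i j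
      using integrable_norm_if_square_integrable(2)[OF square_integrable_diff[OF f[of i] f[of j]]] N[OF that]
      by (simp add: X_dist)
    then show ?thesis by blast
  qed
  from cauchy_L1_AE_cauchy_subseq[of circle f, OF integrable_norm_if_square_integrable(1)[OF f] this]
  obtain r where r: "strict_mono r" and AE_Cauchy: "AE z in circle. Cauchy (\<lambda>i. f (r i) z)" .
  define F where "F z = lim (\<lambda>i. f (r i) z)" for z
  have [measurable]: "F \<in> borel_measurable circle"
    unfolding F_def by (rule borel_measurable_lim_metric) measurable
  have AE_lim: "AE z in circle. (\<lambda>i. f (r i) z) \<longlonglongrightarrow> F z"
    using AE_Cauchy by eventually_elim (simp add: F_def Cauchy_convergent_iff convergent_LIMSEQ_iff)
  have fatou: "(\<integral>\<^sup>+z. ennreal ((cmod (F z - f n z))\<^sup>2) \<partial>circle) \<le> ennreal (e\<^sup>2)"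
    if N: "\<And>m n. m \<ge> N \<Longrightarrow> n \<ge> N \<Longrightarrow> dist (X m) (X n) < e" and n: "n \<ge> N" for n N e
  proof -
    have "(\<integral>\<^sup>+z. ennreal ((cmod (F z - f n z))\<^sup>2) \<partial>circle)
        = (\<integral>\<^sup>+z. liminf (\<lambda>i. ennreal ((cmod (f (r i) z - f n z))\<^sup>2)) \<partial>circle)"
    proof (rule nn_integral_cong_AE, use AE_lim in eventually_elim)
      fix z assume "(\<lambda>i. f (r i) z) \<longlonglongrightarrow> F z"
      then have "(\<lambda>i. ennreal ((cmod (f (r i) z - f n z))\<^sup>2)) \<longlonglongrightarrow> ennreal ((cmod (F z - f n z))\<^sup>2)"
        by (intro tendsto_intros)
      then show "ennreal ((cmod (F z - f n z))\<^sup>2) = liminf (\<lambda>i. ennreal ((cmod (f (r i) z - f n z))\<^sup>2))"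
        using lim_imp_Liminf by force
    qed
    also have "\<dots> \<le> liminf (\<lambda>i. \<integral>\<^sup>+z. ennreal ((cmod (f (r i) z - f n z))\<^sup>2) \<partial>circle)"
      by (rule nn_integral_liminf) measurable
    also have "\<dots> \<le> liminf (\<lambda>i::nat. ennreal (e\<^sup>2))"
    proof (rule Liminf_mono, rule eventually_sequentiallyI[of N])
      fix i assume i: "i \<ge> N"
      have si: "square_integrable (\<lambda>z. f (r i) z - f n z)"
        by (intro square_integrable_diff f)
      have "(\<integral>\<^sup>+z. ennreal ((cmod (f (r i) z - f n z))\<^sup>2) \<partial>circle) = ennreal ((dist (X (r i)) (X n))\<^sup>2)"
        unfolding X_dist norm_abs_L2[OF si]
        by (rule nn_integral_eq_integral) (use si in \<open>auto simp: square_integrable_def\<close>)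
      also have "\<dots> \<le> ennreal (e\<^sup>2)"
        using N[of "r i" n] n i seq_suble[OF r, of i] by (intro ennreal_leI power_mono) auto
      finally show "(\<integral>\<^sup>+z. ennreal ((cmod (f (r i) z - f n z))\<^sup>2) \<partial>circle) \<le> ennreal (e\<^sup>2)" .
    qed
    also have "\<dots> = ennreal (e\<^sup>2)"
      by (simp add: Liminf_const)
    finally show ?thesis .
  qed
  have si_diff: "square_integrable (\<lambda>z. F z - f n z)"
    if N: "\<And>m n. m \<ge> N \<Longrightarrow> n \<ge> N \<Longrightarrow> dist (X m) (X n) < e" and n: "n \<ge> N" for n N e
    unfolding square_integrable_def
  proof (intro conjI integrableI_bounded)
    show "(\<integral>\<^sup>+z. ennreal (norm ((cmod (F z - f n z))\<^sup>2)) \<partial>circle) < \<infinity>"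
      using fatou[OF N n] by (auto simp: top_unique less_top[symmetric])
  qed measurable
  obtain N where N: "\<And>m n. m \<ge> N \<Longrightarrow> n \<ge> N \<Longrightarrow> dist (X m) (X n) < 1"
    using metric_CauchyD[OF X, of 1] by auto
  have F: "square_integrable F"
    using square_integrable_add[OF si_diff[of N 1 N] f[of N]] N by simp
  have "X \<longlonglongrightarrow> abs_L2 F"
  proof (rule metric_LIMSEQ_I)
    fix e :: real assume e: "e > 0"
    obtain N where N: "\<And>m n. m \<ge> N \<Longrightarrow> n \<ge> N \<Longrightarrow> dist (X m) (X n) < e / 2"
      using metric_CauchyD[OF X, of "e / 2"] e by auto
    have "dist (X n) (abs_L2 F) < e" if n: "n \<ge> N" for n
    proof -
      have "ennreal ((dist (abs_L2 F) (X n))\<^sup>2) = (\<integral>\<^sup>+z. ennreal ((cmod (F z - f n z))\<^sup>2) \<partial>circle)"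
        unfolding dist_norm Xf abs_L2_diff[OF F f] norm_abs_L2[OF square_integrable_diff[OF F f]]
        by (rule nn_integral_eq_integral[symmetric])
           (use square_integrable_diff[OF F f[of n]] in \<open>simp_all add: square_integrable_def\<close>)
      also have "\<dots> \<le> ennreal ((e / 2)\<^sup>2)"
        by (rule fatou[OF N n])
      finally have "(dist (abs_L2 F) (X n))\<^sup>2 \<le> (e / 2)\<^sup>2"
        by (rule ennreal_le_iff[THEN iffD1, rotated]) simp
      then have "dist (abs_L2 F) (X n) \<le> e / 2"
        by (rule power2_le_imp_le) (use e in simp)
      then show ?thesis
        unfolding dist_commute[of "X n"] using e by linarith
    qed
    then show "\<exists>no. \<forall>n\<ge>no. dist (X n) (abs_L2 F) < e" by blast
  qed
  then show "convergent X"
    by (rule convergentI)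
qed

section \<open>Hilbert space geometry\<close>

lemma cinner_add_right: "cinner f (g + h) = cinner f g + cinner f h"
  by (subst (1 2 3) cinner_commute) (simp add: cinner_add_left)

lemma cinner_scaleC_right: "cinner f (c *\<^sub>C g) = cnj c * cinner f g"
  by (subst (1 2) cinner_commute) (simp add: cinner_scaleC_left)

lemma cinner_zero_left [simp]: "cinner 0 f = 0"
  using cinner_scaleC_left[of 0 0 f] by simp

lemma cinner_zero_right [simp]: "cinner f 0 = 0"
  by (subst cinner_commute) simp

lemma cinner_diff_left: "cinner (f - g) h = cinner f h - cinner g h"
  using cinner_add_left[of "f - g" g h] by simp

lemma cinner_diff_right: "cinner f (g - h) = cinner f g - cinner f h"
  using cinner_add_right[of f "g - h" h] by simp

lemma cinner_sum_left: "cinner (\<Sum>i\<in>I. F i) g = (\<Sum>i\<in>I. cinner (F i) g)"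
  by (induction I rule: infinite_finite_induct) (simp_all add: cinner_add_left)

lemma cinner_self_norm: "cinner f f = of_real ((norm f)\<^sup>2)"
  by (subst cinner_self) (simp add: power2_norm_eq_inner inner_L2_def)

lemma cinner_self_eq_0_iff [simp]: "cinner f f = 0 \<longleftrightarrow> f = 0"
  by (simp add: cinner_self_norm)

lemma L2_eqI_cinner: "(\<And>h. cinner f h = cinner g h) \<Longrightarrow> f = g"
  using cinner_self_eq_0_iff[of "f - g"] by (simp add: cinner_diff_left)

lemma L2_eqI_cinner_right: "(\<And>h. cinner h f = cinner h g) \<Longrightarrow> f = g"
  using cinner_self_eq_0_iff[of "f - g"] by (simp add: cinner_diff_right)

lemma norm_cinner_le: "cmod (cinner f g) \<le> norm f * norm g"
proof -
  \<comment> \<open>Multiplying by \<open>c\<close> rotates the inner product onto the nonnegative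
    real axis, where the real Cauchy-Schwarz inequality applies.\<close>
  define c where "c = cnj (sgn (cinner f g))"
  have "cmod (cinner f g) = Re (c * cinner f g)"
    unfolding c_def by (simp add: sgn_eq complex_norm_square[symmetric] mult.commute power2_eq_square flip: of_real_mult)
  also have "\<dots> = inner (c *\<^sub>C f) g"
    by (simp add: inner_L2_def cinner_scaleC_left)
  also have "\<dots> \<le> norm (c *\<^sub>C f) * norm g"
    by (rule norm_cauchy_schwarz)
  also have "\<dots> \<le> (1 * norm f) * norm g"
    unfolding norm_scaleC by (intro mult_right_mono) (auto simp: c_def norm_sgn)
  finally show ?thesis by simp
qed

lemma bounded_linear_cinner_left: "bounded_linear (\<lambda>f. cinner f g)"
  by (rule bounded_linear_intro[where K = "norm g"])
     (simp_all add: cinner_add_left cinner_scaleC_left norm_cinner_le scaleR_conv_of_real flip: scaleC_of_real)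

lemma closed_cinner_eq: "closed {f. cinner f g = c}"
  by (intro closed_Collect_eq continuous_on_const linear_continuous_on bounded_linear_cinner_left)

section \<open>Orthogonal projections onto closed subspaces\<close>

lemma orth_projI:
  assumes "L2.subspace W" "g \<in> W" "\<And>h. h \<in> W \<Longrightarrow> cinner (f - g) h = 0"
  shows "orth_proj W f = g"
  unfolding orth_proj_def
proof (rule the_equality)
  fix g' assume g': "g' \<in> W \<and> (\<forall>h\<in>W. cinner (f - g') h = 0)"
  have "g - g' \<in> W"
    using assms g' by (simp add: L2.subspace_diff)
  then have "cinner (f - g') (g - g') - cinner (f - g) (g - g') = 0"
    using assms g' by simp
  then show "g' = g"
    by (simp flip: cinner_diff_left)
qed (use assms in blast)

text \<open>A minimizing sequence is Cauchy: the midpoint of two of its members lies in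
  \<open>S\<close> by convexity, so it is no closer to \<open>a\<close> than the infimum
  \<open>d\<close>, and the parallelogram law then bounds the distance of the two members.\<close>

lemma closest_point_exists_complete:
  fixes S :: "'a::{real_inner, complete_space} set"
  assumes "convex S" "closed S" "S \<noteq> {}"
  shows "\<exists>y\<in>S. \<forall>z\<in>S. dist a y \<le> dist a z"
proof -
  define d where "d = infdist a S"
  have d_le: "d \<le> dist a y" if "y \<in> S" for y
    using that by (simp add: d_def infdist_le)
  have d0: "d \<ge> 0" by (simp add: d_def infdist_nonneg)
  have "\<exists>y\<in>S. dist a y < d + 1 / Suc n" for n
    using cInf_lessD[of "dist a ` S" "d + 1 / Suc n"] assms(3)
    by (auto simp: d_def infdist_notempty)
  then obtain y where y: "\<And>n. y n \<in> S" and y_lt: "\<And>n. dist a (y n) < d + 1 / Suc n"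
    by metis
  have y_diff: "(dist (y m) (y n))\<^sup>2 \<le> 4 * (2 * d * (1 / Suc N) + (1 / Suc N)\<^sup>2)"
    if "m \<ge> N" "n \<ge> N" for m n N
  proof -
    have le: "(norm (a - y k))\<^sup>2 \<le> (d + 1 / Suc N)\<^sup>2" if "k \<ge> N" for k
    proof (rule power_mono)
      have "1 / real (Suc k) \<le> 1 / Suc N" using that by (simp add: field_simps)
      then show "norm (a - y k) \<le> d + 1 / Suc N"
        using y_lt[of k] by (simp add: dist_norm)
    qed simp
    have "(1/2) *\<^sub>R y m + (1/2) *\<^sub>R y n \<in> S"
      using assms(1) y by (intro convexD) auto
    then have "d \<le> norm (a - ((1/2) *\<^sub>R y m + (1/2) *\<^sub>R y n))"
      using d_le by (simp add: dist_norm)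
    then have "d\<^sup>2 \<le> (norm (a - ((1/2) *\<^sub>R y m + (1/2) *\<^sub>R y n)))\<^sup>2"
      using d0 by (intro power_mono)
    moreover have "(norm (y m - y n))\<^sup>2 = 2 * (norm (a - y m))\<^sup>2 + 2 * (norm (a - y n))\<^sup>2
        - 4 * (norm (a - ((1/2) *\<^sub>R y m + (1/2) *\<^sub>R y n)))\<^sup>2"
    proof -
      define u v where "u = a - y m" and "v = a - y n"
      have "a = (1/2) *\<^sub>R a + (1/2) *\<^sub>R a"
        by (simp flip: scaleR_left_distrib)
      then have mid: "a - ((1/2) *\<^sub>R y m + (1/2) *\<^sub>R y n) = (1/2) *\<^sub>R (u + v)"
        by (simp add: u_def v_def scaleR_diff_right scaleR_add_right)
      have "(norm (v - u))\<^sup>2 = 2 * (norm u)\<^sup>2 + 2 * (norm v)\<^sup>2 - (norm (v + u))\<^sup>2"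
      proof -
        \<comment> \<open>The rules \<open>dot_norm\<close> and \<open>dot_norm_neg\<close> express
          one inner product in two ways; eliminating it yields the parallelogram law.\<close>
        have "P = 2 * Q + 2 * R - S" if "x = (S - R - Q) / 2" "x = (R + Q - P) / 2" for x P Q R S :: real
          using that by (simp add: field_simps)
        from this[OF dot_norm dot_norm_neg] show ?thesis .
      qed
      moreover have "v - u = y m - y n"
        by (simp add: u_def v_def)
      moreover have "(norm ((1/2) *\<^sub>R (u + v)))\<^sup>2 = (norm (v + u))\<^sup>2 / 4"
        by (simp add: power_divide add.commute)
      ultimately show ?thesis
        unfolding mid u_def[symmetric] v_def[symmetric] by simp
    qed
    ultimately have "(norm (y m - y n))\<^sup>2 \<le> 4 * (d + 1 / Suc N)\<^sup>2 - 4 * d\<^sup>2"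
      using le[OF that(1)] le[OF that(2)] by linarith
    also have "\<dots> = 4 * (2 * d * (1 / Suc N) + (1 / Suc N)\<^sup>2)"
    proof -
      have "4 * (d + t)\<^sup>2 - 4 * d\<^sup>2 = 4 * (2 * d * t + t\<^sup>2)" for t
        by (simp add: power2_sum)
      then show ?thesis .
    qed
    finally show ?thesis by (simp add: dist_norm)
  qed
  have "Cauchy y"
  proof (rule metric_CauchyI)
    fix e :: real assume e: "e > 0"
    have "(\<lambda>N. 4 * (2 * d * (1 / Suc N) + (1 / Suc N)\<^sup>2)) \<longlonglongrightarrow> 4 * (2 * d * 0 + 0\<^sup>2)"
      by (intro tendsto_intros LIMSEQ_Suc[OF lim_1_over_n])
    then have "\<forall>\<^sub>F N in sequentially. 4 * (2 * d * (1 / Suc N) + (1 / Suc N)\<^sup>2) < e\<^sup>2"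
      by (rule order_tendstoD) (use e in simp)
    from eventually_happens'[OF sequentially_bot this]
    obtain N where N: "4 * (2 * d * (1 / Suc N) + (1 / Suc N)\<^sup>2) < e\<^sup>2" ..
    have "dist (y m) (y n) < e" if "m \<ge> N" "n \<ge> N" for m n
      by (rule power_less_imp_less_base[OF le_less_trans[OF y_diff[OF that] N]]) (use e in simp)
    then show "\<exists>M. \<forall>m\<ge>M. \<forall>n\<ge>M. dist (y m) (y n) < e" by blast
  qed
  then obtain l where l: "y \<longlonglongrightarrow> l"
    by (auto simp: Cauchy_convergent_iff convergent_def)
  have "l \<in> S"
    using closed_sequentially[OF assms(2)] y l by blast
  moreover have "dist a l \<le> d"
  proof (rule LIMSEQ_le)
    show "(\<lambda>n. dist a (y n)) \<longlonglongrightarrow> dist a l"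
      by (intro tendsto_intros l)
    have "(\<lambda>n. d + 1 / Suc n) \<longlonglongrightarrow> d + 0"
      by (intro tendsto_intros LIMSEQ_Suc[OF lim_1_over_n])
    then show "(\<lambda>n. d + 1 / Suc n) \<longlonglongrightarrow> d" by simp
    show "\<exists>N. \<forall>n\<ge>N. dist a (y n) \<le> d + 1 / Suc n"
      using y_lt less_imp_le by blast
  qed
  ultimately show ?thesis
    using d_le by (meson order_trans)
qed

text \<open>The closest point satisfies a real variational inequality. Applied to \<open>h\<close>
  and \<open>- h\<close> it kills the real part of the inner product; applied to \<open>h\<close>
  multiplied by the imaginary unit it kills the imaginary part.\<close>

lemma orth_proj:
  assumes "closed_subspace W"
  shows orth_proj_in: "orth_proj W f \<in> W"
    and orth_proj_orth: "h \<in> W \<Longrightarrow> cinner (f - orth_proj W f) h = 0"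
proof -
  have W: "L2.subspace W" "closed W"
    using assms by (simp_all add: closed_subspace_def)
  have scaleR_W: "r *\<^sub>R x \<in> W" if "x \<in> W" for r x
    using L2.subspace_scale[OF W(1) that, of "of_real r"] by (simp add: scaleC_of_real)
  have "convex W"
    using W(1) by (intro convexI) (simp add: L2.subspace_add scaleR_W)
  moreover have "W \<noteq> {}"
    using L2.subspace_0[OF W(1)] by blast
  ultimately obtain y where y: "y \<in> W" "\<forall>z\<in>W. dist f y \<le> dist f z"
    using closest_point_exists_complete W(2) by blast
  have inner_le: "inner (f - y) h \<le> 0" if "h \<in> W" for h
    using any_closest_point_dot[OF \<open>convex W\<close> W(2) y(1) L2.subspace_add[OF W(1) y(1) that] y(2)] by simp
  have inner_0: "inner (f - y) h = 0" if "h \<in> W" for h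
    using inner_le[OF that] inner_le[OF L2.subspace_neg[OF W(1) that]] by simp
  have orth: "cinner (f - y) h = 0" if h: "h \<in> W" for h
  proof (rule complex_eqI)
    show "Re (cinner (f - y) h) = Re 0"
      using inner_0[OF h] by (simp add: inner_L2_def)
    show "Im (cinner (f - y) h) = Im 0"
      using inner_0[OF L2.subspace_scale[OF W(1) h, of "\<i>"]] by (simp add: inner_L2_def cinner_scaleC_right)
  qed
  have eq: "orth_proj W f = y"
    by (rule orth_projI[OF W(1) y(1) orth])
  show "orth_proj W f \<in> W" using eq y by simp
  show "h \<in> W \<Longrightarrow> cinner (f - orth_proj W f) h = 0" using eq orth by simp
qed

lemma orth_proj_id: "L2.subspace W \<Longrightarrow> f \<in> W \<Longrightarrow> orth_proj W f = f"
  by (rule orth_projI) auto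

lemma orth_proj_eq_0:
  assumes "L2.subspace W" "\<And>h. h \<in> W \<Longrightarrow> cinner f h = 0"
  shows "orth_proj W f = 0"
  using assms by (intro orth_projI) (auto simp: L2.subspace_0)

text \<open>Self-adjointness comes first, straight from the orthogonality of the residuals;
  linearity then follows by testing against all vectors.\<close>

lemma is_orth_proj_orth_proj:
  assumes "closed_subspace W"
  shows "is_orth_proj (orth_proj W)"
proof -
  note P = orth_proj_in[OF assms] orth_proj_orth[OF assms]
  have W: "L2.subspace W"
    using assms by (simp add: closed_subspace_def)
  have selfadj: "cinner (orth_proj W f) g = cinner f (orth_proj W g)" for f g
  proof -
    have "cinner (orth_proj W f) (g - orth_proj W g) = 0"
      by (subst cinner_commute) (simp add: P)
    moreover have "cinner (f - orth_proj W f) (orth_proj W g) = 0"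
      by (simp add: P)
    ultimately show ?thesis
      by (simp add: cinner_diff_left cinner_diff_right)
  qed
  have "bounded_op (orth_proj W)"
  proof (rule bounded_opI[where K = 1])
    show "orth_proj W (f + g) = orth_proj W f + orth_proj W g" for f g
      by (rule L2_eqI_cinner) (simp add: selfadj cinner_add_left)
    show "orth_proj W (c *\<^sub>C f) = c *\<^sub>C orth_proj W f" for c f
      by (rule L2_eqI_cinner) (simp add: selfadj cinner_scaleC_left)
    fix f
    have "(norm (orth_proj W f))\<^sup>2 = cmod (cinner (orth_proj W f) (orth_proj W f))"
      unfolding cinner_self_norm by (simp add: norm_power)
    also have "\<dots> = cmod (cinner f (orth_proj W f))"
      unfolding selfadj by (simp add: orth_proj_id[OF W P(1)])
    also have "\<dots> \<le> norm f * norm (orth_proj W f)"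
      by (rule norm_cinner_le)
    finally show "norm (orth_proj W f) \<le> norm f * 1"
      by (cases "norm (orth_proj W f) = 0") (simp_all add: power2_eq_square)
  qed
  then show ?thesis
    using selfadj orth_proj_id[OF W P(1)] by (auto simp: is_orth_proj_def)
qed

lemma orth_proj_inject:
  assumes "closed_subspace W" "closed_subspace V" "orth_proj W = orth_proj V"
  shows "W = V"
  using assms orth_proj_in orth_proj_id unfolding closed_subspace_def
  by (metis subsetI subset_antisym)

section \<open>Riesz representation and adjoints\<close>

lemma riesz_representation:
  assumes add: "\<And>f g. l (f + g) = l f + l g" and scale: "\<And>c f. l (c *\<^sub>C f) = c * l f"
    and bound: "\<And>f. cmod (l f) \<le> norm f * K"
  shows "\<exists>g. \<forall>f. l f = cinner f g"
proof (cases "\<forall>f. l f = 0")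
  case True
  then show ?thesis by (intro exI[of _ 0]) simp
next
  case False
  then obtain f0 where f0: "l f0 \<noteq> 0" by blast
  define W where "W = {f. l f = 0}"
  have "bounded_linear l"
    by (rule bounded_linear_intro[where K = K])
       (simp_all add: add scale bound scaleR_conv_of_real flip: scaleC_of_real)
  then have "closed W"
    unfolding W_def by (intro closed_Collect_eq continuous_on_const linear_continuous_on)
  moreover have "L2.subspace W"
    using scale[of 0 0] by (auto simp: W_def L2.subspace_def add scale)
  ultimately have W: "closed_subspace W"
    by (simp add: closed_subspace_def)
  define u where "u = f0 - orth_proj W f0"
  have "l u = l f0"
    using add[of u "orth_proj W f0"] orth_proj_in[OF W, of f0] by (simp add: u_def W_def)
  then have lu: "l u \<noteq> 0" using f0 by simp
  then have "u \<noteq> 0" using scale[of 0 0] by auto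
  \<comment> \<open>Subtracting the multiple \<open>l f / l u\<close> of \<open>u\<close> from
    \<open>f\<close> gives a vector of the kernel, which is orthogonal to \<open>u\<close>. Solving
    for \<open>l f\<close> produces this representing vector.\<close>
  have "l f = cinner f ((cnj (l u) / cinner u u) *\<^sub>C u)" for f
  proof -
    have "l (f - (l f / l u) *\<^sub>C u) = 0"
      using add[of "f - (l f / l u) *\<^sub>C u" "(l f / l u) *\<^sub>C u"] lu by (simp add: scale)
    then have "cinner u (f - (l f / l u) *\<^sub>C u) = 0"
      unfolding u_def by (intro orth_proj_orth[OF W]) (simp add: W_def)
    then have "cinner (f - (l f / l u) *\<^sub>C u) u = 0"
      by (subst cinner_commute) simp
    then have "cinner f u = l f / l u * cinner u u"
      by (simp add: cinner_diff_left cinner_scaleC_left)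
    then show ?thesis
      using lu \<open>u \<noteq> 0\<close> by (simp add: cinner_scaleC_right cinner_commute[of u u, symmetric])
  qed
  then show ?thesis by blast
qed

lemma adjoint_exists:
  assumes "bounded_op T"
  shows "\<exists>S. bounded_op S \<and> (\<forall>f g. cinner (T f) g = cinner f (S g))"
proof -
  have lin: "T (f + g) = T f + T g" "T (c *\<^sub>C f) = c *\<^sub>C T f" for c f g
    using assms by (auto simp: bounded_op_def linear_simps)
  obtain K where K: "K > 0" "\<And>f. norm (T f) \<le> norm f * K"
    using assms bounded_linear.pos_bounded unfolding bounded_op_def by blast
  have le: "cmod (cinner (T f) g) \<le> norm f * (K * norm g)" for f g
    using norm_cinner_le[of "T f" g] mult_right_mono[OF K(2)[of f], of "norm g"] by (simp add: mult.assoc)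
  have "\<exists>h. \<forall>f. cinner (T f) g = cinner f h" for g
    by (rule riesz_representation[where K = "K * norm g"])
       (simp_all add: lin cinner_add_left cinner_scaleC_left le)
  then obtain S where S: "\<And>f g. cinner (T f) g = cinner f (S g)"
    by metis
  have "bounded_op S"
  proof (rule bounded_opI[where K = K])
    show "S (f + g) = S f + S g" for f g
      by (rule L2_eqI_cinner_right) (simp add: cinner_add_right flip: S)
    show "S (c *\<^sub>C f) = c *\<^sub>C S f" for c f
      by (rule L2_eqI_cinner_right) (simp add: cinner_scaleC_right flip: S)
    fix g
    have "(norm (S g))\<^sup>2 = cmod (cinner (S g) (S g))"
      unfolding cinner_self_norm by (simp add: norm_power)
    also have "\<dots> = cmod (cinner (T (S g)) g)"
      by (simp add: S)
    also have "\<dots> \<le> norm (S g) * (norm g * K)"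
      using le[of "S g" g] by (simp add: mult.commute)
    finally show "norm (S g) \<le> norm g * K"
      using K(1) by (cases "norm (S g) = 0") (simp_all add: power2_eq_square)
  qed
  with S show ?thesis by blast
qed

lemma adjoint_op_eqI:
  assumes "bounded_op S" "\<And>f g. cinner (T f) g = cinner f (S g)"
  shows "adjoint_op T = S"
  unfolding adjoint_op_def
proof (rule the_equality)
  fix S' assume S': "bounded_op S' \<and> (\<forall>f g. cinner (T f) g = cinner f (S' g))"
  show "S' = S"
    by (rule ext, rule L2_eqI_cinner_right) (metis S' assms(2))
qed (use assms in blast)

lemma
  assumes "bounded_op T"
  shows bounded_op_adjoint: "bounded_op (adjoint_op T)"
    and cinner_adjoint: "cinner (T f) g = cinner f (adjoint_op T g)"
  using adjoint_exists[OF assms] adjoint_op_eqI by blast+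

section \<open>Compact operators through finite nets\<close>

lemma compact_on_finite_net:
  assumes "compact_on V T" "e > 0"
  shows "\<exists>F. finite F \<and> F \<subseteq> V \<inter> cball 0 1 \<and> (\<forall>f\<in>V \<inter> cball 0 1. \<exists>g\<in>F. dist (T g) (T f) < e)"
proof -
  have "closure (T ` (V \<inter> cball 0 1)) \<subseteq> (\<Union>g\<in>V \<inter> cball 0 1. ball (T g) e)"
    using assms(2) by (auto simp: closure_approachable)
  then obtain F where F: "F \<subseteq> V \<inter> cball 0 1" "finite F"
      "closure (T ` (V \<inter> cball 0 1)) \<subseteq> (\<Union>g\<in>F. ball (T g) e)"
    by (rule compactE_image[OF assms(1)[unfolded compact_on_def] open_ball])
  have "\<exists>g\<in>F. dist (T g) (T f) < e" if "f \<in> V \<inter> cball 0 1" for f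
    using F(3) that closure_subset[of "T ` (V \<inter> cball 0 1)"] by fastforce
  then show ?thesis
    using F(1,2) by (intro exI[of _ F] conjI ballI)
qed

text \<open>Since \<open>L2\<close> is complete, total boundedness suffices. A net at half the
  radius absorbs the passage to the closure.\<close>

lemma compact_onI_finite_net:
  assumes "\<And>e. e > 0 \<Longrightarrow> \<exists>F. finite F \<and> (\<forall>f\<in>V \<inter> cball 0 1. \<exists>g\<in>F. dist (T g) (T f) < e)"
  shows "compact_on V T"
  unfolding compact_on_def compact_eq_totally_bounded
proof (intro conjI allI impI)
  show "complete (closure (T ` (V \<inter> cball 0 1)))"
    by (simp add: complete_eq_closed)
  fix e :: real assume "e > 0"
  then obtain F where F: "finite F" "\<And>f. f \<in> V \<inter> cball 0 1 \<Longrightarrow> \<exists>g\<in>F. dist (T g) (T f) < e / 2"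
    using assms[of "e / 2"] half_gt_zero by blast
  have "closure (T ` (V \<inter> cball 0 1)) \<subseteq> (\<Union>x\<in>T ` F. ball x e)"
  proof
    fix y assume "y \<in> closure (T ` (V \<inter> cball 0 1))"
    then have "\<exists>x\<in>T ` (V \<inter> cball 0 1). dist x y < e / 2"
      unfolding closure_approachable using half_gt_zero[OF \<open>e > 0\<close>] by blast
    then obtain f where f: "f \<in> V \<inter> cball 0 1" "dist (T f) y < e / 2"
      by blast
    obtain g where "g \<in> F" "dist (T g) (T f) < e / 2"
      using F(2)[OF f(1)] by blast
    then have "y \<in> ball (T g) e"
      using dist_triangle_half_r[of "T f" "T g" e y] f(2) by (simp add: dist_commute)
    then show "y \<in> (\<Union>x\<in>T ` F. ball x e)"
      using \<open>g \<in> F\<close> by blast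
  qed
  then show "\<exists>k. finite k \<and> closure (T ` (V \<inter> cball 0 1)) \<subseteq> (\<Union>x\<in>k. ball x e)"
    using F(1) by blast
qed

text \<open>With \<open>S\<close> the adjoint of \<open>T\<close>, \<open>\<parallel>S h\<parallel>\<^sup>2 = \<langle>T (S h), h\<rangle>\<close>, and \<open>T S\<close> is compact.\<close>
lemma adjoint_compact:
  assumes "T \<in> compact_ops"
  shows "adjoint_op T \<in> compact_ops"
proof -
  have T: "bounded_op T" "compact_on UNIV T"
    using assms by (auto simp: compact_ops_def)
  define S where "S = adjoint_op T"
  have S: "bounded_op S" and TS: "\<And>f g. cinner (T f) g = cinner f (S g)"
    using bounded_op_adjoint[OF T(1)] cinner_adjoint[OF T(1)] by (auto simp: S_def)
  have comp: "compact_on UNIV (T \<circ> S)"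
    using T S by (intro compact_on_comp_right) (auto simp: bounded_op_def)
  have TS_diff: "(T \<circ> S) (f - g) = (T \<circ> S) f - (T \<circ> S) g" "S (f - g) = S f - S g" for f g
    using bounded_op_comp[OF T(1) S] S linear_diff[of "T \<circ> S" f g] linear_diff[of S f g]
    by (simp_all add: bounded_op_def bounded_linear.linear del: o_apply)
  have "compact_on UNIV S"
  proof (rule compact_onI_finite_net)
    fix e :: real assume e: "e > 0"
    \<comment> \<open>Points of the unit ball differ by at most 2 in norm, so this radius bounds the
      squared distance of their images under \<open>S\<close> by \<open>e\<^sup>2\<close>.\<close>
    obtain F where F: "finite F" "F \<subseteq> cball 0 1"
        "\<And>f. f \<in> cball 0 1 \<Longrightarrow> \<exists>g\<in>F. dist ((T \<circ> S) g) ((T \<circ> S) f) < e\<^sup>2 / 2"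
      using compact_on_finite_net[OF comp, of "e\<^sup>2 / 2"] e by auto
    have "\<exists>g\<in>F. dist (S g) (S f) < e" if f: "f \<in> cball 0 1" for f
    proof -
      obtain g where g: "g \<in> F" "dist ((T \<circ> S) g) ((T \<circ> S) f) < e\<^sup>2 / 2"
        using F(3)[OF f] by blast
      have "norm (g - f) \<le> 2"
        using F(2) g(1) f norm_triangle_ineq4[of g f] by (fastforce simp: subset_iff)
      have "(norm (S (g - f)))\<^sup>2 = cmod (cinner (S (g - f)) (S (g - f)))"
        unfolding cinner_self_norm by (simp add: norm_power)
      also have "\<dots> = cmod (cinner ((T \<circ> S) (g - f)) (g - f))"
        by (simp add: TS)
      also have "\<dots> \<le> norm ((T \<circ> S) (g - f)) * norm (g - f)"
        by (rule norm_cinner_le)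
      also have "\<dots> \<le> norm ((T \<circ> S) (g - f)) * 2"
        using \<open>norm (g - f) \<le> 2\<close> by (intro mult_left_mono) auto
      also have "\<dots> < e\<^sup>2"
        using g(2) unfolding TS_diff dist_norm by simp
      finally have "norm (S (g - f)) < e"
        by (rule power_less_imp_less_base) (use e in simp)
      then show ?thesis
        using g(1) by (intro bexI[of _ g]) (simp_all add: TS_diff dist_norm)
    qed
    with F(1) show "\<exists>F. finite F \<and> (\<forall>f\<in>UNIV \<inter> cball 0 1. \<exists>g\<in>F. dist (S g) (S f) < e)"
      by auto
  qed
  with S show ?thesis
    by (simp add: compact_ops_def S_def)
qed

lemma rank_one_compact: "(\<lambda>f. cinner f a *\<^sub>C b) \<in> compact_ops"
proof -
  have "bounded_op (\<lambda>f. cinner f a *\<^sub>C b)"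
  proof (rule bounded_opI[where K = "norm a * norm b"])
    show "norm (cinner f a *\<^sub>C b) \<le> norm f * (norm a * norm b)" for f
      using mult_right_mono[OF norm_cinner_le[of f a], of "norm b"] by (simp add: norm_scaleC mult.assoc)
  qed (simp_all add: cinner_add_left cinner_scaleC_left L2.scale_left_distrib)
  moreover have "compact_on UNIV (\<lambda>f. cinner f a *\<^sub>C b)"
  proof (rule compact_on_if_subset)
    have "bounded_linear (\<lambda>c. c *\<^sub>C b)"
      by (rule bounded_linear_intro[where K = "norm b"])
         (simp_all add: L2.scale_left_distrib norm_scaleC scaleR_conv_of_real flip: scaleC_of_real)
    then show "compact ((\<lambda>c. c *\<^sub>C b) ` cball 0 (norm a))"
      by (intro compact_continuous_image linear_continuous_on) auto
    have "cmod (cinner f a) \<le> norm a" if "norm f \<le> 1" for f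
      using norm_cinner_le[of f a] mult_right_mono[OF that, of "norm a"] by simp
    then show "(\<lambda>f. cinner f a *\<^sub>C b) ` (UNIV \<inter> cball 0 1) \<subseteq> (\<lambda>c. c *\<^sub>C b) ` cball 0 (norm a)"
      by auto
  qed
  ultimately show ?thesis by (simp add: compact_ops_def)
qed

lemma finite_rank_compact: "(\<lambda>f. \<Sum>e\<in>N. cinner f (a e) *\<^sub>C b e) \<in> compact_ops"
proof (induction N rule: infinite_finite_induct)
  case (insert x N)
  have "bounded_op (\<lambda>f. cinner f (a x) *\<^sub>C b x + (\<Sum>e\<in>N. cinner f (a e) *\<^sub>C b e))"
    and "compact_on UNIV (\<lambda>f. cinner f (a x) *\<^sub>C b x + (\<Sum>e\<in>N. cinner f (a e) *\<^sub>C b e))"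
    using insert rank_one_compact[of "a x" "b x"]
    by (auto simp: compact_ops_def intro!: bounded_op_add compact_on_add)
  then show ?case
    using insert by (simp add: compact_ops_def)
qed (use rank_one_compact[of 0 0] in simp_all)

section \<open>Multiplication operators\<close>

text \<open>The bound is imposed at every point of the circle and not just almost everywhere, so
  that symbols can be multiplied and compared pointwise.\<close>

definition bounded_mult :: "(complex \<Rightarrow> complex) \<Rightarrow> bool" where
  "bounded_mult u \<longleftrightarrow> u \<in> borel_measurable circle \<and> (\<exists>C. \<forall>z\<in>sphere 0 1. cmod (u z) \<le> C)"

lemma borel_measurable_circle:
  "u \<in> borel_measurable borel \<Longrightarrow> u \<in> borel_measurable circle"
  unfolding measurable_cong_sets[OF sets_circle refl] by (rule measurable_restrict_space1)

lemma borel_measurable_circle_continuous: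
  "continuous_on (sphere 0 1) u \<Longrightarrow> u \<in> borel_measurable circle"
  unfolding measurable_cong_sets[OF sets_circle refl] by (rule borel_measurable_continuous_on_restrict)

lemma bounded_mult_continuous:
  assumes "continuous_on (sphere 0 1) u"
  shows "bounded_mult u"
proof -
  have "bounded (u ` sphere 0 1)"
    by (intro compact_imp_bounded compact_continuous_image assms) auto
  then show ?thesis
    using borel_measurable_circle_continuous[OF assms]
    by (auto simp: bounded_mult_def bounded_iff)
qed

lemma bounded_mult_const [simp]: "bounded_mult (\<lambda>_. c)"
  by (intro bounded_mult_continuous continuous_intros)

lemma bounded_mult_ident [simp]: "bounded_mult (\<lambda>z. z)"
  by (intro bounded_mult_continuous continuous_intros)

lemma bounded_mult_power_int [simp]: "bounded_mult (\<lambda>z. z powi n)"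
  by (intro bounded_mult_continuous continuous_intros) auto

lemma bounded_mult_times [simp]:
  assumes "bounded_mult u" "bounded_mult v"
  shows "bounded_mult (\<lambda>z. u z * v z)"
proof -
  obtain C D where CD: "\<And>z. z \<in> sphere 0 1 \<Longrightarrow> cmod (u z) \<le> C" "\<And>z. z \<in> sphere 0 1 \<Longrightarrow> cmod (v z) \<le> D"
    using assms unfolding bounded_mult_def by meson
  have "cmod (u z * v z) \<le> C * D" if "z \<in> sphere 0 1" for z
    unfolding norm_mult
    by (rule mult_mono[OF CD[OF that] order_trans[OF norm_ge_zero CD(1)[OF that]] norm_ge_zero])
  moreover have "(\<lambda>z. u z * v z) \<in> borel_measurable circle"
    using assms by (auto simp: bounded_mult_def)
  ultimately show ?thesis
    unfolding bounded_mult_def by blast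
qed

lemma bounded_mult_add [simp]:
  assumes "bounded_mult u" "bounded_mult v"
  shows "bounded_mult (\<lambda>z. u z + v z)"
proof -
  obtain C D where CD: "\<And>z. z \<in> sphere 0 1 \<Longrightarrow> cmod (u z) \<le> C" "\<And>z. z \<in> sphere 0 1 \<Longrightarrow> cmod (v z) \<le> D"
    using assms unfolding bounded_mult_def by meson
  have "cmod (u z + v z) \<le> C + D" if "z \<in> sphere 0 1" for z
    using norm_triangle_ineq[of "u z" "v z"] CD[OF that] by linarith
  moreover have "(\<lambda>z. u z + v z) \<in> borel_measurable circle"
    using assms by (auto simp: bounded_mult_def)
  ultimately show ?thesis
    unfolding bounded_mult_def by blast
qed

lemma bounded_mult_diff [simp]:
  assumes "bounded_mult u" "bounded_mult v"
  shows "bounded_mult (\<lambda>z. u z - v z)"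
  using bounded_mult_add[OF assms(1) bounded_mult_times[OF bounded_mult_const[of "-1"] assms(2)]] by simp

lemma bounded_mult_cnj [simp]:
  assumes "bounded_mult u"
  shows "bounded_mult (\<lambda>z. cnj (u z))"
proof -
  have "cnj \<in> borel_measurable borel"
    by (intro borel_measurable_continuous_onI continuous_intros)
  then have "(\<lambda>z. cnj (u z)) \<in> borel_measurable circle"
    using assms measurable_compose[of u circle borel cnj borel] by (simp add: bounded_mult_def)
  then show ?thesis
    using assms by (simp add: bounded_mult_def)
qed

lemma square_integrable_mult:
  assumes "bounded_mult u" "square_integrable f"
  shows "square_integrable (\<lambda>z. u z * f z)"
proof -
  obtain C where C: "\<And>z. z \<in> sphere 0 1 \<Longrightarrow> cmod (u z) \<le> C"
    using assms unfolding bounded_mult_def by blast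
  have [measurable]: "u \<in> borel_measurable circle" "f \<in> borel_measurable circle"
    using assms by (simp_all add: bounded_mult_def square_integrable_def)
  have "integrable circle (\<lambda>z. (cmod (u z * f z))\<^sup>2)"
  proof (rule Bochner_Integration.integrable_bound)
    show "integrable circle (\<lambda>z. C\<^sup>2 * (cmod (f z))\<^sup>2)"
      using assms(2) by (simp add: square_integrable_def)
    show "AE z in circle. norm ((cmod (u z * f z))\<^sup>2) \<le> norm (C\<^sup>2 * (cmod (f z))\<^sup>2)"
    proof (rule AE_I2)
      fix z assume "z \<in> space circle"
      then have "(cmod (u z))\<^sup>2 * (cmod (f z))\<^sup>2 \<le> C\<^sup>2 * (cmod (f z))\<^sup>2"
        using C by (intro mult_right_mono power_mono) simp_all
      then show "norm ((cmod (u z * f z))\<^sup>2) \<le> norm (C\<^sup>2 * (cmod (f z))\<^sup>2)"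
        by (simp add: norm_mult power_mult_distrib)
    qed
  qed measurable
  then show ?thesis
    by (simp add: square_integrable_def)
qed

text \<open>The default 0 keeps the operator total: the product with an unbounded symbol need not be
  square integrable.\<close>

lift_definition Mult :: "(complex \<Rightarrow> complex) \<Rightarrow> L2 \<Rightarrow> L2" is
  "\<lambda>u f z. if bounded_mult u then u z * f z else 0"
proof -
  fix u and f g :: "complex \<Rightarrow> complex" assume "L2_eq f g"
  then show "L2_eq (\<lambda>z. if bounded_mult u then u z * f z else 0)
      (\<lambda>z. if bounded_mult u then u z * g z else 0)"
    by (cases "bounded_mult u") (auto simp: L2_eq_def square_integrable_mult square_integrable_zero)
qed

lemma Mult_abs_L2: "bounded_mult u \<Longrightarrow> square_integrable f \<Longrightarrow> Mult u (abs_L2 f) = abs_L2 (\<lambda>z. u z * f z)"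
  by (simp add: Mult.abs_eq L2_eq_refl)

lemma abs_L2_cong:
  assumes "square_integrable f" "square_integrable g" "\<And>z. z \<in> sphere 0 1 \<Longrightarrow> f z = g z"
  shows "abs_L2 f = abs_L2 g"
  unfolding abs_L2_eq_iff[OF assms(1,2)] using assms(3) by (intro AE_I2) simp

lemma abs_L2_plus: "square_integrable f \<Longrightarrow> square_integrable g \<Longrightarrow> abs_L2 f + abs_L2 g = abs_L2 (\<lambda>z. f z + g z)"
  by (rule plus_L2.abs_eq) (auto intro: L2_eq_refl)

lemma abs_L2_scaleC: "square_integrable f \<Longrightarrow> c *\<^sub>C abs_L2 f = abs_L2 (\<lambda>z. c * f z)"
  by (rule scaleC.abs_eq) (auto intro: L2_eq_refl)

section \<open>Algebra of multiplication operators\<close>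

lemma Mult_cong:
  assumes "bounded_mult u" "bounded_mult v" "\<And>z. cmod z = 1 \<Longrightarrow> u z = v z"
  shows "Mult u f = Mult v f"
  by (rule L2_cases[of f]) (use assms in \<open>auto simp: Mult_abs_L2 square_integrable_mult intro!: abs_L2_cong\<close>)

lemma Mult_Mult:
  assumes "bounded_mult u" "bounded_mult v"
  shows "Mult u (Mult v f) = Mult (\<lambda>z. u z * v z) f"
  by (rule L2_cases[of f]) (use assms in \<open>simp add: Mult_abs_L2 square_integrable_mult mult.assoc\<close>)

lemma Mult_add_right:
  assumes "bounded_mult u"
  shows "Mult u (f + g) = Mult u f + Mult u g"
  by (rule L2_cases[of f]; rule L2_cases[of g])
     (use assms in \<open>simp add: Mult_abs_L2 square_integrable_mult abs_L2_plus square_integrable_add distrib_left\<close>)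

lemma Mult_scaleC_right:
  assumes "bounded_mult u"
  shows "Mult u (c *\<^sub>C f) = c *\<^sub>C Mult u f"
  by (rule L2_cases[of f])
     (use assms in \<open>simp add: Mult_abs_L2 square_integrable_mult abs_L2_scaleC square_integrable_scale mult.left_commute\<close>)

lemma Mult_diff_right:
  assumes "bounded_mult u"
  shows "Mult u (f - g) = Mult u f - Mult u g"
  using Mult_add_right[OF assms, of "f - g" g] by simp

lemma Mult_zero_right [simp]: "bounded_mult u \<Longrightarrow> Mult u 0 = 0"
  using Mult_add_right[of u 0 0] by simp

lemma Mult_add_left:
  assumes "bounded_mult u" "bounded_mult v"
  shows "Mult (\<lambda>z. u z + v z) f = Mult u f + Mult v f"
  by (rule L2_cases[of f])
     (use assms in \<open>simp add: Mult_abs_L2 square_integrable_mult abs_L2_plus distrib_right\<close>)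

lemma Mult_const [simp]: "Mult (\<lambda>_. c) f = c *\<^sub>C f"
  by (rule L2_cases[of f]) (simp add: Mult_abs_L2 abs_L2_scaleC)

lemma Mult_scaleC_left:
  assumes "bounded_mult u"
  shows "Mult (\<lambda>z. c * u z) f = c *\<^sub>C Mult u f"
  using Mult_Mult[OF bounded_mult_const[of c] assms, of f] by simp

lemma Mult_diff_left:
  assumes "bounded_mult u" "bounded_mult v"
  shows "Mult (\<lambda>z. u z - v z) f = Mult u f - Mult v f"
  using Mult_add_left[of "\<lambda>z. u z - v z" v f] assms by simp

lemma cinner_abs_L2:
  "square_integrable f \<Longrightarrow> square_integrable g \<Longrightarrow>
    cinner (abs_L2 f) (abs_L2 g) = (\<integral>z. f z * cnj (g z) \<partial>circle)"
  by (simp add: cinner.abs_eq L2_eq_refl)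

lemma cinner_Mult_left:
  assumes "bounded_mult u"
  shows "cinner (Mult u f) g = cinner f (Mult (\<lambda>z. cnj (u z)) g)"
  by (rule L2_cases[of f]; rule L2_cases[of g])
     (use assms in \<open>simp add: Mult_abs_L2 square_integrable_mult cinner_abs_L2\<close>, simp add: mult_ac)

lemma norm_Mult_le:
  assumes "bounded_mult u" "\<And>z. cmod z = 1 \<Longrightarrow> cmod (u z) \<le> C"
  shows "norm (Mult u f) \<le> C * norm f"
proof -
  obtain F where F: "square_integrable F" "f = abs_L2 F"
    using L2_cases by blast
  have "0 \<le> cmod (u 1)" by simp
  also have "\<dots> \<le> C" by (rule assms) simp
  finally have "0 \<le> C" .
  have "(norm (Mult u f))\<^sup>2 = (\<integral>z. (cmod (u z * F z))\<^sup>2 \<partial>circle)"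
    using F assms(1) by (simp add: Mult_abs_L2 norm_abs_L2 square_integrable_mult)
  also have "\<dots> \<le> (\<integral>z. C\<^sup>2 * (cmod (F z))\<^sup>2 \<partial>circle)"
  proof (rule integral_mono)
    show "integrable circle (\<lambda>z. (cmod (u z * F z))\<^sup>2)"
      using square_integrable_mult[OF assms(1) F(1)] by (simp add: square_integrable_def)
    show "integrable circle (\<lambda>z. C\<^sup>2 * (cmod (F z))\<^sup>2)"
      using F(1) by (simp add: square_integrable_def)
    show "(cmod (u z * F z))\<^sup>2 \<le> C\<^sup>2 * (cmod (F z))\<^sup>2" if "z \<in> space circle" for z
      unfolding norm_mult power_mult_distrib
      using that by (intro mult_right_mono power_mono assms(2)) simp_all
  qed
  also have "\<dots> = (C * norm f)\<^sup>2"
    using F by (simp add: norm_abs_L2 power_mult_distrib)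
  finally show ?thesis
    by (rule power2_le_imp_le) (simp add: \<open>0 \<le> C\<close>)
qed

section \<open>Fourier series\<close>

lift_definition one_L2 :: L2 is "\<lambda>_. 1"
  by (simp add: L2_eq_def square_integrable_const)

definition zpow :: "int \<Rightarrow> L2" where
  "zpow n = Mult (\<lambda>z. z powi n) one_L2"

lemma one_L2_abs: "one_L2 = abs_L2 (\<lambda>_. 1)"
  by (simp add: one_L2.abs_eq)

lemma Mult_one_abs: "bounded_mult u \<Longrightarrow> Mult u one_L2 = abs_L2 u"
  by (simp add: one_L2_abs Mult_abs_L2 square_integrable_const)

lemma square_integrable_bounded_mult: "bounded_mult u \<Longrightarrow> square_integrable u"
  using square_integrable_mult[OF _ square_integrable_const[of 1]] by simp

lemma zpow_abs: "zpow n = abs_L2 (\<lambda>z. z powi n)"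
  by (simp add: zpow_def Mult_one_abs)

lemma zpow_0: "zpow 0 = one_L2"
  by (simp add: zpow_def)

lemma fourier_eq_cinner: "fourier f n = cinner f (zpow n)"
  by (rule L2_cases[of f])
     (simp add: zpow_abs cinner_abs_L2 square_integrable_bounded_mult fourier.abs_eq L2_eq_refl)

lemma Mult_zpow: "Mult (\<lambda>z. z powi m) (zpow n) = zpow (m + n)"
proof -
  have "z powi m * z powi n = z powi (m + n)" if "cmod z = 1" for z
    using that power_int_add[of z m n] by force
  then show ?thesis
    unfolding zpow_def by (subst Mult_Mult) (auto intro!: Mult_cong)
qed

section \<open>Orthonormality of the exponentials\<close>

lemma integral_circle_power_int:
  "(\<integral>z. z powi n \<partial>circle) = (if n = 0 then 1 else 0)"
proof (cases "n = 0")
  case True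
  then show ?thesis using circle.prob_space by simp
next
  case False
  have dens: "uniform_measure lborel {0..2*pi} = density lborel (\<lambda>x. ennreal (indicator {0..2*pi} x / (2*pi)))"
    unfolding uniform_measure_def
    by (intro density_cong) (auto simp: indicator_def divide_ennreal ennreal_1[symmetric] simp del: ennreal_1)
  have cis_meas: "(\<lambda>t. cis t powi n) \<in> borel_measurable borel"
    unfolding cis_power_int by (intro borel_measurable_continuous_onI continuous_intros)
  have "(\<integral>z. z powi n \<partial>circle) = (\<integral>t. cis t powi n \<partial>uniform_measure lborel {0..2*pi})"
    unfolding circle_def
    by (intro integral_distr measurable_cis_circle borel_measurable_continuous_on_restrict continuous_intros) auto
  also have "\<dots> = (\<integral>t. (indicator {0..2*pi} t / (2*pi)) *\<^sub>R cis t powi n \<partial>lborel)"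
    unfolding dens using cis_meas by (intro integral_density) auto
  also have "\<dots> = (1 / (2*pi)) *\<^sub>R (\<integral>t. indicator {0..2*pi} t *\<^sub>R cis (of_int n * t) \<partial>lborel)"
    unfolding cis_power_int by (simp flip: integral_scaleR_right)
  also have "(\<integral>t. indicator {0..2*pi} t *\<^sub>R cis (of_int n * t) \<partial>lborel)
      = cis (of_int n * (2*pi)) / (\<i> * of_int n) - cis (of_int n * 0) / (\<i> * of_int n)"
  proof (rule integral_FTC_Icc)
    show "((\<lambda>t. cis (of_int n * t) / (\<i> * of_int n)) has_vector_derivative cis (of_int n * x))
        (at x within {0..2 * pi})" for x
      using False unfolding cis_conv_exp
      by (auto intro!: derivative_eq_intros has_vector_derivative_real_field simp: field_simps)
    show "continuous_on {0..2 * pi} (\<lambda>t. cis (of_int n * t))"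
      by (intro continuous_intros)
  qed simp
  also have "\<dots> = 0"
    using cis_multiple_2pi[of "of_int n"] by (simp add: mult.commute)
  finally show ?thesis using False by simp
qed

lemma power_int_cnj_unit:
  assumes "cmod z = 1"
  shows "cnj z powi n = z powi (- n)"
proof -
  have "cnj z = inverse z"
    using assms by (simp add: inverse_complex_def complex_eq_iff cmod_def flip: power2_eq_square)
  then show ?thesis by (simp add: power_int_minus power_int_inverse)
qed

lemma Mult_cnj_power_int: "Mult (\<lambda>z. cnj (z powi n)) f = Mult (\<lambda>z. z powi (- n)) f"
  using power_int_cnj_unit by (intro Mult_cong bounded_mult_cnj) simp_all

lemma cinner_zpow: "cinner (zpow m) (zpow n) = (if m = n then 1 else 0)"
proof -
  \<comment> \<open>The factor \<open>z powi n\<close> is split off \<open>zpow m\<close> and moved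
    across as its conjugate, where it cancels against \<open>zpow n\<close>.\<close>
  have "cinner (zpow m) (zpow n) = cinner (zpow (m - n)) one_L2"
    using Mult_zpow[of m 0] Mult_zpow[of "m - n" n] Mult_zpow[of n "m - n"]
      cinner_Mult_left[OF bounded_mult_power_int[of n], of "zpow (m - n)" "zpow n"]
      Mult_cnj_power_int[of n "zpow n"] Mult_zpow[of "- n" n]
    by (simp add: zpow_0)
  also have "\<dots> = (\<integral>z. z powi (m - n) \<partial>circle)"
    by (simp add: zpow_abs one_L2_abs cinner_abs_L2 square_integrable_bounded_mult)
  finally show ?thesis by (simp add: integral_circle_power_int)
qed

lemma norm_zpow [simp]: "norm (zpow n) = 1"
proof -
  have "complex_of_real ((norm (zpow n))\<^sup>2) = of_real (1\<^sup>2)"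
    using cinner_zpow[of n n] unfolding cinner_self_norm by simp
  then have "(norm (zpow n))\<^sup>2 = 1\<^sup>2"
    unfolding of_real_eq_iff .
  then show ?thesis
    by (rule power2_eq_imp_eq) simp_all
qed

lemma fourier_zpow: "fourier (zpow m) n = (if m = n then 1 else 0)"
  by (simp add: fourier_eq_cinner cinner_zpow)

lemma fourier_Mult_power_int: "fourier (Mult (\<lambda>z. z powi m) f) n = fourier f (n - m)"
  by (simp add: fourier_eq_cinner cinner_Mult_left Mult_cnj_power_int Mult_zpow add.commute[of "- m"]
      del: complex_cnj_power_int)

lemma fourier_Mult_ident: "fourier (Mult (\<lambda>z. z) f) n = fourier f (n - 1)"
  using fourier_Mult_power_int[of 1 f n] by simp

lemma fourier_add: "fourier (f + g) n = fourier f n + fourier g n"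
  and fourier_diff: "fourier (f - g) n = fourier f n - fourier g n"
  and fourier_scaleC: "fourier (c *\<^sub>C f) n = c * fourier f n"
  and fourier_0 [simp]: "fourier 0 n = 0"
  by (simp_all add: fourier_eq_cinner cinner_add_left cinner_diff_left cinner_scaleC_left)

text \<open>The set of \<open>f\<close> with vanishing Fourier coefficients is invariant under multiplication by real
  polynomials in the coordinates, since \<open>Re z\<close> and \<open>Im z\<close> are combinations of \<open>z\<close> and \<open>1/z\<close> on the circle.\<close>
lemma fourier_Mult_real_polynomial_zero:
  assumes "real_polynomial_function p" "\<And>n. fourier f n = 0"
  shows "bounded_mult (\<lambda>z. of_real (p z)) \<and> (\<forall>n. fourier (Mult (\<lambda>z. of_real (p z)) f) n = 0)"
  using assms
proof (induction p arbitrary: f rule: real_polynomial_function.induct)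
  case (linear p)
  \<comment> \<open>Chosen so that \<open>p z\<close> is twice the real part of
    \<open>a * z\<close>; on the circle the conjugate of \<open>z\<close> is its inverse, so only
    the powers 1 and -1 occur.\<close>
  define a where "a = Complex (p 1 / 2) (- p \<i> / 2)"
  have p: "p z = Re z * p 1 + Im z * p \<i>" for z
  proof -
    have "z = Re z *\<^sub>R 1 + Im z *\<^sub>R \<i>" by (simp add: complex_eq_iff)
    then have "p z = p (Re z *\<^sub>R 1 + Im z *\<^sub>R \<i>)" by simp
    also have "\<dots> = Re z * p 1 + Im z * p \<i>"
      using linear(1) by (simp only: linear_simps real_scaleR_def)
    finally show ?thesis .
  qed
  have "complex_of_real (p z) = a * z + cnj a * cnj z" for z
    unfolding p[of z] a_def by (simp add: complex_eq_iff field_simps)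
  then have eq: "complex_of_real (p z) = a * z powi 1 + cnj a * z powi (- 1)" if "cmod z = 1" for z
    using power_int_cnj_unit[OF that, of 1] by simp
  have "continuous_on (sphere 0 1) (\<lambda>z. complex_of_real (p z))"
    by (intro continuous_intros linear_continuous_on linear(1))
  then have bm: "bounded_mult (\<lambda>z. complex_of_real (p z))"
    by (rule bounded_mult_continuous)
  have "Mult (\<lambda>z. complex_of_real (p z)) f = Mult (\<lambda>z. a * z powi 1 + cnj a * z powi (- 1)) f"
    by (rule Mult_cong[OF bm]) (simp_all only: eq bounded_mult_add bounded_mult_times bounded_mult_const bounded_mult_power_int)
  also have "\<dots> = a *\<^sub>C Mult (\<lambda>z. z powi 1) f + cnj a *\<^sub>C Mult (\<lambda>z. z powi (- 1)) f"
    by (simp only: Mult_add_left Mult_scaleC_left bounded_mult_times bounded_mult_const bounded_mult_power_int)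
  finally have "fourier (Mult (\<lambda>z. complex_of_real (p z)) f) n = 0" for n
    by (simp only: fourier_add fourier_scaleC fourier_Mult_power_int linear(2)) simp
  with bm show ?case by blast
next
  case (const c)
  then show ?case by (simp add: fourier_scaleC)
next
  case (add p q)
  have "bounded_mult (\<lambda>z. complex_of_real (p z))" "bounded_mult (\<lambda>z. complex_of_real (q z))"
    and "\<And>n. fourier (Mult (\<lambda>z. complex_of_real (p z)) f) n = 0"
    and "\<And>n. fourier (Mult (\<lambda>z. complex_of_real (q z)) f) n = 0"
    using add by blast+
  then show ?case by (simp add: Mult_add_left fourier_add)
next
  case (mult p q)
  have "bounded_mult (\<lambda>z. complex_of_real (p z))" "bounded_mult (\<lambda>z. complex_of_real (q z))"
    and "\<And>n. fourier (Mult (\<lambda>z. complex_of_real (p z)) (Mult (\<lambda>z. complex_of_real (q z)) f)) n = 0"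
    using mult by blast+
  then show ?case by (simp add: Mult_Mult)
qed

lemma fourier_zero_imp_continuous_orth:
  fixes h :: "complex \<Rightarrow> real"
  assumes f: "\<And>n. fourier f n = 0" and h: "continuous_on (sphere 0 1) h"
  shows "cinner (Mult (\<lambda>z. of_real (h z)) f) one_L2 = 0"
proof -
  have bm: "bounded_mult (\<lambda>z. complex_of_real (h z))"
    by (intro bounded_mult_continuous continuous_intros h)
  have "cmod (cinner (Mult (\<lambda>z. of_real (h z)) f) one_L2) \<le> 0 + e" if e: "e > 0" for e
  proof -
    \<comment> \<open>Uniform accuracy for the approximating polynomial; the summand 1 covers the
      case \<open>f = 0\<close>.\<close>
    have "e / (norm f + 1) > 0"
      using e by (simp add: add_nonneg_pos)
    from Stone_Weierstrass_real_polynomial_function[OF compact_sphere h this]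
    obtain p where p: "real_polynomial_function p"
      "\<And>x. x \<in> sphere 0 1 \<Longrightarrow> \<bar>h x - p x\<bar> < e / (norm f + 1)" by blast
    note pm = fourier_Mult_real_polynomial_zero[OF p(1) f]
    then have p0: "cinner (Mult (\<lambda>z. of_real (p z)) f) one_L2 = 0"
      by (metis fourier_eq_cinner zpow_0)
    have "norm (Mult (\<lambda>z. of_real (h z) - of_real (p z)) f) \<le> e / (norm f + 1) * norm f"
    proof (rule norm_Mult_le)
      show "cmod (of_real (h z) - of_real (p z)) \<le> e / (norm f + 1)" if "cmod z = 1" for z
        using p(2)[of z] that by (simp flip: of_real_diff)
    qed (use bm pm in simp)
    also have "\<dots> \<le> e"
      using e by (simp add: divide_simps add_nonneg_pos)
    finally have *: "norm (Mult (\<lambda>z. of_real (h z) - of_real (p z)) f) \<le> e" .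
    have "cinner (Mult (\<lambda>z. of_real (h z)) f) one_L2
        = cinner (Mult (\<lambda>z. of_real (h z) - of_real (p z)) f) one_L2"
      using bm pm p0 by (simp add: Mult_diff_left cinner_diff_left)
    then show ?thesis
      using norm_cinner_le[of "Mult (\<lambda>z. of_real (h z) - of_real (p z)) f" one_L2] * norm_zpow[of 0]
      by (simp add: zpow_0)
  qed
  then have "cmod (cinner (Mult (\<lambda>z. of_real (h z)) f) one_L2) \<le> 0"
    by (rule field_le_epsilon)
  then show ?thesis by simp
qed

text \<open>Completeness of the exponentials. The representative \<open>F\<close> integrates to 0
  against continuous functions, hence over closed sets by approximation of their indicators, hence
  over all Borel sets because the closed sets form an intersection-stable generator. An integrable
  function with this property vanishes almost everywhere.\<close>

theorem fourier_zero_imp_zero: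
  assumes f: "\<And>n. fourier f n = 0"
  shows "f = 0"
proof -
  obtain F where F: "square_integrable F" "f = abs_L2 F"
    using L2_cases by blast
  have int: "integrable circle F"
    by (rule integrable_norm_if_square_integrable(1)[OF F(1)])
  then have [measurable]: "F \<in> borel_measurable circle" by auto
  have cont0: "(\<integral>z. h z *\<^sub>R F z \<partial>circle) = 0" if h: "continuous_on (sphere 0 1) h" for h :: "complex \<Rightarrow> real"
  proof -
    have bm: "bounded_mult (\<lambda>z. complex_of_real (h z))"
      by (intro bounded_mult_continuous continuous_intros h)
    show ?thesis
      using fourier_zero_imp_continuous_orth[OF f h] bm F
      by (simp add: Mult_abs_L2 one_L2_abs cinner_abs_L2 square_integrable_mult square_integrable_const
          scaleR_conv_of_real)
  qed
  have ind_meas [measurable]: "indicat_real A \<in> borel_measurable circle" if "A \<in> sets borel" for A :: "complex set"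
    using borel_measurable_circle[OF borel_measurable_indicator[OF that]] .
  have set_int: "integrable circle (\<lambda>z. indicat_real A z *\<^sub>R F z)" if "A \<in> sets borel" for A
  proof (rule Bochner_Integration.integrable_bound[OF int])
    note [measurable] = ind_meas[OF that]
    show "(\<lambda>z. indicat_real A z *\<^sub>R F z) \<in> borel_measurable circle"
      by measurable
  qed (simp add: indicator_def)
  have closed0: "(\<integral>z. indicat_real C z *\<^sub>R F z \<partial>circle) = 0" if C: "closed C" for C
  proof (cases "C = {}")
    case False
    \<comment> \<open>Continuous functions with values in [0, 1] that equal 1 on \<open>C\<close>
      and decrease to 0 off it. Closedness of \<open>C\<close> makes the distance positive
      there.\<close>
    define h where "h n z = max 0 (1 - real n * infdist z C)" for n z
    have h_cont: "continuous_on A (h n)" for A n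
      unfolding h_def by (intro continuous_intros)
    have "(\<lambda>n. \<integral>z. h n z *\<^sub>R F z \<partial>circle) \<longlonglongrightarrow> (\<integral>z. indicat_real C z *\<^sub>R F z \<partial>circle)"
    proof (rule integral_dominated_convergence[where w = "\<lambda>z. cmod (F z)"])
      show "(\<lambda>z. indicat_real C z *\<^sub>R F z) \<in> borel_measurable circle"
        using set_int[of C] C by auto
      show "(\<lambda>z. h n z *\<^sub>R F z) \<in> borel_measurable circle" for n
      proof -
        have "h n \<in> borel_measurable borel"
          by (rule borel_measurable_continuous_onI[OF h_cont])
        then have [measurable]: "h n \<in> borel_measurable circle"
          by (rule borel_measurable_circle)
        show ?thesis by measurable
      qed
      show "integrable circle (\<lambda>z. cmod (F z))"
        using int by simp
      show "AE z in circle. norm (h n z *\<^sub>R F z) \<le> cmod (F z)" for n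
      proof (rule AE_I2)
        fix z
        have "0 \<le> real n * infdist z C" by (simp add: infdist_nonneg)
        then have "\<bar>h n z\<bar> \<le> 1" by (simp add: h_def)
        then show "norm (h n z *\<^sub>R F z) \<le> cmod (F z)"
          by (simp add: mult_left_le_one_le)
      qed
      have "(\<lambda>n. h n z) \<longlonglongrightarrow> indicat_real C z" for z
      proof (cases "z \<in> C")
        case True
        then show ?thesis by (simp add: h_def)
      next
        case notin: False
        then have "infdist z C > 0"
          using C False by (simp add: infdist_pos_not_in_closed)
        then obtain N where N: "1 < real N * infdist z C"
          using reals_Archimedean3 by blast
        have "h n z = 0" if "n \<ge> N" for n
        proof -
          have "real N * infdist z C \<le> real n * infdist z C"
            using that by (intro mult_right_mono) (simp_all add: infdist_nonneg)
          then show ?thesis using N by (simp add: h_def)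
        qed
        then show ?thesis
          using notin by (intro tendsto_eventually eventually_sequentiallyI[of N]) simp
      qed
      then show "AE z in circle. (\<lambda>n. h n z *\<^sub>R F z) \<longlonglongrightarrow> indicat_real C z *\<^sub>R F z"
        by (intro AE_I2 tendsto_intros)
    qed
    then show ?thesis
      using cont0[OF h_cont] LIMSEQ_unique by (simp add: LIMSEQ_const_iff)
  qed simp
  have borel0: "(\<integral>z. indicat_real A z *\<^sub>R F z \<partial>circle) = 0" if "A \<in> sets borel" for A
  proof -
    have "Int_stable (Collect closed :: complex set set)"
      by (auto simp: Int_stable_def)
    moreover have "(Collect closed :: complex set set) \<subseteq> Pow UNIV"
      by simp
    moreover have "A \<in> sigma_sets UNIV (Collect closed)"
      using that unfolding borel_eq_closed by simp
    ultimately show ?thesis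
    proof (induction A rule: sigma_sets_induct_disjoint)
      case (basic A)
      then show ?case using closed0 by simp
    next
      case (compl A)
      then have "A \<in> sets borel" unfolding borel_eq_closed by simp
      have "(\<integral>z. indicat_real (UNIV - A) z *\<^sub>R F z \<partial>circle)
          = (\<integral>z. 1 *\<^sub>R F z - indicat_real A z *\<^sub>R F z \<partial>circle)"
        by (intro Bochner_Integration.integral_cong) (auto simp: indicator_def)
      also have "\<dots> = 0"
        using int set_int[OF \<open>A \<in> sets borel\<close>] compl cont0[of "\<lambda>_. 1"] by simp
      finally show ?case .
    next
      case (union A)
      then have A: "A i \<in> sets borel" for i
        unfolding borel_eq_closed by auto
      \<comment> \<open>Intersecting with the circle turns the Borel sets into measurable sets of
        \<open>circle\<close> without changing the integrals.\<close>
      have "(LINT z:(\<Union>i. A i \<inter> sphere 0 1)|circle. F z) = (\<Sum>i. (LINT z:(A i \<inter> sphere 0 1)|circle. F z))"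
      proof (rule lebesgue_integral_countable_add)
        show "A i \<inter> sphere 0 1 \<in> sets circle" for i
          using A[of i] by (auto simp: sets_circle sets_restrict_space)
        show "set_integrable circle (\<Union>i. A i \<inter> sphere 0 1) F"
          unfolding set_integrable_def
          by (rule Bochner_Integration.integrable_cong[THEN iffD1, OF refl _ set_int[of "\<Union>i. A i"]])
             (use A in \<open>auto simp: indicator_def\<close>)
      qed (use union in \<open>auto simp: disjoint_family_on_def\<close>)
      moreover have "(LINT z:(A i \<inter> sphere 0 1)|circle. F z) = (\<integral>z. indicat_real (A i) z *\<^sub>R F z \<partial>circle)" for i
        unfolding set_lebesgue_integral_def
        by (intro Bochner_Integration.integral_cong) (auto simp: indicator_def)
      moreover have "(LINT z:(\<Union>i. A i \<inter> sphere 0 1)|circle. F z) = (\<integral>z. indicat_real (\<Union>i. A i) z *\<^sub>R F z \<partial>circle)"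
        unfolding set_lebesgue_integral_def
        by (intro Bochner_Integration.integral_cong) (auto simp: indicator_def)
      ultimately show ?case using union by simp
    qed simp
  qed
  have "AE z in circle. F z = 0"
  proof (rule circle.density_zero[OF int])
    fix A assume "A \<in> sets circle"
    then have "A \<in> sets borel"
      by (auto simp: sets_circle sets_restrict_space)
    then show "(LINT z:A|circle. F z) = 0"
      unfolding set_lebesgue_integral_def by (rule borel0)
  qed
  then show ?thesis
    unfolding F(2) zero_L2_def using F(1) by (simp add: abs_L2_eq_iff square_integrable_zero)
qed

lemma L2_eqI_fourier: "(\<And>n. fourier f n = fourier g n) \<Longrightarrow> f = g"
  using fourier_zero_imp_zero[of "f - g"] by (simp add: fourier_diff)

section \<open>Bounds on Fourier coefficients\<close>

lemma fourier_le_norm: "cmod (fourier f n) \<le> norm f"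
  using norm_cinner_le[of f "zpow n"] by (simp add: fourier_eq_cinner)

lemma cinner_zpow_left: "cinner (zpow n) f = cnj (fourier f n)"
  by (subst cinner_commute) (simp add: fourier_eq_cinner)

lemma bessel_inequality:
  assumes "finite A"
  shows "(\<Sum>n\<in>A. (cmod (fourier f n))\<^sup>2) \<le> (norm f)\<^sup>2"
proof -
  define s where "s = (\<Sum>n\<in>A. (cmod (fourier f n))\<^sup>2)"
  define g where "g = (\<Sum>n\<in>A. fourier f n *\<^sub>C zpow n)"
  have s0: "s \<ge> 0" by (simp add: s_def sum_nonneg)
  have g_f: "cinner g f = of_real s"
    unfolding g_def s_def cinner_sum_left of_real_sum cinner_scaleC_left cinner_zpow_left complex_norm_square
    by (rule refl)
  have g_zpow: "cinner g (zpow n) = fourier f n" if "n \<in> A" for n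
    unfolding g_def cinner_sum_left cinner_scaleC_left cinner_zpow
    using assms that by (simp add: if_distrib cong: if_cong)
  have "cinner g g = (\<Sum>n\<in>A. fourier f n * cnj (cinner g (zpow n)))"
    by (subst g_def) (simp add: cinner_sum_left cinner_scaleC_left cinner_commute[of "zpow _" g])
  also have "\<dots> = of_real s"
    unfolding s_def of_real_sum complex_norm_square by (intro sum.cong refl) (simp add: g_zpow)
  finally have "cinner g g = of_real s" .
  then have "(norm g)\<^sup>2 = s"
    unfolding cinner_self_norm of_real_eq_iff .
  have "s = cmod (cinner g f)"
    using g_f s0 by simp
  also have "\<dots> \<le> norm g * norm f"
    by (rule norm_cinner_le)
  finally have "(norm g)\<^sup>2 \<le> norm g * norm f"
    using \<open>(norm g)\<^sup>2 = s\<close> by simp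
  then have "norm g \<le> norm f"
    by (cases "norm g = 0") (simp_all add: power2_eq_square)
  then have "(norm g)\<^sup>2 \<le> (norm f)\<^sup>2"
    by (rule power_mono) simp
  then show ?thesis
    using \<open>(norm g)\<^sup>2 = s\<close> s_def by simp
qed

text \<open>Bessel's inequality at \<open>N\<close> distinct indices would bound
  \<open>N * c\<^sup>2\<close> for every \<open>N\<close>. This excludes coefficients that fail to
  decay along a recursion.\<close>

lemma fourier_not_bounded_below:
  assumes "inj a" "\<And>k::nat. c \<le> cmod (fourier f (a k))"
  shows "c \<le> 0"
proof (rule ccontr)
  assume "\<not> c \<le> 0"
  then have c: "c\<^sup>2 > 0" "c \<ge> 0" by simp_all
  obtain N where N: "(norm f)\<^sup>2 < real N * c\<^sup>2"
    using reals_Archimedean3[OF c(1)] by blast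
  have "real N * c\<^sup>2 = (\<Sum>n\<in>a ` {..<N}. c\<^sup>2)"
    using assms(1) by (simp add: card_image inj_on_subset)
  also have "\<dots> \<le> (\<Sum>n\<in>a ` {..<N}. (cmod (fourier f n))\<^sup>2)"
    using assms(2) c(2) by (intro sum_mono power_mono) auto
  also have "\<dots> \<le> (norm f)\<^sup>2"
    by (rule bessel_inequality) simp
  finally show False using N by simp
qed

section \<open>The Hardy space\<close>

lemma closed_subspace_orth: "closed_subspace {f. \<forall>g\<in>S. cinner f g = 0}"
proof -
  have "closed (\<Inter>g\<in>S. {f. cinner f g = 0})"
    by (intro closed_INT ballI closed_cinner_eq)
  also have "(\<Inter>g\<in>S. {f. cinner f g = 0}) = {f. \<forall>g\<in>S. cinner f g = 0}"
    by blast
  finally show ?thesis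
    by (auto simp: closed_subspace_def L2.subspace_def cinner_add_left cinner_scaleC_left)
qed

lemma Hardy_eq_orth: "Hardy = {f. \<forall>g\<in>zpow ` {..<0}. cinner f g = 0}"
  by (auto simp: Hardy_def fourier_eq_cinner)

lemma closed_subspace_Hardy: "closed_subspace Hardy"
  unfolding Hardy_eq_orth by (rule closed_subspace_orth)

lemma subspace_Hardy: "L2.subspace Hardy"
  using closed_subspace_Hardy by (simp add: closed_subspace_def)

lemmas Hardy_intros = L2.subspace_add[OF subspace_Hardy] L2.subspace_diff[OF subspace_Hardy]
  L2.subspace_scale[OF subspace_Hardy] L2.subspace_sum[OF subspace_Hardy]

lemma one_Hardy: "one_L2 \<in> Hardy"
  by (auto simp: Hardy_def fourier_zpow simp flip: zpow_0)

lemma Mult_ident_Hardy: "f \<in> Hardy \<Longrightarrow> Mult (\<lambda>z. z) f \<in> Hardy"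
  by (auto simp: Hardy_def fourier_Mult_ident)

text \<open>The projection \<open>g1\<close> of \<open>g\<close> onto \<open>Hardy\<close> has no
  coefficients at all: the negative ones vanish by membership, the others because
  \<open>zpow k\<close> lies in \<open>Hardy\<close> and sees the same coefficient of
  \<open>g\<close> and \<open>g1\<close>. Completeness of the exponentials gives
  \<open>g1 = 0\<close>.\<close>

lemma Hardy_orth:
  assumes f: "f \<in> Hardy" and g: "\<And>k. k \<ge> 0 \<Longrightarrow> fourier g k = 0"
  shows "cinner g f = 0"
proof -
  define g1 where "g1 = orth_proj Hardy g"
  have orth: "cinner (g - g1) h = 0" if "h \<in> Hardy" for h
    unfolding g1_def by (rule orth_proj_orth[OF closed_subspace_Hardy that])
  have "fourier g1 k = 0" for k
  proof (cases "k \<ge> 0")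
    case True
    then have "zpow k \<in> Hardy"
      by (auto simp: Hardy_def fourier_zpow)
    from orth[OF this] show ?thesis
      using g[OF True] by (simp add: fourier_eq_cinner cinner_diff_left)
  next
    case False
    then show ?thesis
      using orth_proj_in[OF closed_subspace_Hardy, of g] by (simp add: Hardy_def g1_def)
  qed
  then have "g1 = 0"
    by (rule fourier_zero_imp_zero)
  with orth[OF f] show ?thesis by simp
qed

lemma closed_subspace_Hardy_minus: "closed_subspace Hardy_minus"
  unfolding Hardy_minus_def by (rule closed_subspace_orth)

section \<open>Division by linear factors\<close>

lemma bounded_mult_linear [simp]: "bounded_mult (\<lambda>z. z - a)"
  by (intro bounded_mult_continuous continuous_intros)

lemma bounded_mult_one_minus [simp]: "bounded_mult (\<lambda>z. 1 - b * z)"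
  by (intro bounded_mult_continuous continuous_intros)

lemma one_minus_neq_0:
  fixes b z :: complex
  assumes "cmod b < 1" "cmod z \<le> 1"
  shows "1 - b * z \<noteq> 0"
proof
  assume "1 - b * z = 0"
  then have "b * z = 1" by simp
  then have "1 = cmod b * cmod z" by (metis norm_mult norm_one)
  also have "\<dots> \<le> cmod b * 1" using assms(2) by (intro mult_left_mono) auto
  finally show False using assms(1) by simp
qed

lemma bounded_mult_inverse_one_minus [simp]:
  assumes "cmod b < 1"
  shows "bounded_mult (\<lambda>z. 1 / (1 - b * z))"
  using one_minus_neq_0[OF assms] by (intro bounded_mult_continuous continuous_intros) auto

lemma bounded_mult_inverse_linear:
  assumes "cmod a < 1"
  shows "bounded_mult (\<lambda>z. 1 / (z - a))"
  using assms by (intro bounded_mult_continuous continuous_intros) auto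

lemma Mult_linear: "Mult (\<lambda>z. z - a) f = Mult (\<lambda>z. z) f - a *\<^sub>C f"
  by (simp add: Mult_diff_left)

lemma Mult_one_minus: "Mult (\<lambda>z. 1 - b * z) f = f - b *\<^sub>C Mult (\<lambda>z. z) f"
  by (simp add: Mult_diff_left Mult_scaleC_left)

lemma Mult_linear_Hardy: "f \<in> Hardy \<Longrightarrow> Mult (\<lambda>z. z - a) f \<in> Hardy"
  unfolding Mult_linear by (intro Hardy_intros Mult_ident_Hardy)

lemma Mult_one_minus_Hardy: "f \<in> Hardy \<Longrightarrow> Mult (\<lambda>z. 1 - b * z) f \<in> Hardy"
  unfolding Mult_one_minus by (intro Hardy_intros Mult_ident_Hardy)

lemma fourier_Mult_linear: "fourier (Mult (\<lambda>z. z - a) f) n = fourier f (n - 1) - a * fourier f n"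
  by (simp add: Mult_linear fourier_diff fourier_scaleC fourier_Mult_ident)

lemma fourier_Mult_one_minus:
  "fourier (Mult (\<lambda>z. 1 - b * z) f) n = fourier f n - b * fourier f (n - 1)"
  by (simp add: Mult_one_minus fourier_diff fourier_scaleC fourier_Mult_ident)

text \<open>A negative coefficient is \<open>b\<close> times its left neighbour, hence
  \<open>b ^ k\<close> times the one \<open>k\<close> places to the left. The coefficients are
  bounded, so it is 0 in the limit.\<close>

lemma Hardy_if_Mult_one_minus:
  assumes b: "cmod b < 1" and f: "Mult (\<lambda>z. 1 - b * z) f \<in> Hardy"
  shows "f \<in> Hardy"
proof -
  have "fourier f n = 0" if n: "n < 0" for n
  proof -
    have step: "fourier f m = b * fourier f (m - 1)" if "m < 0" for m
      using f that fourier_Mult_one_minus[of b f m] by (simp add: Hardy_def)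
    have iter: "fourier f n = b ^ k * fourier f (n - int k)" for k
    proof (induction k)
      case (Suc k)
      then show ?case using step[of "n - int k"] n by (simp add: algebra_simps)
    qed simp
    have "cmod (fourier f n) \<le> cmod b ^ k * norm f" for k
      unfolding iter[of k] norm_mult norm_power
      by (intro mult_left_mono fourier_le_norm) simp
    moreover have "(\<lambda>k. cmod b ^ k * norm f) \<longlonglongrightarrow> 0 * norm f"
      using b by (intro tendsto_intros LIMSEQ_realpow_zero) auto
    ultimately have "cmod (fourier f n) \<le> 0 * norm f"
      by (intro LIMSEQ_le_const[of _ "0 * norm f"]) auto
    then show ?thesis by simp
  qed
  then show ?thesis by (simp add: Hardy_def)
qed

lemma fourier_iterate_linear:
  assumes "Mult (\<lambda>z. z - r) f \<in> Hardy" "n < 0"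
  shows "fourier f (n - int k) = r ^ k * fourier f n"
proof (induction k)
  case (Suc k)
  have "fourier f (n - int k - 1) = r * fourier f (n - int k)"
    using assms fourier_Mult_linear[of r f "n - int k"] by (simp add: Hardy_def)
  then show ?case using Suc by (simp add: algebra_simps)
qed simp

text \<open>Here the recursion runs the other way: moving left multiplies negative coefficients by
  \<open>r\<close>, so they never shrink. On the unit circle itself boundedness would be no
  contradiction, so Bessel's inequality is used.\<close>

lemma Hardy_if_Mult_linear_outside:
  assumes r: "cmod r \<ge> 1" and f: "Mult (\<lambda>z. z - r) f \<in> Hardy"
  shows "f \<in> Hardy"
proof -
  have "fourier f n = 0" if n: "n < 0" for n
  proof -
    have "cmod (fourier f n) \<le> cmod (fourier f (n - int k))" for k
    proof -
      have "1 * cmod (fourier f n) \<le> cmod r ^ k * cmod (fourier f n)"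
        using r by (intro mult_right_mono one_le_power) simp_all
      then show ?thesis
        by (simp add: fourier_iterate_linear[OF f n] norm_mult norm_power)
    qed
    moreover have "inj (\<lambda>k. n - int k)" by (simp add: inj_def)
    ultimately have "cmod (fourier f n) \<le> 0"
      using fourier_not_bounded_below[of "\<lambda>k. n - int k"] by blast
    then show ?thesis by simp
  qed
  then show ?thesis by (simp add: Hardy_def)
qed

text \<open>Every negative coefficient is a power of \<open>r\<close> times the one at -1, which is
  therefore the only obstruction to membership.\<close>

lemma Hardy_if_Mult_linear_inside:
  assumes f: "Mult (\<lambda>z. z - r) f \<in> Hardy" and "fourier f (- 1) = 0"
  shows "f \<in> Hardy"
proof -
  have "fourier f n = 0" if n: "n < 0" for n
    using fourier_iterate_linear[OF f, of "- 1" "nat (- 1 - n)"] n assms(2) by simp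
  then show ?thesis by (simp add: Hardy_def)
qed

lemma Mult_linear_cancel:
  assumes "cmod r < 1" "Mult (\<lambda>z. z - r) f = Mult (\<lambda>z. z - r) g"
  shows "f = g"
proof -
  have "Mult (\<lambda>z. 1 / (z - r)) (Mult (\<lambda>z. z - r) h) = h" for h
  proof -
    have "Mult (\<lambda>z. 1 / (z - r) * (z - r)) h = Mult (\<lambda>_. 1) h"
      using assms(1)
      by (intro Mult_cong bounded_mult_times bounded_mult_inverse_linear bounded_mult_linear bounded_mult_const) auto
    then show ?thesis
      using bounded_mult_inverse_linear[OF assms(1)] by (simp add: Mult_Mult)
  qed
  then show ?thesis using assms(2) by metis
qed

text \<open>The reproducing kernel at \<open>a\<close>: \<open>\<langle>f, szego a\<rangle>\<close> is the value at \<open>a\<close> of the extension of \<open>f \<in> Hardy\<close>.\<close>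
definition szego :: "complex \<Rightarrow> L2" where
  "szego a = Mult (\<lambda>z. 1 / (1 - cnj a * z)) one_L2"

section \<open>Reproducing kernels and division inside the disk\<close>

lemma Mult_one_minus_inverse:
  assumes "cmod b < 1"
  shows "Mult (\<lambda>z. 1 - b * z) (Mult (\<lambda>z. 1 / (1 - b * z)) f) = f"
proof -
  have "Mult (\<lambda>z. (1 - b * z) * (1 / (1 - b * z))) f = Mult (\<lambda>_. 1) f"
    using one_minus_neq_0[OF assms] assms
    by (intro Mult_cong bounded_mult_times bounded_mult_one_minus bounded_mult_inverse_one_minus) auto
  then show ?thesis
    using assms Mult_Mult[OF bounded_mult_one_minus bounded_mult_inverse_one_minus, of b b f] by simp
qed

lemma Mult_inverse_one_minus_Hardy:
  assumes "cmod b < 1" "f \<in> Hardy"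
  shows "Mult (\<lambda>z. 1 / (1 - b * z)) f \<in> Hardy"
  by (rule Hardy_if_Mult_one_minus[OF assms(1)]) (simp only: Mult_one_minus_inverse assms)

lemma szego_Hardy: "cmod a < 1 \<Longrightarrow> szego a \<in> Hardy"
  unfolding szego_def by (intro Mult_inverse_one_minus_Hardy one_Hardy) simp

text \<open>Compare zeroth coefficients in the identity that \<open>1 - cnj a * z\<close> times the
  kernel is 1; the kernel has no coefficient at -1.\<close>

lemma cinner_one_szego:
  assumes "cmod a < 1"
  shows "cinner one_L2 (szego a) = 1"
proof -
  have "Mult (\<lambda>z. 1 - cnj a * z) (szego a) = one_L2"
    unfolding szego_def using assms by (intro Mult_one_minus_inverse) simp
  then have "fourier (szego a) 0 - cnj a * fourier (szego a) (- 1) = 1"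
    using fourier_Mult_one_minus[of "cnj a" "szego a" 0] fourier_zpow[of 0 0] by (simp add: zpow_0)
  then have "fourier (szego a) 0 = 1"
    using szego_Hardy[OF assms] by (simp add: Hardy_def)
  then show ?thesis
    using cinner_zpow_left[of 0 "szego a"] by (simp add: zpow_0)
qed

text \<open>On the circle \<open>z - a\<close> equals \<open>z * (1 - a * cnj z)\<close>, so the
  conjugated kernel cancels all but the shift by \<open>z\<close>. The vector \<open>f\<close>
  ranges over all of \<open>L2\<close>, which allows testing a quotient not yet known to lie in
  \<open>Hardy\<close>.\<close>

lemma cinner_Mult_linear_szego:
  assumes a: "cmod a < 1"
  shows "cinner (Mult (\<lambda>z. z - a) f) (szego a) = fourier f (- 1)"
proof -
  let ?k = "\<lambda>z. 1 / (1 - cnj a * z)"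
  have bm: "bounded_mult ?k" "bounded_mult (\<lambda>z. cnj (?k z))"
    using a by (simp_all del: complex_cnj_divide complex_cnj_diff)
  have eq: "cnj (?k z) * (z - a) = z" if "cmod z = 1" for z
  proof -
    have "z * cnj z = 1" using that complex_norm_square[of z] by simp
    then have "z - a = z * (1 - a * cnj z)" by (simp add: algebra_simps)
    moreover have "1 - a * cnj z \<noteq> 0"
      using one_minus_neq_0[of a "cnj z"] a that by simp
    ultimately show ?thesis by simp
  qed
  have "cinner (Mult (\<lambda>z. z - a) f) (szego a) = cinner (Mult (\<lambda>z. cnj (?k z)) (Mult (\<lambda>z. z - a) f)) one_L2"
    unfolding szego_def using cinner_Mult_left[OF bm(2), of "Mult (\<lambda>z. z - a) f" one_L2] by simp
  also have "\<dots> = cinner (Mult (\<lambda>z. z) f) one_L2"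
    unfolding Mult_Mult[OF bm(2) bounded_mult_linear]
    by (subst Mult_cong[OF bounded_mult_times[OF bm(2) bounded_mult_linear] bounded_mult_ident eq]) simp_all
  also have "\<dots> = fourier (Mult (\<lambda>z. z) f) 0"
    by (simp add: fourier_eq_cinner zpow_0)
  finally show ?thesis by (simp add: fourier_Mult_ident)
qed

lemma cinner_Mult_linear_szego_Hardy:
  "cmod a < 1 \<Longrightarrow> f \<in> Hardy \<Longrightarrow> cinner (Mult (\<lambda>z. z - a) f) (szego a) = 0"
  by (simp add: cinner_Mult_linear_szego Hardy_def)

text \<open>The quotient exists in \<open>L2\<close> since \<open>z - a\<close> has no zero on the
  circle. Its coefficient at -1, the only obstruction to lying in \<open>Hardy\<close>, is the value
  of \<open>f\<close> at \<open>a\<close>.\<close>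

lemma Hardy_divide_linear:
  assumes a: "cmod a < 1" and f: "f \<in> Hardy" "cinner f (szego a) = 0"
  shows "\<exists>q\<in>Hardy. f = Mult (\<lambda>z. z - a) q"
proof -
  define q where "q = Mult (\<lambda>z. 1 / (z - a)) f"
  have "Mult (\<lambda>z. (z - a) * (1 / (z - a))) f = Mult (\<lambda>_. 1) f"
    using a by (intro Mult_cong bounded_mult_times bounded_mult_inverse_linear) auto
  then have q: "Mult (\<lambda>z. z - a) q = f"
    unfolding q_def using a by (simp add: Mult_Mult bounded_mult_inverse_linear)
  have "q \<in> Hardy"
  proof (rule Hardy_if_Mult_linear_inside)
    show "Mult (\<lambda>z. z - a) q \<in> Hardy"
      unfolding q by (rule f)
    show "fourier q (- 1) = 0"
      using cinner_Mult_linear_szego[OF a, of q] f(2) unfolding q by simp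
  qed
  with q show ?thesis by blast
qed

section \<open>Inner functions and Blaschke factors\<close>

text \<open>An inner function through a representative that is unimodular at every point of the
  circle, so that conjugation inverts the symbol pointwise.\<close>

definition inner_symbol :: "(complex \<Rightarrow> complex) \<Rightarrow> bool" where
  "inner_symbol u \<longleftrightarrow> bounded_mult u \<and> (\<forall>z. cmod z = 1 \<longrightarrow> cmod (u z) = 1) \<and> Mult u one_L2 \<in> Hardy"

lemma inner_function_symbol:
  assumes "inner_function \<phi>"
  obtains u where "inner_symbol u" "\<phi> = Mult u one_L2"
proof -
  obtain F where F: "square_integrable F" "\<phi> = abs_L2 F"
    using L2_cases by blast
  \<comment> \<open>The values of \<open>F\<close> on the exceptional null set are replaced by
    1.\<close>
  define u where "u z = (if cmod (F z) = 1 then F z else 1)" for z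
  have [measurable]: "F \<in> borel_measurable circle"
    using F(1) by (simp add: square_integrable_def)
  have u1: "cmod (u z) = 1" for z by (simp add: u_def)
  have "u \<in> borel_measurable circle"
    unfolding u_def by measurable
  then have bm: "bounded_mult u"
    using u1 by (auto simp: bounded_mult_def)
  have "AE z in circle. cmod (F z) = 1"
    using assms F by (simp add: inner_function_def unimodular.abs_eq L2_eq_refl)
  then have "AE z in circle. F z = u z"
    by eventually_elim (simp add: u_def)
  then have "\<phi> = Mult u one_L2"
    using F bm by (simp add: Mult_one_abs abs_L2_eq_iff square_integrable_bounded_mult)
  moreover have "inner_symbol u"
    using bm u1 assms calculation by (simp add: inner_symbol_def inner_function_def)
  ultimately show ?thesis using that by blast
qed

lemma is_product_Mult:
  assumes "bounded_mult u"
  shows "is_product (Mult u one_L2) f h \<longleftrightarrow> h = Mult u f"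
proof -
  obtain F H where FH: "square_integrable F" "f = abs_L2 F" "square_integrable H" "h = abs_L2 H"
    using L2_cases by metis
  then show ?thesis
    using assms by (simp add: Mult_one_abs Mult_abs_L2 abs_L2_eq_iff square_integrable_mult
        is_product.abs_eq L2_eq_refl square_integrable_bounded_mult)
qed

lemma mult_Hardy_Mult: "bounded_mult u \<Longrightarrow> mult_Hardy (Mult u one_L2) = Mult u ` Hardy"
  by (auto simp: mult_Hardy_def is_product_Mult)

lemma L2_represents_iff:
  assumes "bounded_mult v"
  shows "L2_represents v \<phi> \<longleftrightarrow> \<phi> = Mult v one_L2"
proof -
  obtain F where F: "square_integrable F" "\<phi> = abs_L2 F"
    using L2_cases by blast
  then show ?thesis
    using assms by (simp add: Mult_one_abs abs_L2_eq_iff L2_represents.abs_eq L2_eq_refl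
        square_integrable_bounded_mult)
qed

lemma Mult_cnj_cancel:
  assumes "bounded_mult u" "\<And>z. cmod z = 1 \<Longrightarrow> cmod (u z) = 1"
  shows "Mult (\<lambda>z. cnj (u z)) (Mult u f) = f" "Mult u (Mult (\<lambda>z. cnj (u z)) f) = f"
proof -
  have eq: "cnj (u z) * u z = 1" "u z * cnj (u z) = 1" if "cmod z = 1" for z
    using assms(2)[OF that] complex_norm_square[of "u z"] by (simp_all add: mult.commute)
  have "Mult (\<lambda>z. cnj (u z) * u z) f = Mult (\<lambda>_. 1) f" "Mult (\<lambda>z. u z * cnj (u z)) f = Mult (\<lambda>_. 1) f"
    using assms(1) by (intro Mult_cong bounded_mult_times bounded_mult_cnj bounded_mult_const; simp add: eq)+
  then show "Mult (\<lambda>z. cnj (u z)) (Mult u f) = f" "Mult u (Mult (\<lambda>z. cnj (u z)) f) = f"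
    using assms(1) by (simp_all add: Mult_Mult)
qed

lemma cinner_Mult_unimodular:
  assumes "bounded_mult u" "\<And>z. cmod z = 1 \<Longrightarrow> cmod (u z) = 1"
  shows "cinner (Mult u f) (Mult u g) = cinner f g"
  using assms Mult_cnj_cancel(1)[OF assms] by (simp add: cinner_Mult_left)

text \<open>By duality. For \<open>n < 0\<close> the vector \<open>g\<close> has coefficient at
  \<open>k\<close> conjugate to that of \<open>u\<close> at \<open>n - k\<close>, which vanishes for
  \<open>k \<ge> 0\<close>; so \<open>g\<close> is orthogonal to \<open>f\<close>.\<close>

lemma Mult_inner_Hardy:
  assumes u: "inner_symbol u" and f: "f \<in> Hardy"
  shows "Mult u f \<in> Hardy"
proof -
  have bm: "bounded_mult u" using u by (simp add: inner_symbol_def)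
  have "fourier (Mult u f) n = 0" if n: "n < 0" for n
  proof -
    define g where "g = Mult (\<lambda>z. cnj (u z)) (zpow n)"
    have "fourier g k = 0" if "k \<ge> 0" for k
    proof -
      have "fourier g k = cinner (zpow n) (Mult u (zpow k))"
        using bm by (simp add: g_def fourier_eq_cinner cinner_Mult_left)
      also have "Mult u (zpow k) = Mult (\<lambda>z. z powi k) (Mult u one_L2)"
        using bm by (simp add: zpow_def Mult_Mult mult.commute)
      also have "cinner (zpow n) \<dots> = cnj (fourier (Mult u one_L2) (n - k))"
        unfolding cinner_zpow_left fourier_Mult_power_int ..
      also have "\<dots> = 0"
        using u n that by (simp add: inner_symbol_def Hardy_def)
      finally show ?thesis .
    qed
    then have "cinner g f = 0"
      by (intro Hardy_orth[OF f])
    then have "cinner f g = 0"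
      by (subst cinner_commute) simp
    then show ?thesis
      using bm by (simp add: fourier_eq_cinner cinner_Mult_left g_def)
  qed
  then show ?thesis by (simp add: Hardy_def)
qed

text \<open>As an orthogonal complement, the range is visibly a closed subspace.\<close>

lemma Mult_Hardy_eq_orth:
  assumes u: "inner_symbol u"
  shows "Mult u ` Hardy = {f. \<forall>g\<in>Mult u ` zpow ` {..<0}. cinner f g = 0}"
proof -
  have uu: "bounded_mult u" "\<And>z. cmod z = 1 \<Longrightarrow> cmod (u z) = 1"
    using u by (auto simp: inner_symbol_def)
  have "f \<in> Mult u ` Hardy \<longleftrightarrow> Mult (\<lambda>z. cnj (u z)) f \<in> Hardy" for f
    using Mult_cnj_cancel[OF uu] by (metis (no_types, lifting) image_iff)
  moreover have "Mult (\<lambda>z. cnj (u z)) f \<in> Hardy \<longleftrightarrow> (\<forall>g\<in>Mult u ` zpow ` {..<0}. cinner f g = 0)" for f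
    using uu(1) by (auto simp: Hardy_eq_orth cinner_Mult_left)
  ultimately show ?thesis by blast
qed

lemma closed_subspace_Mult_Hardy: "inner_symbol u \<Longrightarrow> closed_subspace (Mult u ` Hardy)"
  by (simp only: Mult_Hardy_eq_orth closed_subspace_orth)

section \<open>Blaschke factors\<close>

lemma blaschke_factor_eq:
  assumes "cmod a < 1"
  obtains c where "cmod c = 1" "\<And>z. blaschke_factor a z = c * ((z - a) / (1 - cnj a * z))"
proof (cases "a = 0")
  case True
  then show ?thesis using that[of 1] by (simp add: blaschke_factor_def)
next
  case False
  have n1: "cmod (- (cnj a / of_real (cmod a))) = 1"
    using False by (simp add: norm_divide)
  show ?thesis
  proof (rule that[OF n1])
    show "blaschke_factor a z = - (cnj a / of_real (cmod a)) * ((z - a) / (1 - cnj a * z))" for z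
    proof -
      have "(a - z) / (1 - cnj a * z) = - ((z - a) / (1 - cnj a * z))"
        unfolding minus_divide_left by simp
      then show ?thesis
        using False by (simp only: blaschke_factor_def if_False mult_minus_left mult_minus_right)
    qed
  qed
qed

lemma bounded_mult_blaschke [simp]:
  assumes "cmod a < 1"
  shows "bounded_mult (blaschke_factor a)"
proof -
  obtain c where c: "cmod c = 1" "\<And>z. blaschke_factor a z = c * ((z - a) / (1 - cnj a * z))"
    using blaschke_factor_eq[OF assms] by blast
  have "bounded_mult (\<lambda>z. c * ((z - a) * (1 / (1 - cnj a * z))))"
    using assms by (intro bounded_mult_times bounded_mult_const bounded_mult_linear bounded_mult_inverse_one_minus) simp
  moreover have "blaschke_factor a = (\<lambda>z. c * ((z - a) * (1 / (1 - cnj a * z))))"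
    by (rule ext) (simp add: c(2))
  ultimately show ?thesis by simp
qed

text \<open>The factors \<open>blaschke_factor a\<close> and \<open>z - a\<close> differ by a
  constant and by \<open>1 - cnj a * z\<close>, which is invertible on \<open>Hardy\<close>;
  divisibility by one is divisibility by the other.\<close>

lemma Mult_blaschke:
  assumes a: "cmod a < 1"
  obtains c where "cmod c = 1"
    "\<And>f. Mult (blaschke_factor a) f = Mult (\<lambda>z. z - a) (c *\<^sub>C Mult (\<lambda>z. 1 / (1 - cnj a * z)) f)"
    "\<And>f. Mult (\<lambda>z. z - a) f = Mult (blaschke_factor a) (cnj c *\<^sub>C Mult (\<lambda>z. 1 - cnj a * z) f)"
proof -
  obtain c where c: "cmod c = 1" "\<And>z. blaschke_factor a z = c * ((z - a) / (1 - cnj a * z))"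
    using blaschke_factor_eq[OF a] by blast
  have bm: "bounded_mult (\<lambda>z. 1 / (1 - cnj a * z))"
    using a by (intro bounded_mult_inverse_one_minus) simp
  have "Mult (blaschke_factor a) f = Mult (\<lambda>z. (z - a) * (c * (1 / (1 - cnj a * z)))) f" for f
    using bm by (intro Mult_cong bounded_mult_times bounded_mult_const bounded_mult_linear bounded_mult_blaschke a)
       (simp_all add: c(2))
  then have 1: "Mult (blaschke_factor a) f = Mult (\<lambda>z. z - a) (c *\<^sub>C Mult (\<lambda>z. 1 / (1 - cnj a * z)) f)" for f
    by (simp only: Mult_Mult[symmetric] Mult_scaleC_left[symmetric] bm bounded_mult_times bounded_mult_const bounded_mult_linear Mult_scaleC_left)
  have "Mult (\<lambda>z. 1 / (1 - cnj a * z)) (Mult (\<lambda>z. 1 - cnj a * z) f) = f" for f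
    using Mult_one_minus_inverse[of "cnj a" f] Mult_Mult[OF bm bounded_mult_one_minus, of "cnj a" f]
      Mult_Mult[OF bounded_mult_one_minus bm, of "cnj a" f] a
    by (simp only: mult.commute complex_mod_cnj)
  moreover have "c * cnj c = 1"
    using c(1) complex_norm_square[of c] by simp
  ultimately have 2: "Mult (\<lambda>z. z - a) f = Mult (blaschke_factor a) (cnj c *\<^sub>C Mult (\<lambda>z. 1 - cnj a * z) f)" for f
    unfolding 1 by (simp add: Mult_scaleC_right bm)
  show ?thesis using that c(1) 1 2 by blast
qed

lemma cmod_blaschke_factor:
  assumes a: "cmod a < 1" and z: "cmod z = 1"
  shows "cmod (blaschke_factor a z) = 1"
proof -
  obtain c where c: "cmod c = 1" "blaschke_factor a z = c * ((z - a) / (1 - cnj a * z))"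
    using blaschke_factor_eq[OF a] by metis
  have "z * cnj z = 1" using z complex_norm_square[of z] by simp
  then have "z - a = z * cnj (1 - cnj a * z)" by (simp add: algebra_simps)
  then have "cmod (z - a) = cmod z * cmod (cnj (1 - cnj a * z))"
    by (simp only: norm_mult)
  then have "cmod (z - a) = cmod (1 - cnj a * z)"
    unfolding z complex_mod_cnj by simp
  moreover have "1 - cnj a * z \<noteq> 0"
    using one_minus_neq_0[of "cnj a" z] a z by simp
  ultimately show ?thesis
    using c by (simp add: norm_mult norm_divide)
qed

lemma
  assumes "cmod a < 1" "f \<in> Hardy"
  shows Mult_blaschke_Hardy: "Mult (blaschke_factor a) f \<in> Hardy"
    and cinner_Mult_blaschke_szego: "cinner (Mult (blaschke_factor a) f) (szego a) = 0"
proof -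
  obtain c where c: "Mult (blaschke_factor a) f = Mult (\<lambda>z. z - a) (c *\<^sub>C Mult (\<lambda>z. 1 / (1 - cnj a * z)) f)"
    using Mult_blaschke[OF assms(1)] by metis
  have "c *\<^sub>C Mult (\<lambda>z. 1 / (1 - cnj a * z)) f \<in> Hardy"
    using assms by (intro Hardy_intros Mult_inverse_one_minus_Hardy) simp_all
  then show "Mult (blaschke_factor a) f \<in> Hardy" "cinner (Mult (blaschke_factor a) f) (szego a) = 0"
    unfolding c using assms(1) by (simp_all only: Mult_linear_Hardy cinner_Mult_linear_szego_Hardy)
qed

lemma inner_symbol_blaschke: "cmod a < 1 \<Longrightarrow> inner_symbol (blaschke_factor a)"
  by (simp add: inner_symbol_def cmod_blaschke_factor Mult_blaschke_Hardy one_Hardy)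

lemma Hardy_divide_blaschke:
  assumes a: "cmod a < 1" and f: "f \<in> Hardy" "cinner f (szego a) = 0"
  shows "f \<in> Mult (blaschke_factor a) ` Hardy"
proof -
  obtain q where q: "q \<in> Hardy" "f = Mult (\<lambda>z. z - a) q"
    using Hardy_divide_linear[OF assms] by blast
  obtain c where "Mult (\<lambda>z. z - a) q = Mult (blaschke_factor a) (cnj c *\<^sub>C Mult (\<lambda>z. 1 - cnj a * z) q)"
    using Mult_blaschke[OF a] by metis
  moreover have "cnj c *\<^sub>C Mult (\<lambda>z. 1 - cnj a * z) q \<in> Hardy"
    by (intro Hardy_intros Mult_one_minus_Hardy q(1))
  ultimately show ?thesis
    using q(2) by blast
qed

text \<open>On the circle the conjugate of a Blaschke factor is its inverse, so \<open>v\<close> is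
  the quotient of \<open>u\<close> by that factor. The zero of \<open>u\<close> at \<open>a\<close>
  puts the quotient back into \<open>Hardy\<close>.\<close>

lemma inner_symbol_divide_blaschke:
  assumes a: "cmod a < 1" and u: "inner_symbol u" and zero: "cinner (Mult u one_L2) (szego a) = 0"
  obtains v where "inner_symbol v" "\<And>f. Mult u f = Mult (blaschke_factor a) (Mult v f)"
proof -
  define v where "v z = cnj (blaschke_factor a z) * u z" for z
  have bm: "bounded_mult (blaschke_factor a)" "bounded_mult u" "bounded_mult v"
    unfolding v_def using a u by (simp_all add: inner_symbol_def)
  have Mv: "Mult v f = Mult (\<lambda>z. cnj (blaschke_factor a z)) (Mult u f)" for f
    unfolding v_def using bm by (simp add: Mult_Mult)
  note cancel = Mult_cnj_cancel[OF bm(1) cmod_blaschke_factor[OF a]]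
  obtain q where q: "q \<in> Hardy" "Mult u one_L2 = Mult (blaschke_factor a) q"
    using Hardy_divide_blaschke[OF a _ zero] u by (auto simp: inner_symbol_def)
  have "inner_symbol v"
    using bm(3) u q unfolding inner_symbol_def Mv
    by (simp add: v_def norm_mult cmod_blaschke_factor[OF a] cancel)
  moreover have "Mult u f = Mult (blaschke_factor a) (Mult v f)" for f
    by (simp add: Mv cancel)
  ultimately show ?thesis using that by blast
qed

text \<open>Evaluation at \<open>a\<close> is multiplicative: subtracting from \<open>f\<close> its
  value at \<open>a\<close> leaves a multiple of \<open>z - a\<close> in \<open>Hardy\<close>, and
  \<open>u\<close> times such a multiple still vanishes at \<open>a\<close>.\<close>

lemma cinner_Mult_szego:
  assumes a: "cmod a < 1" and u: "inner_symbol u" and f: "f \<in> Hardy"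
  shows "cinner (Mult u f) (szego a) = cinner f (szego a) * cinner (Mult u one_L2) (szego a)"
proof -
  have bm: "bounded_mult u" using u by (simp add: inner_symbol_def)
  define g where "g = f - cinner f (szego a) *\<^sub>C one_L2"
  have "g \<in> Hardy" "cinner g (szego a) = 0"
    unfolding g_def
    by (simp_all add: Hardy_intros f one_Hardy cinner_diff_left cinner_scaleC_left cinner_one_szego[OF a])
  then obtain q where q: "q \<in> Hardy" "g = Mult (\<lambda>z. z - a) q"
    using Hardy_divide_linear[OF a] by blast
  have "Mult u g = Mult (\<lambda>z. z - a) (Mult u q)"
    using bm by (simp add: q(2) Mult_Mult mult.commute)
  then have "cinner (Mult u g) (szego a) = 0"
    using cinner_Mult_linear_szego_Hardy[OF a Mult_inner_Hardy[OF u q(1)]] by simp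
  then show ?thesis
    by (simp add: g_def Mult_diff_right[OF bm] Mult_scaleC_right[OF bm] cinner_diff_left cinner_scaleC_left)
qed

section \<open>Polynomials in the range of an inner function\<close>

definition poly_L2 :: "complex poly \<Rightarrow> L2" where
  "poly_L2 p = Mult (poly p) one_L2"

lemma bounded_mult_poly [simp]: "bounded_mult (poly p)"
  by (intro bounded_mult_continuous continuous_intros)

lemma poly_L2_add: "poly_L2 (p + q) = poly_L2 p + poly_L2 q"
  unfolding poly_L2_def by (subst Mult_add_left[symmetric]) (auto intro!: Mult_cong)

lemma poly_L2_smult: "poly_L2 (Polynomial.smult c p) = c *\<^sub>C poly_L2 p"
  unfolding poly_L2_def by (subst Mult_scaleC_left[symmetric]) (auto intro!: Mult_cong)

lemma poly_L2_const: "poly_L2 [:c:] = c *\<^sub>C one_L2"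
proof -
  have "poly_L2 [:c:] = Mult (\<lambda>_. c) one_L2"
    unfolding poly_L2_def by (intro Mult_cong) simp_all
  then show ?thesis by simp
qed

lemma poly_L2_pCons: "poly_L2 (pCons c p) = c *\<^sub>C one_L2 + Mult (\<lambda>z. z) (poly_L2 p)"
proof -
  have "poly_L2 (pCons c p) = Mult (\<lambda>z. c + z * poly p z) one_L2"
    unfolding poly_L2_def by (intro Mult_cong) simp_all
  also have "\<dots> = Mult (\<lambda>_. c) one_L2 + Mult (\<lambda>z. z * poly p z) one_L2"
    by (rule Mult_add_left) simp_all
  finally show ?thesis by (simp add: poly_L2_def Mult_Mult)
qed

lemma poly_L2_linear_mult: "poly_L2 ([:- r, 1:] * q) = Mult (\<lambda>z. z - r) (poly_L2 q)"
  unfolding poly_L2_def by (subst Mult_Mult) (auto intro!: Mult_cong simp: algebra_simps)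

lemma poly_L2_Hardy: "poly_L2 p \<in> Hardy"
proof (induction p)
  case 0
  show ?case using poly_L2_const[of 0] by (simp add: L2.subspace_0[OF subspace_Hardy])
next
  case (pCons c p)
  then show ?case
    unfolding poly_L2_pCons by (intro Hardy_intros one_Hardy Mult_ident_Hardy)
qed

section \<open>Finite Blaschke products and division of roots\<close>

abbreviation blaschke_product :: "complex list \<Rightarrow> complex \<Rightarrow> complex" where
  "blaschke_product as z \<equiv> (\<Prod>a\<leftarrow>as. blaschke_factor a z)"

lemma bounded_mult_blaschke_product [simp]:
  "\<forall>a\<in>set as. cmod a < 1 \<Longrightarrow> bounded_mult (blaschke_product as)"
  by (induction as) simp_all

lemma Mult_blaschke_product_Cons:
  assumes "\<forall>a\<in>set (b # as). cmod a < 1"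
  shows "Mult (blaschke_product (b # as)) f = Mult (blaschke_factor b) (Mult (blaschke_product as) f)"
    "Mult (blaschke_product (b # as)) f = Mult (blaschke_product as) (Mult (blaschke_factor b) f)"
  using assms by (simp_all add: Mult_Mult mult.commute)

lemma inner_symbol_blaschke_product:
  "\<forall>a\<in>set as. cmod a < 1 \<Longrightarrow> inner_symbol (blaschke_product as)"
proof (induction as)
  case Nil
  then show ?case by (simp add: inner_symbol_def one_Hardy)
next
  case (Cons a as)
  then have "Mult (blaschke_product (a # as)) one_L2 \<in> Hardy"
    unfolding Mult_blaschke_product_Cons(1)[OF Cons.prems]
    by (intro Mult_blaschke_Hardy) (simp_all add: inner_symbol_def)
  with Cons show ?case
    by (simp add: inner_symbol_def norm_mult cmod_blaschke_factor)
qed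

text \<open>With \<open>u\<close> and its conjugate both in \<open>Hardy\<close>, coefficients
  vanish on both sides of 0. The remaining constant is unimodular because multiplication by
  \<open>u\<close> is isometric.\<close>

lemma inner_symbol_invertible:
  assumes u: "inner_symbol u" and w: "Mult (\<lambda>z. cnj (u z)) one_L2 \<in> Hardy"
  obtains c where "cmod c = 1" "Mult u one_L2 = c *\<^sub>C one_L2"
proof -
  have uu: "bounded_mult u" "\<And>z. cmod z = 1 \<Longrightarrow> cmod (u z) = 1" "Mult u one_L2 \<in> Hardy"
    using u by (auto simp: inner_symbol_def)
  define c where "c = fourier (Mult u one_L2) 0"
  have "fourier (Mult u one_L2) n = fourier (c *\<^sub>C zpow 0) n" for n
  proof (cases n "0::int" rule: linorder_cases)
    case less
    then show ?thesis
      using uu(3) by (simp add: Hardy_def fourier_scaleC fourier_zpow)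
  next
    case equal
    then show ?thesis
      by (simp add: c_def fourier_scaleC fourier_zpow)
  next
    case greater
    have "fourier (Mult u one_L2) n = cinner one_L2 (Mult (\<lambda>z. cnj (u z)) (zpow n))"
      using uu(1) by (simp add: fourier_eq_cinner cinner_Mult_left)
    also have "Mult (\<lambda>z. cnj (u z)) (zpow n) = Mult (\<lambda>z. z powi n) (Mult (\<lambda>z. cnj (u z)) one_L2)"
      using uu(1) by (simp add: zpow_def Mult_Mult mult.commute)
    also have "cinner one_L2 \<dots> = cnj (fourier (Mult (\<lambda>z. cnj (u z)) one_L2) (- n))"
      using cinner_zpow_left[of 0] by (simp add: zpow_0 fourier_Mult_power_int)
    also have "\<dots> = 0"
      using w greater by (simp add: Hardy_def)
    finally show ?thesis
      using greater by (simp add: fourier_scaleC fourier_zpow)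
  qed
  then have "Mult u one_L2 = c *\<^sub>C zpow 0"
    by (rule L2_eqI_fourier)
  then have eq: "Mult u one_L2 = c *\<^sub>C one_L2"
    by (simp add: zpow_0)
  have "c * cnj c = cinner (c *\<^sub>C one_L2) (c *\<^sub>C one_L2)"
    using cinner_zpow[of 0 0] by (simp add: cinner_scaleC_left cinner_scaleC_right zpow_0)
  also have "\<dots> = 1"
    unfolding eq[symmetric]
    using cinner_Mult_unimodular[OF uu(1,2)] cinner_zpow[of 0 0] by (simp add: zpow_0)
  finally have "(cmod c)\<^sup>2 = 1"
    unfolding complex_norm_square[symmetric] of_real_eq_1_iff .
  then have "cmod c = 1"
    by (simp add: power2_eq_1_iff) (use norm_ge_zero[of c] in linarith)
  with eq show ?thesis using that by blast
qed

text \<open>Induction on the degree of \<open>p = u f\<close>. A root \<open>r\<close> of \<open>p\<close> with \<open>|r| \<ge> 1\<close> can be divided out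
  of \<open>f\<close>, and one with \<open>|r| < 1\<close> is a zero of \<open>f\<close> or of \<open>u\<close>.\<close>
theorem poly_in_range_imp_blaschke:
  assumes "inner_symbol u" "p \<noteq> 0" "poly_L2 p \<in> Mult u ` Hardy"
  shows "\<exists>c as. cmod c = 1 \<and> (\<forall>a\<in>set as. cmod a < 1) \<and> Mult u one_L2 = c *\<^sub>C Mult (blaschke_product as) one_L2"
  using assms
proof (induction "degree p" arbitrary: p u)
  case 0
  then obtain a where a: "p = [:a:]" "a \<noteq> 0"
    by (metis degree_eq_zeroE pCons_eq_0_iff)
  have uu: "bounded_mult u" "\<And>z. cmod z = 1 \<Longrightarrow> cmod (u z) = 1"
    using 0 by (auto simp: inner_symbol_def)
  obtain f where f: "f \<in> Hardy" "a *\<^sub>C one_L2 = Mult u f"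
    using 0 a by (auto simp: poly_L2_const)
  \<comment> \<open>Dividing the constant \<open>a\<close> by \<open>u\<close> gives
    \<open>f\<close>, so the conjugate of \<open>u\<close> is a multiple of
    \<open>f\<close>.\<close>
  have "a *\<^sub>C Mult (\<lambda>z. cnj (u z)) one_L2 = f"
    using Mult_cnj_cancel(1)[OF uu, of f] uu(1) by (simp add: Mult_scaleC_right flip: f(2))
  then have "Mult (\<lambda>z. cnj (u z)) one_L2 = (1 / a) *\<^sub>C f"
    using a(2) by auto
  then have "Mult (\<lambda>z. cnj (u z)) one_L2 \<in> Hardy"
    by (simp add: Hardy_intros f(1))
  then obtain c where "cmod c = 1" "Mult u one_L2 = c *\<^sub>C one_L2"
    using inner_symbol_invertible[OF 0(2)] by blast
  then show ?case
    by (intro exI[of _ c] exI[of _ "[]"]) simp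
next
  case (Suc n)
  have uu: "bounded_mult u" "\<And>z. cmod z = 1 \<Longrightarrow> cmod (u z) = 1"
    using Suc by (auto simp: inner_symbol_def)
  have "\<not> constant (poly p)"
    using Suc(2) by (simp add: constant_degree)
  then obtain r where "poly p r = 0"
    using fundamental_theorem_of_algebra by blast
  then obtain q where q: "p = [:- r, 1:] * q"
    by (auto simp: poly_eq_0_iff_dvd elim: dvdE)
  then have q0: "q \<noteq> 0"
    using Suc(4) by auto
  have "degree p = Suc (degree q)"
    unfolding q using q0 by (subst degree_mult_eq) auto
  then have deg: "n = degree q"
    using Suc(2) by simp
  note IH = Suc(1)[OF deg _ q0]
  obtain f where f: "f \<in> Hardy" "Mult (\<lambda>z. z - r) (poly_L2 q) = Mult u f"
    using Suc(5) by (auto simp: q poly_L2_linear_mult simp del: mult_pCons_left)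
  show ?case
  proof (cases "cmod r < 1")
    case False
    \<comment> \<open>The quotient of \<open>q\<close> by \<open>u\<close>. Its product with
      \<open>z - r\<close> is \<open>f\<close>, so a root off the open disk cannot keep it out of
      \<open>Hardy\<close>.\<close>
    define h where "h = Mult (\<lambda>z. cnj (u z)) (poly_L2 q)"
    have "Mult (\<lambda>z. z - r) h = Mult (\<lambda>z. cnj (u z)) (Mult u f)"
      unfolding h_def f(2)[symmetric] using uu(1) by (simp add: Mult_Mult mult.commute)
    then have "Mult (\<lambda>z. z - r) h \<in> Hardy"
      by (simp add: Mult_cnj_cancel[OF uu] f(1))
    then have "h \<in> Hardy"
      using False Hardy_if_Mult_linear_outside[of r h] by simp
    moreover have "poly_L2 q = Mult u h"
      by (simp add: h_def Mult_cnj_cancel[OF uu])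
    ultimately show ?thesis
      using IH[OF Suc(3)] by blast
  next
    case True
    have "cinner (Mult u f) (szego r) = 0"
      unfolding f(2)[symmetric] by (rule cinner_Mult_linear_szego_Hardy[OF True poly_L2_Hardy])
    then consider "cinner f (szego r) = 0" | "cinner (Mult u one_L2) (szego r) = 0"
      using cinner_Mult_szego[OF True Suc(3) f(1)] by auto
    then show ?thesis
    proof cases
      case 1
      then obtain g where g: "g \<in> Hardy" "f = Mult (\<lambda>z. z - r) g"
        using Hardy_divide_linear[OF True f(1)] by blast
      have "Mult (\<lambda>z. z - r) (poly_L2 q) = Mult (\<lambda>z. z - r) (Mult u g)"
        using f(2) uu(1) by (simp add: g(2) Mult_Mult mult.commute)
      then have "poly_L2 q = Mult u g"
        by (rule Mult_linear_cancel[OF True])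
      then show ?thesis
        using IH[OF Suc(3)] g(1) by blast
    next
      case 2
      obtain v where v: "inner_symbol v" "\<And>f. Mult u f = Mult (blaschke_factor r) (Mult v f)"
        using inner_symbol_divide_blaschke[OF True Suc(3) 2] by blast
      have bm_v: "bounded_mult v" using v(1) by (simp add: inner_symbol_def)
      have bm: "bounded_mult (\<lambda>z. 1 / (1 - cnj r * z))"
        using True by (intro bounded_mult_inverse_one_minus) simp
      obtain c where c: "\<And>f. Mult (blaschke_factor r) f = Mult (\<lambda>z. z - r) (c *\<^sub>C Mult (\<lambda>z. 1 / (1 - cnj r * z)) f)"
        using Mult_blaschke[OF True] by metis
      \<comment> \<open>The Blaschke factor removed from \<open>u\<close> is more than
        \<open>z - r\<close>: its constant and its denominator are passed on to
        \<open>f\<close>.\<close>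
      define g where "g = c *\<^sub>C Mult (\<lambda>z. 1 / (1 - cnj r * z)) f"
      have "g \<in> Hardy"
        unfolding g_def using True f(1) by (intro Hardy_intros Mult_inverse_one_minus_Hardy) simp_all
      have "Mult (\<lambda>z. z - r) (poly_L2 q) = Mult (\<lambda>z. z - r) (c *\<^sub>C Mult (\<lambda>z. 1 / (1 - cnj r * z)) (Mult v f))"
        unfolding f(2) v(2) c ..
      then have "poly_L2 q = c *\<^sub>C Mult (\<lambda>z. 1 / (1 - cnj r * z)) (Mult v f)"
        by (rule Mult_linear_cancel[OF True])
      also have "\<dots> = Mult v g"
        unfolding g_def using bm bm_v by (simp add: Mult_scaleC_right Mult_Mult mult.commute)
      finally have "poly_L2 q \<in> Mult v ` Hardy"
        using \<open>g \<in> Hardy\<close> by blast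
      then obtain d as where das: "cmod d = 1" "\<forall>a\<in>set as. cmod a < 1"
          "Mult v one_L2 = d *\<^sub>C Mult (blaschke_product as) one_L2"
        using IH[OF v(1)] by blast
      have r_as: "\<forall>a\<in>set (r # as). cmod a < 1"
        using das(2) True by simp
      have "Mult u one_L2 = d *\<^sub>C Mult (blaschke_product (r # as)) one_L2"
        unfolding v(2) das(3) Mult_blaschke_product_Cons(1)[OF r_as]
        using True by (simp add: Mult_scaleC_right)
      then show ?thesis
        using das(1) r_as by blast
    qed
  qed
qed

text \<open>The arbitrary degree bound \<open>d\<close> drives the induction. It supplies two
  solutions of different degrees, a combination of them kills the new functional, and the leading
  term of the larger one survives.\<close>

lemma exists_poly_in_kernels:
  fixes l :: "'x \<Rightarrow> complex poly \<Rightarrow> complex"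
  assumes "finite X"
    and "\<And>x p q. x \<in> X \<Longrightarrow> l x (p + q) = l x p + l x q"
    and "\<And>x c p. x \<in> X \<Longrightarrow> l x (Polynomial.smult c p) = c * l x p"
  shows "\<exists>p. degree p > d \<and> (\<forall>x\<in>X. l x p = 0)"
  using assms
proof (induction X arbitrary: d rule: finite_induct)
  case empty
  have "degree (monom 1 (Suc d) :: complex poly) > d"
    by (simp add: degree_monom_eq)
  then show ?case by blast
next
  case (insert x X)
  then have IH: "\<exists>p. degree p > d \<and> (\<forall>x\<in>X. l x p = 0)" for d
    by simp
  obtain p where p: "degree p > d" "\<forall>x\<in>X. l x p = 0"
    using IH by blast
  obtain q where q: "degree q > degree p" "\<forall>x\<in>X. l x q = 0"
    using IH by blast
  show ?case
  proof (cases "l x p = 0")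
    case True
    then show ?thesis using p by blast
  next
    case False
    define r where "r = Polynomial.smult (l x p) q + Polynomial.smult (- l x q) p"
    have "degree r = degree q"
      unfolding r_def using False q(1)
      by (subst degree_add_eq_left) (auto intro: le_less_trans[OF degree_smult_le])
    moreover have "l y r = l x p * l y q + - l x q * l y p" if "y \<in> insert x X" for y
      unfolding r_def by (simp only: insert.prems[OF that])
    then have "\<forall>y\<in>insert x X. l y r = 0"
      using p(2) q(2) by auto
    ultimately show ?thesis
      using p(1) q(1) by (intro exI[of _ r]) simp
  qed
qed

section \<open>The orthogonal complement of the range of a finite Blaschke product\<close>

text \<open>The product \<open>?B\<close> over the tail is isometric, so it transports the case of
  one factor, where the complement is spanned by \<open>szego a\<close>, into the range of
  \<open>?B\<close>. The vectors are not normalized, whence the divisions by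
  \<open>cinner e e\<close> and the condition that 0 is not among them.\<close>

lemma blaschke_complement:
  assumes "\<forall>a\<in>set as. cmod a < 1"
  shows "\<exists>N. finite N \<and> card N = length as \<and> N \<subseteq> Hardy \<and> 0 \<notin> N \<and>
    (\<forall>x\<in>N. \<forall>y\<in>N. x \<noteq> y \<longrightarrow> cinner x y = 0) \<and>
    (\<forall>e\<in>N. \<forall>f\<in>Hardy. cinner (Mult (blaschke_product as) f) e = 0) \<and>
    (\<forall>f\<in>Hardy. f - (\<Sum>e\<in>N. (cinner f e / cinner e e) *\<^sub>C e) \<in> Mult (blaschke_product as) ` Hardy)"
  using assms
proof (induction as)
  case Nil
  show ?case by (intro exI[of _ "{}"]) simp
next
  case (Cons a as)
  let ?B = "blaschke_product as"
  have as: "\<forall>a\<in>set as. cmod a < 1" and a: "cmod a < 1"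
    using Cons.prems by simp_all
  have B: "bounded_mult ?B" "\<And>z. cmod z = 1 \<Longrightarrow> cmod (?B z) = 1" "inner_symbol ?B"
    using inner_symbol_blaschke_product[OF as] by (auto simp: inner_symbol_def)
  have BH: "Mult (blaschke_product (a # as)) f = Mult ?B (Mult (blaschke_factor a) f)" for f
    by (rule Mult_blaschke_product_Cons(2)[OF Cons.prems])
  from Cons.IH[OF as] obtain N where N: "finite N" "card N = length as" "N \<subseteq> Hardy" "0 \<notin> N"
      "\<forall>x\<in>N. \<forall>y\<in>N. x \<noteq> y \<longrightarrow> cinner x y = 0"
      "\<forall>e\<in>N. \<forall>f\<in>Hardy. cinner (Mult ?B f) e = 0"
      "\<forall>f\<in>Hardy. f - (\<Sum>e\<in>N. (cinner f e / cinner e e) *\<^sub>C e) \<in> Mult ?B ` Hardy"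
    by (elim exE conjE) (rule that)
  define k where "k = Mult ?B (szego a)"
  have szego: "szego a \<in> Hardy"
    by (rule szego_Hardy[OF a])
  have "szego a \<noteq> 0"
    using cinner_one_szego[OF a] by auto
  have kk: "cinner k k = cinner (szego a) (szego a)"
    unfolding k_def by (rule cinner_Mult_unimodular[OF B(1,2)])
  have "k \<noteq> 0"
    using kk \<open>szego a \<noteq> 0\<close> by auto
  have kN: "cinner k e = 0" "cinner e k = 0" if "e \<in> N" for e
    using N(6)[rule_format, OF that szego] cinner_commute[of e k] by (simp_all add: k_def)
  \<comment> \<open>The vector \<open>k\<close> is nonzero and orthogonal to all of
    \<open>N\<close>. This keeps the count exact even for repeated zeros.\<close>
  have "k \<notin> N"
    using kN(1)[of k] \<open>k \<noteq> 0\<close> by auto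
  show ?case
  proof (intro exI[of _ "insert k N"] conjI ballI impI)
    show "finite (insert k N)" "card (insert k N) = length (a # as)"
      using N(1,2) \<open>k \<notin> N\<close> by simp_all
    show "insert k N \<subseteq> Hardy"
      using N(3) Mult_inner_Hardy[OF B(3) szego] by (simp add: k_def)
    show "0 \<notin> insert k N"
      using N(4) \<open>k \<noteq> 0\<close> by auto
    show "cinner x y = 0" if "x \<in> insert k N" "y \<in> insert k N" "x \<noteq> y" for x y
      using that N(5) kN by auto
    fix f assume f: "f \<in> Hardy"
    show "cinner (Mult (blaschke_product (a # as)) f) e = 0" if "e \<in> insert k N" for e
    proof (cases "e = k")
      case True
      then show ?thesis
        unfolding BH k_def
        by (simp only: cinner_Mult_unimodular[OF B(1,2)] cinner_Mult_blaschke_szego[OF a f])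
    next
      case False
      then show ?thesis
        unfolding BH using that by (intro N(6)[rule_format] Mult_blaschke_Hardy a f) simp
    qed
    define S where "S = (\<Sum>e\<in>N. (cinner f e / cinner e e) *\<^sub>C e)"
    obtain g where g: "g \<in> Hardy" "f - S = Mult ?B g"
      using N(7)[rule_format, OF f] by (auto simp: S_def)
    have "cinner S k = 0"
      unfolding S_def cinner_sum_left cinner_scaleC_left using kN by simp
    then have "cinner f k = cinner (f - S) k"
      by (simp add: cinner_diff_left)
    also have "\<dots> = cinner g (szego a)"
      unfolding g(2) k_def by (rule cinner_Mult_unimodular[OF B(1,2)])
    finally have fk: "cinner f k = cinner g (szego a)" .
    \<comment> \<open>By isometry this is the coefficient of \<open>g\<close> along
      \<open>szego a\<close>; subtracting that component makes \<open>g\<close> vanish at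
      \<open>a\<close>.\<close>
    define d where "d = cinner f k / cinner k k"
    have "g - d *\<^sub>C szego a \<in> Hardy"
      by (intro Hardy_intros g szego)
    moreover have "cinner (g - d *\<^sub>C szego a) (szego a) = 0"
      using \<open>szego a \<noteq> 0\<close> by (simp add: d_def fk kk cinner_diff_left cinner_scaleC_left)
    ultimately obtain q where q: "q \<in> Hardy" "g - d *\<^sub>C szego a = Mult (blaschke_factor a) q"
      using Hardy_divide_blaschke[OF a] by blast
    have "f - (\<Sum>e\<in>insert k N. (cinner f e / cinner e e) *\<^sub>C e) = f - S - d *\<^sub>C k"
      using N(1) \<open>k \<notin> N\<close> by (simp add: S_def d_def algebra_simps)
    also have "\<dots> = Mult ?B (g - d *\<^sub>C szego a)"
      unfolding g(2) k_def using B(1) by (simp add: Mult_diff_right Mult_scaleC_right)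
    also have "\<dots> = Mult (blaschke_product (a # as)) q"
      unfolding q(2) BH ..
    finally show "f - (\<Sum>e\<in>insert k N. (cinner f e / cinner e e) *\<^sub>C e)
        \<in> Mult (blaschke_product (a # as)) ` Hardy"
      using q(1) by blast
  qed
qed

section \<open>Zeros of the extension to the disk\<close>

lemma summable_disk_extension:
  assumes "cmod w < 1"
  shows "summable (\<lambda>n. fourier f (int n) * w ^ n)"
proof (rule summable_comparison_test)
  show "\<exists>N. \<forall>n\<ge>N. norm (fourier f (int n) * w ^ n) \<le> norm f * cmod w ^ n"
    by (simp add: norm_mult norm_power mult_right_mono fourier_le_norm)
  show "summable (\<lambda>n. norm f * cmod w ^ n)"
    using assms by (intro summable_mult summable_geometric) simp
qed

text \<open>Writing \<open>f\<close> as its candidate value \<open>c\<close> plus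
  \<open>z - w\<close> times \<open>q\<close>, the power series at \<open>w\<close> is
  \<open>c\<close> plus a telescoping series. Its sum is the coefficient of \<open>q\<close> at -1,
  which is 0.\<close>

lemma disk_extension_eq_cinner:
  assumes w: "cmod w < 1" and f: "f \<in> Hardy"
  shows "disk_extension f w = cinner f (szego w)"
proof -
  define c where "c = cinner f (szego w)"
  have "f - c *\<^sub>C one_L2 \<in> Hardy" "cinner (f - c *\<^sub>C one_L2) (szego w) = 0"
    by (simp_all add: c_def Hardy_intros f one_Hardy cinner_diff_left cinner_scaleC_left cinner_one_szego[OF w])
  then obtain q where q: "q \<in> Hardy" "f - c *\<^sub>C one_L2 = Mult (\<lambda>z. z - w) q"
    using Hardy_divide_linear[OF w] by blast
  have f_coeff: "fourier f n = c * fourier one_L2 n + (fourier q (n - 1) - w * fourier q n)" for n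
    using fourier_Mult_linear[of w q n, folded q(2)] by (simp add: fourier_diff fourier_scaleC diff_eq_eq)
  have coeff: "fourier f (int n) * w ^ n = (if n = 0 then c else 0) + (fourier q (int n - 1) * w ^ n - fourier q (int n) * w ^ Suc n)" for n
  proof -
    have "fourier one_L2 (int n) = (if n = 0 then 1 else 0)"
      by (simp add: fourier_zpow flip: zpow_0)
    then show ?thesis
      unfolding f_coeff[of "int n"] by (simp add: algebra_simps)
  qed
  have s1: "(\<lambda>n. if n = 0 then c else 0) sums c"
    using sums_single[of 0 "\<lambda>_. c"] by simp
  have s2: "(\<lambda>n. fourier q (int n - 1) * w ^ n - fourier q (int n) * w ^ Suc n) sums (0 - fourier q (int 0 - 1) * w ^ 0)"
  proof -
    define F where "F n = fourier q (int n - 1) * w ^ n" for n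
    have "summable (\<lambda>n. w * (fourier q (int n) * w ^ n))"
      using w by (intro summable_mult summable_disk_extension)
    then have "(\<lambda>n. w * (fourier q (int n) * w ^ n)) \<longlonglongrightarrow> 0"
      by (rule summable_LIMSEQ_zero)
    moreover have "F (Suc n) = w * (fourier q (int n) * w ^ n)" for n
      by (simp add: F_def)
    ultimately have "F \<longlonglongrightarrow> 0"
      by (subst filterlim_sequentially_Suc[symmetric]) simp
    from telescope_sums'[OF this] have "(\<lambda>n. F n - F (Suc n)) sums (F 0 - 0)" .
    moreover have "F 0 = 0"
      using q(1) by (simp add: F_def Hardy_def)
    ultimately show ?thesis
      by (simp add: F_def)
  qed
  have "(\<lambda>n. fourier f (int n) * w ^ n) sums (c + (0 - fourier q (int 0 - 1) * w ^ 0))"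
    unfolding coeff by (rule sums_add[OF s1 s2])
  then show ?thesis
    using q(1) by (simp add: disk_extension_def sums_iff c_def Hardy_def)
qed

section \<open>Zeros and multiplicities of a finite Blaschke product\<close>

lemma cinner_blaschke_szego:
  assumes a: "cmod a < 1" and w: "cmod w < 1"
  shows "cinner (Mult (blaschke_factor a) one_L2) (szego w) = blaschke_factor a w"
proof -
  obtain c where c: "\<And>z. blaschke_factor a z = c * ((z - a) / (1 - cnj a * z))"
    using blaschke_factor_eq[OF a] by metis
  have bm: "bounded_mult (blaschke_factor a)" using a by simp
  define h where "h = Mult (blaschke_factor a) one_L2"
  have h: "h \<in> Hardy"
    unfolding h_def by (rule Mult_blaschke_Hardy[OF a one_Hardy])
  have ident: "cinner (Mult (\<lambda>z. z) f) (szego w) = w * cinner f (szego w)" if "f \<in> Hardy" for f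
    using cinner_Mult_linear_szego_Hardy[OF w that] by (simp add: Mult_linear cinner_diff_left cinner_scaleC_left)
  \<comment> \<open>The denominator is cleared so that only evaluations of linear multiples of
    elements of \<open>Hardy\<close> at \<open>w\<close> are needed.\<close>
  have "Mult (\<lambda>z. 1 - cnj a * z) h = Mult (\<lambda>z. c * (z - a)) one_L2"
    unfolding h_def Mult_Mult[OF bounded_mult_one_minus bm]
    using one_minus_neq_0[of "cnj a"] a bm
    by (intro Mult_cong bounded_mult_times[OF bounded_mult_one_minus bm] bounded_mult_times
        bounded_mult_linear bounded_mult_const) (simp_all add: c)
  also have "\<dots> = c *\<^sub>C Mult (\<lambda>z. z - a) one_L2"
    by (rule Mult_scaleC_left) simp
  finally have "cinner (Mult (\<lambda>z. 1 - cnj a * z) h) (szego w) = c * cinner (Mult (\<lambda>z. z - a) one_L2) (szego w)"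
    by (simp add: cinner_scaleC_left)
  moreover have "cinner (Mult (\<lambda>z. 1 - cnj a * z) h) (szego w) = (1 - cnj a * w) * cinner h (szego w)"
    by (simp add: Mult_one_minus cinner_diff_left cinner_scaleC_left ident[OF h] left_diff_distrib mult.assoc)
  moreover have "cinner (Mult (\<lambda>z. z - a) one_L2) (szego w) = w - a"
    by (simp add: Mult_linear cinner_diff_left cinner_scaleC_left ident[OF one_Hardy] cinner_one_szego[OF w])
  ultimately have "(1 - cnj a * w) * cinner h (szego w) = c * (w - a)"
    by simp
  moreover have "1 - cnj a * w \<noteq> 0"
    using one_minus_neq_0[of "cnj a" w] a w by simp
  ultimately show ?thesis
    unfolding h_def[symmetric] c by (simp add: field_simps)
qed

lemma cinner_blaschke_product_szego:
  assumes "\<forall>a\<in>set as. cmod a < 1" and w: "cmod w < 1"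
  shows "cinner (Mult (blaschke_product as) one_L2) (szego w) = blaschke_product as w"
  using assms(1)
proof (induction as)
  case Nil
  then show ?case by (simp add: cinner_one_szego[OF w])
next
  case (Cons a as)
  have "Mult (blaschke_product as) one_L2 \<in> Hardy"
    using inner_symbol_blaschke_product[of as] Cons.prems by (simp add: inner_symbol_def)
  then have "cinner (Mult (blaschke_product (a # as)) one_L2) (szego w)
      = cinner (Mult (blaschke_product as) one_L2) (szego w) * cinner (Mult (blaschke_factor a) one_L2) (szego w)"
    unfolding Mult_blaschke_product_Cons(1)[OF Cons.prems]
    using Cons.prems by (intro cinner_Mult_szego w inner_symbol_blaschke) simp_all
  then show ?case
    using Cons cinner_blaschke_szego[OF _ w] by (simp add: mult.commute)
qed

text \<open>The nonvanishing cofactor is what lets \<open>zorder\<close> be read off as the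
  multiplicity of \<open>w\<close> in the list.\<close>

lemma blaschke_product_local_factor:
  assumes "\<forall>a\<in>set as. cmod a < 1" and w: "cmod w < 1"
  shows "\<exists>g. g holomorphic_on ball 0 1 \<and> g w \<noteq> 0 \<and>
    (\<forall>z\<in>ball 0 1. blaschke_product as z = g z * (z - w) ^ count_list as w)"
  using assms(1)
proof (induction as)
  case Nil
  show ?case by (intro exI[of _ "\<lambda>_. 1"]) simp
next
  case (Cons a as)
  then obtain g where g: "g holomorphic_on ball 0 1" "g w \<noteq> 0"
      "\<And>z. z \<in> ball 0 1 \<Longrightarrow> blaschke_product as z = g z * (z - w) ^ count_list as w"
    by auto
  have a: "cmod a < 1" using Cons.prems by simp
  obtain c where c: "cmod c = 1" "\<And>z. blaschke_factor a z = c * ((z - a) / (1 - cnj a * z))"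
    using blaschke_factor_eq[OF a] by blast
  have nz: "1 - cnj a * z \<noteq> 0" if "z \<in> ball 0 1" for z
    using one_minus_neq_0[of "cnj a" z] a that by simp
  have c0: "c \<noteq> 0" using c(1) by auto
  show ?case
  proof (cases "a = w")
    case True
    have "(\<lambda>z. g z * (c / (1 - cnj a * z))) holomorphic_on ball 0 1"
      using nz by (intro holomorphic_intros g(1)) auto
    moreover have "g w * (c / (1 - cnj a * w)) \<noteq> 0"
      using g(2) c0 nz[of w] w by simp
    moreover have "blaschke_product (a # as) z = g z * (c / (1 - cnj a * z)) * (z - w) ^ count_list (a # as) w"
      if "z \<in> ball 0 1" for z
    proof -
      have "blaschke_factor a z = c / (1 - cnj a * z) * (z - w)"
        using c(2)[of z] True by simp
      then show ?thesis
        using g(3)[OF that] True by simp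
    qed
    ultimately show ?thesis by blast
  next
    case False
    have "(\<lambda>z. g z * (c * ((z - a) / (1 - cnj a * z)))) holomorphic_on ball 0 1"
      using nz by (intro holomorphic_intros g(1)) auto
    moreover have "g w * (c * ((w - a) / (1 - cnj a * w))) \<noteq> 0"
      using g(2) c0 nz[of w] w False by simp
    moreover have "blaschke_product (a # as) z = g z * (c * ((z - a) / (1 - cnj a * z))) * (z - w) ^ count_list (a # as) w"
      if "z \<in> ball 0 1" for z
      using g(3)[OF that] False by (simp add: c(2))
    ultimately show ?thesis by blast
  qed
qed

lemma zero_count_blaschke:
  assumes c: "cmod c = 1" and as: "\<forall>a\<in>set as. cmod a < 1"
    and \<phi>: "\<phi> = c *\<^sub>C Mult (blaschke_product as) one_L2"
  shows "zero_count \<phi> = length as"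
proof -
  have c0: "c \<noteq> 0" using c by auto
  have "\<phi> \<in> Hardy"
    unfolding \<phi> using inner_symbol_blaschke_product[OF as] by (intro Hardy_intros) (simp add: inner_symbol_def)
  then have ext: "disk_extension \<phi> w = c * blaschke_product as w" if "cmod w < 1" for w
    using disk_extension_eq_cinner[OF that] cinner_blaschke_product_szego[OF as that]
    by (simp add: \<phi> cinner_scaleC_left)
  have zorder: "zorder (disk_extension \<phi>) w = int (count_list as w)" if w: "cmod w < 1" for w
  proof -
    obtain g where g: "g holomorphic_on ball 0 1" "g w \<noteq> 0"
      "\<And>z. z \<in> ball 0 1 \<Longrightarrow> blaschke_product as z = g z * (z - w) ^ count_list as w"
      using blaschke_product_local_factor[OF as w] by blast
    show ?thesis
    proof (rule zorder_eqI)
      show "open (ball 0 1 :: complex set)" "w \<in> ball 0 1"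
        using w by simp_all
      show "(\<lambda>z. c * g z) holomorphic_on ball 0 1"
        by (intro holomorphic_intros g(1))
      show "c * g w \<noteq> 0" using c0 g(2) by simp
      show "disk_extension \<phi> z = c * g z * (z - w) powi int (count_list as w)" if "z \<in> ball 0 1" "z \<noteq> w" for z
        using ext[of z] g(3)[OF that(1)] that(1) by simp
    qed
  qed
  have bf0: "blaschke_factor a w = 0 \<longleftrightarrow> w = a" if aw: "cmod a < 1" "cmod w < 1" for a w
  proof -
    obtain d where d: "cmod d = 1" "blaschke_factor a w = d * ((w - a) / (1 - cnj a * w))"
      using blaschke_factor_eq[OF aw(1)] by metis
    then have "d \<noteq> 0" by auto
    then show ?thesis
      using d(2) one_minus_neq_0[of "cnj a" w] aw by simp
  qed
  have "disk_extension \<phi> w = 0 \<longleftrightarrow> w \<in> set as" if w: "cmod w < 1" for w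
  proof -
    have "disk_extension \<phi> w = 0 \<longleftrightarrow> (\<exists>a\<in>set as. blaschke_factor a w = 0)"
      using c0 by (auto simp: ext[OF w] prod_list_zero_iff image_iff)
    also have "\<dots> \<longleftrightarrow> w \<in> set as"
      using as bf0[OF _ w] by auto
    finally show ?thesis .
  qed
  then have "{w \<in> ball 0 1. disk_extension \<phi> w = 0} = set as"
    using as by auto
  then have "zero_count \<phi> = (\<Sum>w\<in>set as. count_list as w)"
    unfolding zero_count_def using as zorder by (intro sum.cong) simp_all
  then show ?thesis
    by (simp add: sum_count_set)
qed

lemma finite_blaschke_product_iff:
  "finite_blaschke_product \<phi> \<longleftrightarrow>
    (\<exists>c as. cmod c = 1 \<and> (\<forall>a\<in>set as. cmod a < 1) \<and> \<phi> = c *\<^sub>C Mult (blaschke_product as) one_L2)"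
proof -
  have "L2_represents (\<lambda>z. c * blaschke_product as z) \<phi> \<longleftrightarrow> \<phi> = c *\<^sub>C Mult (blaschke_product as) one_L2"
    if "\<forall>a\<in>set as. cmod a < 1" for c as
    using that by (subst L2_represents_iff) (simp_all add: Mult_scaleC_left)
  then show ?thesis
    unfolding finite_blaschke_product_def by metis
qed

section \<open>Closed subspaces of finite codimension in the Hardy space\<close>

lemma orth_proj_bounded_op: "closed_subspace W \<Longrightarrow> bounded_op (orth_proj W)"
  using is_orth_proj_orth_proj by (simp add: is_orth_proj_def)

lemma bounded_op_simps:
  assumes "bounded_op T"
  shows "T (f + g) = T f + T g" "T (f - g) = T f - T g" "T (c *\<^sub>C f) = c *\<^sub>C T f" "T 0 = 0"
  using assms linear_diff[of T f g] linear_add[of T f g] linear_0[of T]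
  by (simp_all add: bounded_op_def bounded_linear.linear)

lemma P_plus_Hardy: "f \<in> Hardy \<Longrightarrow> P_plus f = f"
  unfolding P_plus_def by (rule orth_proj_id[OF subspace_Hardy])

lemma P_plus_in_Hardy: "P_plus f \<in> Hardy"
  unfolding P_plus_def by (rule orth_proj_in[OF closed_subspace_Hardy])

lemma P_minus_Hardy:
  assumes "f \<in> Hardy"
  shows "P_minus f = 0"
  unfolding P_minus_def
proof (rule orth_proj_eq_0)
  show "L2.subspace Hardy_minus"
    using closed_subspace_Hardy_minus by (simp add: closed_subspace_def)
  show "cinner f h = 0" if "h \<in> Hardy_minus" for h
    using that assms by (subst cinner_commute) (simp add: Hardy_minus_def)
qed

lemma bounded_op_P_plus: "bounded_op P_plus"
  unfolding P_plus_def by (rule orth_proj_bounded_op[OF closed_subspace_Hardy])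

lemma bounded_op_P_minus: "bounded_op P_minus"
  unfolding P_minus_def by (rule orth_proj_bounded_op[OF closed_subspace_Hardy_minus])

text \<open>A unit fixed vector \<open>v\<close> is within distance less than 1 of some
  \<open>Q g\<close> from a finite net. If it were orthogonal to that \<open>Q g\<close>, then
  \<open>cinner v (v - Q g)\<close> would be 1, against Cauchy-Schwarz.\<close>

lemma compact_fixed_points:
  assumes "Q \<in> compact_ops"
  shows "\<exists>F. finite F \<and> (\<forall>y. Q y = y \<longrightarrow> (\<forall>x\<in>F. cinner y (Q x) = 0) \<longrightarrow> y = 0)"
proof -
  have Q: "bounded_op Q" "compact_on UNIV Q"
    using assms by (simp_all add: compact_ops_def)
  obtain F where F: "finite F" "\<And>f. norm f \<le> 1 \<Longrightarrow> \<exists>g\<in>F. dist (Q g) (Q f) < 1"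
    using compact_on_finite_net[OF Q(2), of 1] by auto
  have "y = 0" if y: "Q y = y" "\<forall>x\<in>F. cinner y (Q x) = 0" for y
  proof (rule ccontr)
    assume "y \<noteq> 0"
    define v where "v = of_real (1 / norm y) *\<^sub>C y"
    have v: "norm v = 1" "Q v = v" "\<forall>x\<in>F. cinner v (Q x) = 0"
      using \<open>y \<noteq> 0\<close> y by (simp_all add: v_def norm_scaleC norm_divide bounded_op_simps[OF Q(1)] cinner_scaleC_left)
    then obtain g where g: "g \<in> F" "dist (Q g) (Q v) < 1"
      using F(2)[of v] by auto
    have "cinner v (v - Q g) = 1"
      using v g(1) by (simp add: cinner_diff_right cinner_self_norm)
    then have "1 \<le> norm v * norm (v - Q g)"
      using norm_cinner_le[of v "v - Q g"] by simp
    then show False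
      using g(2) v by (simp add: dist_norm norm_minus_commute)
  qed
  with F(1) show ?thesis by blast
qed

section \<open>Membership criteria for a closed subspace of \<open>Hardy\<close>\<close>

context
  fixes M :: "L2 set"
  assumes M: "closed_subspace M" and M_Hardy: "M \<subseteq> Hardy"
begin

lemma subspace_M: "L2.subspace M"
  using M by (simp add: closed_subspace_def)

lemma orth_proj_eq_iff:
  assumes "closed_subspace W"
  shows "orth_proj W = orth_proj M \<longleftrightarrow> W = M"
  using orth_proj_inject[OF assms M] by blast

lemma orth_proj_M_Hardy: "orth_proj M f \<in> Hardy"
  using orth_proj_in[OF M] M_Hardy by blast

lemma ker_on_M: "ker_on M P_plus = {0}"
  using M_Hardy P_plus_Hardy L2.subspace_0[OF subspace_M] bounded_op_simps(4)[OF bounded_op_P_plus]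
  by (auto simp: ker_on_def subset_iff)

lemma image_M: "P_plus ` M = M"
  using M_Hardy P_plus_Hardy by force

lemma Gr_spaces_iff: "M \<in> Gr_spaces \<longleftrightarrow> fin_codim M Hardy"
proof -
  have "P_minus ` (M \<inter> cball 0 1) \<subseteq> {0}"
    using M_Hardy P_minus_Hardy by auto
  then have "compact_on M P_minus"
    by (intro compact_on_if_subset[of "{0}"]) simp_all
  moreover have "fin_dim {0}"
    unfolding fin_dim_def by (intro exI[of _ "{}"]) simp
  ultimately show ?thesis
    using M M_Hardy bounded_op_P_plus
    by (simp add: Gr_spaces_def fredholm_def ker_on_M image_M closed_subspace_def)
qed

lemma fredholm_index_M: "fredholm_index M Hardy P_plus = - int (codim M Hardy)"
proof -
  have "L2.dim {0} = 0"
    using L2.dim_span[of "{}"] L2.dim_eq_card_independent[OF L2.independent_empty] by simp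
  then show ?thesis
    by (simp add: fredholm_index_def ker_on_M image_M)
qed

lemma Gr_res_iff: "orth_proj M \<in> Gr_res \<longleftrightarrow> fin_codim M Hardy"
proof -
  have "W = M" if "W \<in> Gr_spaces" "orth_proj M = orth_proj W" for W
    using that orth_proj_eq_iff[of W] by (simp add: Gr_spaces_def)
  then have "orth_proj M \<in> Gr_res \<longleftrightarrow> M \<in> Gr_spaces"
    unfolding Gr_res_def by blast
  then show ?thesis
    by (simp add: Gr_spaces_iff)
qed

lemma orth_proj_M_eq_0: "(\<And>h. h \<in> M \<Longrightarrow> cinner f h = 0) \<Longrightarrow> orth_proj M f = 0"
  by (rule orth_proj_eq_0[OF subspace_M])

lemma orth_proj_M_residual: "h \<in> M \<Longrightarrow> cinner h (f - orth_proj M f) = 0"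
  using orth_proj_orth[OF M, of h f] by (subst cinner_commute) simp

text \<open>Passing to the residual is linear and kills \<open>M\<close>, so generators modulo
  \<open>M\<close> become generators of the residuals.\<close>

lemma residual_span:
  assumes "f \<in> L2.span (M \<union> B)"
  shows "f - orth_proj M f \<in> L2.span ((\<lambda>b. b - orth_proj M b) ` B)"
  using assms
proof (rule L2.span_induct)
  note simps = bounded_op_simps[OF orth_proj_bounded_op[OF M]]
  let ?V = "L2.span ((\<lambda>b. b - orth_proj M b) ` B)"
  show "L2.subspace {f. f - orth_proj M f \<in> ?V}"
  proof (rule L2.subspaceI)
    fix f g c assume "f \<in> {f. f - orth_proj M f \<in> ?V}" "g \<in> {f. f - orth_proj M f \<in> ?V}"
    then have "(f - orth_proj M f) + (g - orth_proj M g) \<in> ?V" "c *\<^sub>C (f - orth_proj M f) \<in> ?V"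
      by (simp_all add: L2.span_add L2.span_scale)
    then show "f + g \<in> {f. f - orth_proj M f \<in> ?V}" "c *\<^sub>C f \<in> {f. f - orth_proj M f \<in> ?V}"
      by (simp_all add: simps L2.scale_right_diff_distrib add_diff_add)
  qed (simp add: simps L2.span_zero)
  show "x - orth_proj M x \<in> ?V" if "x \<in> M \<union> B" for x
    using that by (auto simp: orth_proj_id[OF subspace_M] L2.span_zero intro: L2.span_base)
qed

text \<open>The residual \<open>y\<close> of \<open>p\<close> is a combination of the residuals of
  \<open>B\<close>. Choosing \<open>p\<close> orthogonal to these makes \<open>y\<close> orthogonal
  to them too, because the part of \<open>p\<close> in \<open>M\<close> is; hence \<open>y\<close>
  is orthogonal to itself.\<close>

lemma fin_codim_imp_poly:
  assumes "fin_codim M Hardy"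
  shows "\<exists>p. p \<noteq> 0 \<and> poly_L2 p \<in> M"
proof -
  let ?Q = "\<lambda>b. b - orth_proj M b"
  obtain B where B: "finite B" "Hardy \<subseteq> L2.span (M \<union> B)"
    using assms by (auto simp: fin_codim_def)
  obtain p where p: "degree p > 0" "\<And>b. b \<in> B \<Longrightarrow> cinner (poly_L2 p) (?Q b) = 0"
    using exists_poly_in_kernels[OF B(1), of "\<lambda>b p. cinner (poly_L2 p) (?Q b)" 0]
    by (auto simp: poly_L2_add poly_L2_smult cinner_add_left cinner_scaleC_left)
  define y where "y = ?Q (poly_L2 p)"
  have y_span: "y \<in> L2.span (?Q ` B)"
    unfolding y_def using B(2) poly_L2_Hardy by (intro residual_span) blast
  have "cinner y (?Q b) = 0" if "b \<in> B" for b
    using p(2)[OF that] orth_proj_M_residual[OF orth_proj_in[OF M], of "poly_L2 p" b]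
    by (simp add: y_def cinner_diff_left)
  then have y_orth: "cinner (?Q b) y = 0" if "b \<in> B" for b
    using that by (subst cinner_commute) simp
  have "L2.subspace {v. cinner v y = 0}"
    by (simp add: L2.subspace_def cinner_add_left cinner_scaleC_left)
  from L2.span_induct[OF y_span this] have "cinner y y = 0"
    using y_orth by blast
  then have "poly_L2 p = orth_proj M (poly_L2 p)"
    by (simp add: y_def)
  then have "poly_L2 p \<in> M"
    using orth_proj_in[OF M] by metis
  then show ?thesis using p(1) by (intro exI[of _ p]) auto
qed

section \<open>An orthogonal basis of the complement of \<open>M\<close> in
  \<open>Hardy\<close>\<close>

context
  fixes N :: "L2 set"
  assumes N: "finite N" "N \<subseteq> Hardy" "0 \<notin> N"
    and N_orth: "\<And>x y. x \<in> N \<Longrightarrow> y \<in> N \<Longrightarrow> x \<noteq> y \<Longrightarrow> cinner x y = 0"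
    and N_M: "\<And>e h. e \<in> N \<Longrightarrow> h \<in> M \<Longrightarrow> cinner h e = 0"
    and N_expand: "\<And>f. f \<in> Hardy \<Longrightarrow> f - (\<Sum>e\<in>N. (cinner f e / cinner e e) *\<^sub>C e) \<in> M"
begin

lemma Hardy_span_complement: "Hardy \<subseteq> L2.span (M \<union> N)"
proof
  fix f assume "f \<in> Hardy"
  then have "f - (\<Sum>e\<in>N. (cinner f e / cinner e e) *\<^sub>C e) \<in> L2.span (M \<union> N)"
    by (intro L2.span_base UnI1 N_expand)
  moreover have "(\<Sum>e\<in>N. (cinner f e / cinner e e) *\<^sub>C e) \<in> L2.span (M \<union> N)"
    by (intro L2.span_sum L2.span_scale L2.span_base UnI2)
  ultimately have "f - (\<Sum>e\<in>N. (cinner f e / cinner e e) *\<^sub>C e) + (\<Sum>e\<in>N. (cinner f e / cinner e e) *\<^sub>C e)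
      \<in> L2.span (M \<union> N)"
    by (rule L2.span_add)
  then show "f \<in> L2.span (M \<union> N)"
    by simp
qed

lemma fin_codim_complement: "fin_codim M Hardy"
  unfolding fin_codim_def using N Hardy_span_complement by blast

lemma independent_complement: "L2.independent N"
proof (rule L2.independent_if_scalars_zero[OF N(1)])
  fix c x assume sum: "(\<Sum>e\<in>N. c e *\<^sub>C e) = 0" and x: "x \<in> N"
  have "0 = cinner (\<Sum>e\<in>N. c e *\<^sub>C e) x"
    by (simp add: sum)
  also have "\<dots> = (\<Sum>e\<in>N. if e = x then c x * cinner x x else 0)"
    unfolding cinner_sum_left cinner_scaleC_left
    using N_orth x by (intro sum.cong refl) auto
  also have "\<dots> = c x * cinner x x"
    using N(1) x by simp
  finally show "c x = 0"
    using x N(3) by auto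
qed

text \<open>For minimality, the elements of \<open>N\<close> are their own residuals, so they lie in
  the span of the residuals of any competing \<open>B\<close>. Independence of \<open>N\<close> then
  bounds its size.\<close>

lemma codim_complement: "codim M Hardy = card N"
  unfolding codim_def
proof (rule Least_equality)
  show "\<exists>B. finite B \<and> card B = card N \<and> B \<subseteq> Hardy \<and> Hardy \<subseteq> L2.span (M \<union> B)"
    using N Hardy_span_complement by blast
  fix n assume "\<exists>B. finite B \<and> card B = n \<and> B \<subseteq> Hardy \<and> Hardy \<subseteq> L2.span (M \<union> B)"
  then obtain B where B: "finite B" "card B = n" "Hardy \<subseteq> L2.span (M \<union> B)"
    by blast
  let ?T = "(\<lambda>b. b - orth_proj M b) ` B"
  have "N \<subseteq> L2.span ?T"
  proof
    fix e assume e: "e \<in> N"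
    have "orth_proj M e = 0"
      using N_M[OF e] by (intro orth_proj_M_eq_0) (subst cinner_commute, simp)
    moreover have "e - orth_proj M e \<in> L2.span ?T"
      using e N(2) B(3) by (intro residual_span) blast
    ultimately show "e \<in> L2.span ?T" by simp
  qed
  then have "card N \<le> card ?T"
    using L2.independent_span_bound[OF _ independent_complement] B(1) by blast
  also have "\<dots> \<le> n"
    using card_image_le[OF B(1)] B(2) by blast
  finally show "card N \<le> n" .
qed

text \<open>The difference is the projection onto the span of \<open>N\<close>, an operator of
  finite rank.\<close>

lemma P_plus_diff_compact: "(\<lambda>f. P_plus f - orth_proj M f) \<in> compact_ops"
proof -
  have "P_plus f - orth_proj M f = (\<Sum>e\<in>N. cinner f e *\<^sub>C ((1 / cinner e e) *\<^sub>C e))" for f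
  proof -
    define S where "S = (\<Sum>e\<in>N. (cinner f e / cinner e e) *\<^sub>C e)"
    have P_orth: "cinner (f - P_plus f) h = 0" if "h \<in> Hardy" for h
      unfolding P_plus_def by (rule orth_proj_orth[OF closed_subspace_Hardy that])
    have "cinner (P_plus f) e = cinner f e" if "e \<in> N" for e
      using P_orth[of e] that N(2) by (auto simp: cinner_diff_left)
    then have "P_plus f - S \<in> M"
      using N_expand[OF P_plus_in_Hardy, of f] by (simp add: S_def)
    moreover have "cinner (f - (P_plus f - S)) h = 0" if h: "h \<in> M" for h
    proof -
      have "cinner e h = 0" if "e \<in> N" for e
        using N_M[OF that h] by (subst cinner_commute) simp
      then have "cinner S h = 0"
        by (simp add: S_def cinner_sum_left cinner_scaleC_left)
      moreover have "cinner (f - P_plus f) h = 0"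
        using h M_Hardy by (intro P_orth) blast
      ultimately show ?thesis
        by (simp add: cinner_diff_left)
    qed
    ultimately have "orth_proj M f = P_plus f - S"
      by (intro orth_projI[OF subspace_M])
    then show ?thesis by (simp add: S_def)
  qed
  then show ?thesis
    by (simp only: finite_rank_compact)
qed

end

text \<open>On \<open>Hardy\<close> the compact operator \<open>Q\<close> is the passage to the
  residual, and it vanishes on \<open>M\<close>. So \<open>Q\<close> fixes the residual of any
  polynomial, and finitely many conditions on \<open>p\<close> make this residual 0.\<close>

lemma compact_diff_imp_poly:
  assumes "(\<lambda>f. P_plus f - orth_proj M f) \<in> compact_ops"
  shows "\<exists>p. p \<noteq> 0 \<and> poly_L2 p \<in> M"
proof -
  define Q where "Q f = P_plus f - orth_proj M f" for f
  have Q_compact: "Q \<in> compact_ops"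
    using assms by (simp add: Q_def[abs_def])
  then have "bounded_op Q"
    by (simp add: compact_ops_def)
  note simps = bounded_op_simps[OF this]
  obtain F where F: "finite F" "\<And>y. Q y = y \<Longrightarrow> (\<forall>x\<in>F. cinner y (Q x) = 0) \<Longrightarrow> y = 0"
    using compact_fixed_points[OF Q_compact] by blast
  obtain p where p: "degree p > 0" "\<forall>x\<in>F. cinner (Q (poly_L2 p)) (Q x) = 0"
    using exists_poly_in_kernels[OF F(1), of "\<lambda>x p. cinner (Q (poly_L2 p)) (Q x)" 0]
    by (auto simp: poly_L2_add poly_L2_smult simps cinner_add_left cinner_scaleC_left)
  have Q_poly: "Q (poly_L2 p) = poly_L2 p - orth_proj M (poly_L2 p)"
    by (simp add: Q_def P_plus_Hardy poly_L2_Hardy)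
  have "Q (orth_proj M (poly_L2 p)) = 0"
    by (simp add: Q_def P_plus_Hardy orth_proj_M_Hardy orth_proj_id[OF subspace_M orth_proj_in[OF M]])
  then have "Q (Q (poly_L2 p)) = Q (poly_L2 p)"
    unfolding Q_poly simps by (simp add: Q_poly)
  then have "Q (poly_L2 p) = 0"
    using p(2) by (rule F(2))
  then have "poly_L2 p = orth_proj M (poly_L2 p)"
    by (simp add: Q_poly)
  then have "poly_L2 p \<in> M"
    using orth_proj_in[OF M] by metis
  then show ?thesis using p(1) by (intro exI[of _ p]) auto
qed

end

section \<open>Noncompactness of the projection onto the range of an inner function\<close>

lemma poly_L2_eq_0: "poly_L2 p = 0 \<Longrightarrow> p = 0"
proof (induction p)
  case (pCons c p)
  have eq: "c * fourier one_L2 n + fourier (poly_L2 p) (n - 1) = 0" for n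
    using arg_cong[OF pCons.prems, of "\<lambda>f. fourier f n"]
    by (simp add: poly_L2_pCons fourier_add fourier_scaleC fourier_Mult_ident)
  have "fourier (poly_L2 p) (- 1) = 0"
    using poly_L2_Hardy[of p] by (simp add: Hardy_def)
  \<comment> \<open>At index 0 the shifted term is a coefficient at -1, which vanishes and isolates
    the constant term.\<close>
  then have "c = 0"
    using eq[of 0] by (simp add: fourier_zpow flip: zpow_0)
  then have "fourier (poly_L2 p) n = 0" for n
    using eq[of "n + 1"] by simp
  then have "poly_L2 p = 0"
    by (rule fourier_zero_imp_zero)
  with pCons.IH \<open>c = 0\<close> show ?case by simp
qed simp

text \<open>Products of \<open>u\<close> with polynomials are fixed by the projection. If it were
  compact, finitely many conditions would separate them from 0, yet some nonzero polynomial meets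
  all of these.\<close>

lemma inner_proj_not_compact:
  assumes u: "inner_symbol u"
  shows "orth_proj (Mult u ` Hardy) \<notin> compact_ops"
proof
  let ?P = "orth_proj (Mult u ` Hardy)"
  have uu: "bounded_mult u" "\<And>z. cmod z = 1 \<Longrightarrow> cmod (u z) = 1"
    using u by (auto simp: inner_symbol_def)
  assume "?P \<in> compact_ops"
  from compact_fixed_points[OF this]
  obtain F where F: "finite F" "\<And>y. ?P y = y \<Longrightarrow> (\<forall>x\<in>F. cinner y (?P x) = 0) \<Longrightarrow> y = 0"
    by blast
  obtain p where p: "degree p > 0" "\<forall>x\<in>F. cinner (Mult u (poly_L2 p)) (?P x) = 0"
    using exists_poly_in_kernels[OF F(1), of "\<lambda>x p. cinner (Mult u (poly_L2 p)) (?P x)" 0] uu(1)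
    by (auto simp: poly_L2_add poly_L2_smult Mult_add_right Mult_scaleC_right cinner_add_left cinner_scaleC_left)
  have "?P (Mult u (poly_L2 p)) = Mult u (poly_L2 p)"
    using closed_subspace_Mult_Hardy[OF u] poly_L2_Hardy
    by (intro orth_proj_id) (auto simp: closed_subspace_def)
  then have "Mult u (poly_L2 p) = 0"
    using p(2) by (rule F(2))
  then have "poly_L2 p = 0"
    using Mult_cnj_cancel(1)[OF uu, of "poly_L2 p"] uu(1) by simp
  then show False
    using poly_L2_eq_0 p(1) by force
qed

section \<open>The Calkin algebra\<close>

lemma carrier_BL2 [simp]: "T \<in> carrier BL2 \<longleftrightarrow> bounded_op T"
  by (simp add: BL2_def)

lemma calkin_map_hom: "calkin_map \<in> ring_hom BL2 calkin"
  using ideal.rcos_ring_hom[OF ideal_compact_ops]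
  by (simp add: calkin_def calkin_map_def[abs_def])

lemma calkin_map_comp:
  "bounded_op S \<Longrightarrow> bounded_op T \<Longrightarrow> calkin_map (S \<circ> T) = calkin_map S \<otimes>\<^bsub>calkin\<^esub> calkin_map T"
  using ring_hom_mult[OF calkin_map_hom, of S T] by (simp add: BL2_def)

lemma calkin_map_closed: "bounded_op T \<Longrightarrow> calkin_map T \<in> carrier calkin"
  using ring_hom_closed[OF calkin_map_hom] by simp

lemma zero_compact: "(\<lambda>_. 0) \<in> compact_ops"
  using finite_rank_compact[where N = "{}"] by simp

lemma compact_ops_add: "S \<in> compact_ops \<Longrightarrow> T \<in> compact_ops \<Longrightarrow> (\<lambda>f. S f + T f) \<in> compact_ops"
  by (simp add: compact_ops_def bounded_op_add compact_on_add)

lemma compact_ops_uminus: "T \<in> compact_ops \<Longrightarrow> (\<lambda>f. - T f) \<in> compact_ops"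
  using compact_on_comp_left[OF bounded_linear_minus[OF bounded_linear_ident], of UNIV T]
  by (simp add: compact_ops_def bounded_op_uminus comp_def)

lemma calkin_map_eq_image: "calkin_map T = (\<lambda>K f. K f + T f) ` compact_ops"
  unfolding calkin_map_def a_r_coset_def' by (auto simp: BL2_def)

lemma calkin_map_eq_iff: "calkin_map S = calkin_map T \<longleftrightarrow> (\<lambda>f. S f - T f) \<in> compact_ops"
proof
  assume "calkin_map S = calkin_map T"
  moreover have "S \<in> calkin_map S"
    using zero_compact unfolding calkin_map_eq_image by (rule rev_image_eqI) simp
  ultimately obtain K where "K \<in> compact_ops" "S = (\<lambda>f. K f + T f)"
    by (auto simp: calkin_map_eq_image)
  then show "(\<lambda>f. S f - T f) \<in> compact_ops"
    by simp
next
  have sub: "calkin_map U \<subseteq> calkin_map V" if "(\<lambda>f. U f - V f) \<in> compact_ops" for U V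
  proof
    fix x assume "x \<in> calkin_map U"
    then obtain K where K: "K \<in> compact_ops" "x = (\<lambda>f. K f + U f)"
      by (auto simp: calkin_map_eq_image)
    then have "x = (\<lambda>f. (K f + (U f - V f)) + V f)"
      by simp
    then show "x \<in> calkin_map V"
      using compact_ops_add[OF K(1) that] unfolding calkin_map_eq_image by (rule image_eqI)
  qed
  assume "(\<lambda>f. S f - T f) \<in> compact_ops"
  then show "calkin_map S = calkin_map T"
    using compact_ops_uminus by (intro equalityI sub) fastforce+
qed

lemma calkin_map_eq_zero_iff: "calkin_map T = \<zero>\<^bsub>calkin\<^esub> \<longleftrightarrow> T \<in> compact_ops"
proof -
  have "ring calkin"
    unfolding calkin_def by (rule ideal.quotient_is_ring[OF ideal_compact_ops])
  then have "calkin_map \<zero>\<^bsub>BL2\<^esub> = \<zero>\<^bsub>calkin\<^esub>"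
    using ring_hom_zero[OF calkin_map_hom ring_BL2] by blast
  then have "\<zero>\<^bsub>calkin\<^esub> = calkin_map (\<lambda>_. 0)"
    by (simp add: BL2_def)
  then show ?thesis
    using calkin_map_eq_iff[of T "\<lambda>_. 0"] by simp
qed

text \<open>The star of a coset is an image of a set of operators, so two inclusions are needed. The
  adjoint of \<open>K\<close> plus \<open>T\<close> is the adjoint of \<open>K\<close> plus
  \<open>T\<close>'s own adjoint \<open>T\<close>, and taking adjoints is an involution of
  \<open>compact_ops\<close>.\<close>

lemma calkin_star_selfadjoint:
  assumes T: "bounded_op T" and selfadj: "\<And>f g. cinner (T f) g = cinner f (T g)"
  shows "calkin_star (calkin_map T) = calkin_map T"
proof -
  have bo: "bounded_op (\<lambda>f. K f + T f)" if "K \<in> compact_ops" for K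
    using that T by (intro bounded_op_add) (auto simp: compact_ops_def)
  have adj: "cinner (K f) g = cinner f (adjoint_op K g)" "cinner (adjoint_op K f) g = cinner f (K g)"
    if "K \<in> compact_ops" for K f g
  proof -
    show 1: "cinner (K f) g = cinner f (adjoint_op K g)" for f g
      using that by (intro cinner_adjoint) (auto simp: compact_ops_def)
    show "cinner (adjoint_op K f) g = cinner f (K g)"
      using 1[of g f] cinner_commute by metis
  qed
  have star: "adjoint_op (\<lambda>f. K f + T f) = (\<lambda>f. adjoint_op K f + T f)"
    "adjoint_op (\<lambda>f. adjoint_op K f + T f) = (\<lambda>f. K f + T f)" if K: "K \<in> compact_ops" for K
    using bo[OF K] bo[OF adjoint_compact[OF K]]
    by (auto intro!: adjoint_op_eqI simp: cinner_add_left cinner_add_right adj[OF K] selfadj)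
  show ?thesis
    unfolding calkin_star_def calkin_map_eq_image image_image
  proof (intro equalityI subsetI; elim imageE)
    fix x K assume K: "K \<in> compact_ops" "x = adjoint_op (\<lambda>f. K f + T f)"
    then show "x \<in> (\<lambda>K f. K f + T f) ` compact_ops"
      using adjoint_compact[OF K(1)] by (simp add: star)
  next
    fix x K assume K: "K \<in> compact_ops" "x = (\<lambda>f. K f + T f)"
    then have "x = adjoint_op (\<lambda>f. adjoint_op K f + T f)"
      by (simp add: star)
    then show "x \<in> (\<lambda>K. adjoint_op (\<lambda>f. K f + T f)) ` compact_ops"
      using adjoint_compact[OF K(1)] by blast
  qed
qed

text \<open>Since \<open>M\<close> lies in \<open>Hardy\<close>, composing \<open>P\<close> with
  \<open>P_plus\<close> on either side gives \<open>P\<close>, and with \<open>P_minus\<close> gives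
  0. All block conditions hold before passing to the quotient, and the corner is the class of
  \<open>P\<close> itself. With \<open>nc\<close> giving a nonzero corner, what remains is that it
  differs from the class of \<open>P_plus\<close>.\<close>

lemma essential_class_1_iff:
  assumes M: "closed_subspace M" and M_Hardy: "M \<subseteq> Hardy" and nc: "orth_proj M \<notin> compact_ops"
  shows "orth_proj M \<in> essential_class_1 \<longleftrightarrow> (\<lambda>f. P_plus f - orth_proj M f) \<notin> compact_ops"
proof -
  define P where "P = orth_proj M"
  have P: "is_orth_proj P"
    unfolding P_def by (rule is_orth_proj_orth_proj[OF M])
  then have bo: "bounded_op P" "bounded_op P_plus" "bounded_op P_minus"
    by (simp_all add: is_orth_proj_def bounded_op_P_plus bounded_op_P_minus)
  have PP: "P \<circ> P = P" and selfadj: "cinner (P f) g = cinner f (P g)" for f g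
    using P by (simp_all add: is_orth_proj_def)
  have P_Hardy: "P f \<in> Hardy" for f
    using orth_proj_in[OF M] M_Hardy by (auto simp: P_def)
  have P_zero: "P f = 0" if "\<And>h. h \<in> Hardy \<Longrightarrow> cinner f h = 0" for f
    unfolding P_def using M M_Hardy that by (intro orth_proj_eq_0) (auto simp: closed_subspace_def)
  have "P (f - P_plus f) = 0" for f
    using orth_proj_orth[OF closed_subspace_Hardy] by (intro P_zero) (simp add: P_plus_def)
  then have P_plus1: "P (P_plus f) = P f" for f
    by (simp add: bounded_op_simps[OF bo(1)])
  have P_plus2: "P_plus (P f) = P f" for f
    by (rule P_plus_Hardy[OF P_Hardy])
  have P_minus1: "P (P_minus f) = 0" for f
    using orth_proj_in[OF closed_subspace_Hardy_minus, of f]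
    by (intro P_zero) (simp add: P_minus_def Hardy_minus_def)
  have P_minus2: "P_minus (P f) = 0" for f
    by (rule P_minus_Hardy[OF P_Hardy])
  define a e e' where "a = calkin_map P" and "e = calkin_map P_plus" and "e' = calkin_map P_minus"
  have triple: "calkin_map S \<otimes>\<^bsub>calkin\<^esub> a \<otimes>\<^bsub>calkin\<^esub> calkin_map T = calkin_map (\<lambda>f. S (P (T f)))"
    if "bounded_op S" "bounded_op T" for S T
    using calkin_map_comp[OF bounded_op_comp[OF that(1) bo(1)] that(2)] calkin_map_comp[OF that(1) bo(1)]
    by (simp add: a_def comp_def)
  have zero: "calkin_map (\<lambda>_. 0) = \<zero>\<^bsub>calkin\<^esub>"
    using calkin_map_eq_zero_iff zero_compact by simp
  have eae: "e \<otimes>\<^bsub>calkin\<^esub> a \<otimes>\<^bsub>calkin\<^esub> e = a"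
    unfolding e_def triple[OF bo(2) bo(2)] by (simp add: P_plus1 P_plus2 a_def)
  have off: "e \<otimes>\<^bsub>calkin\<^esub> a \<otimes>\<^bsub>calkin\<^esub> e' = \<zero>\<^bsub>calkin\<^esub>"
    "e' \<otimes>\<^bsub>calkin\<^esub> a \<otimes>\<^bsub>calkin\<^esub> e = \<zero>\<^bsub>calkin\<^esub>"
    "e' \<otimes>\<^bsub>calkin\<^esub> a \<otimes>\<^bsub>calkin\<^esub> e' = \<zero>\<^bsub>calkin\<^esub>"
    unfolding e_def e'_def triple[OF bo(2) bo(3)] triple[OF bo(3) bo(2)] triple[OF bo(3) bo(3)]
    by (simp_all add: P_minus1 P_minus2 zero bounded_op_simps(4)[OF bo(2)] bounded_op_simps(4)[OF bo(3)])
  have proj: "calkin_projection a"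
    unfolding calkin_projection_def a_def
    using calkin_map_closed[OF bo(1)] calkin_map_comp[OF bo(1) bo(1)] calkin_star_selfadjoint[OF bo(1) selfadj]
    by (simp add: PP)
  have nonzero: "a \<noteq> \<zero>\<^bsub>calkin\<^esub>"
    using calkin_map_eq_zero_iff nc by (simp add: a_def P_def)
  have B_cc: "P \<in> B_cc"
    using bo(1) zero_compact by (simp add: B_cc_def P_plus1 P_plus2)
  have "P \<in> essential_class_1 \<longleftrightarrow> P \<in> B_cc \<and> is_orth_proj P \<and>
      (\<exists>p. calkin_projection p \<and> p \<noteq> \<zero>\<^bsub>calkin\<^esub> \<and> p \<noteq> e \<and>
        e \<otimes>\<^bsub>calkin\<^esub> a \<otimes>\<^bsub>calkin\<^esub> e = p \<and>
        e \<otimes>\<^bsub>calkin\<^esub> a \<otimes>\<^bsub>calkin\<^esub> e' = \<zero>\<^bsub>calkin\<^esub> \<and>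
        e' \<otimes>\<^bsub>calkin\<^esub> a \<otimes>\<^bsub>calkin\<^esub> e = \<zero>\<^bsub>calkin\<^esub> \<and>
        e' \<otimes>\<^bsub>calkin\<^esub> a \<otimes>\<^bsub>calkin\<^esub> e' = \<zero>\<^bsub>calkin\<^esub>)"
    unfolding essential_class_1_def Let_def a_def e_def e'_def mem_Collect_eq ..
  also have "\<dots> \<longleftrightarrow> e \<noteq> a"
    unfolding eae off using P proj nonzero B_cc by (metis (no_types))
  also have "\<dots> \<longleftrightarrow> (\<lambda>f. P_plus f - P f) \<notin> compact_ops"
    unfolding a_def e_def calkin_map_eq_iff ..
  finally show ?thesis
    by (simp add: P_def)
qed

theorem theorem5p1:
  fixes \<phi> :: L2
  assumes "inner_function \<phi>"
  shows "((finite_blaschke_product \<phi> \<longleftrightarrow> P_inner \<phi> \<in> Gr_res) \<and>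
          (finite_blaschke_product \<phi> \<longrightarrow> P_inner \<phi> \<in> Gr_res_index (- int (zero_count \<phi>)))) \<and>
         (\<not> finite_blaschke_product \<phi> \<longleftrightarrow> P_inner \<phi> \<in> essential_class_1)"
proof -
  obtain u where u: "inner_symbol u" and \<phi>: "\<phi> = Mult u one_L2"
    using inner_function_symbol[OF assms] by blast
  have bm: "bounded_mult u"
    using u by (simp add: inner_symbol_def)
  define M where "M = Mult u ` Hardy"
  have P: "P_inner \<phi> = orth_proj M"
    unfolding P_inner_def M_def \<phi> mult_Hardy_Mult[OF bm] ..
  have M: "closed_subspace M"
    unfolding M_def by (rule closed_subspace_Mult_Hardy[OF u])
  have M_Hardy: "M \<subseteq> Hardy"
    using Mult_inner_Hardy[OF u] by (auto simp: M_def)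
  have nc: "orth_proj M \<notin> compact_ops"
    unfolding M_def by (rule inner_proj_not_compact[OF u])
  have blaschke_if_poly: "finite_blaschke_product \<phi>" if "\<exists>p. p \<noteq> 0 \<and> poly_L2 p \<in> M"
    using that poly_in_range_imp_blaschke[OF u] unfolding finite_blaschke_product_iff M_def \<phi> by blast
  have blaschke: "fin_codim M Hardy \<and> codim M Hardy = zero_count \<phi> \<and> (\<lambda>f. P_plus f - orth_proj M f) \<in> compact_ops"
    if fbp: "finite_blaschke_product \<phi>"
  proof -
    obtain c as where c: "cmod c = 1" and as: "\<forall>a\<in>set as. cmod a < 1"
        and eq: "\<phi> = c *\<^sub>C Mult (blaschke_product as) one_L2"
      using fbp unfolding finite_blaschke_product_iff by blast
    have c0: "c \<noteq> 0" using c by auto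
    let ?B = "blaschke_product as"
    have bmB: "bounded_mult ?B"
      using as by simp
    have "\<phi> = Mult (\<lambda>z. c * ?B z) one_L2"
      using bmB by (simp add: eq Mult_scaleC_left)
    \<comment> \<open>The symbols \<open>u\<close> and \<open>c * ?B z\<close> represent the same
      vector and may differ on a null set. The ranges agree because \<open>mult_Hardy\<close>
      depends on the vector alone.\<close>
    then have "M = Mult (\<lambda>z. c * ?B z) ` Hardy"
      using mult_Hardy_Mult[OF bm] mult_Hardy_Mult[of "\<lambda>z. c * ?B z"] bmB by (simp add: M_def \<phi>)
    also have "\<dots> = Mult ?B ` Hardy"
    proof (intro equalityI subsetI; elim imageE)
      fix x f assume f: "f \<in> Hardy" "x = Mult (\<lambda>z. c * ?B z) f"
      then have "x = Mult ?B (c *\<^sub>C f)"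
        using bmB by (simp add: Mult_scaleC_left Mult_scaleC_right)
      then show "x \<in> Mult ?B ` Hardy"
        using Hardy_intros(3)[OF f(1)] by blast
    next
      fix x f assume f: "f \<in> Hardy" "x = Mult ?B f"
      then have "x = Mult (\<lambda>z. c * ?B z) ((1 / c) *\<^sub>C f)"
        using bmB c0 by (simp add: Mult_scaleC_left Mult_scaleC_right)
      then show "x \<in> Mult (\<lambda>z. c * ?B z) ` Hardy"
        using Hardy_intros(3)[OF f(1)] by blast
    qed
    finally have M_eq: "M = Mult ?B ` Hardy" .
    from blaschke_complement[OF as] obtain N where N: "finite N" "card N = length as" "N \<subseteq> Hardy" "0 \<notin> N"
      "\<forall>x\<in>N. \<forall>y\<in>N. x \<noteq> y \<longrightarrow> cinner x y = 0"
      "\<forall>e\<in>N. \<forall>f\<in>Hardy. cinner (Mult ?B f) e = 0"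
      "\<forall>f\<in>Hardy. f - (\<Sum>e\<in>N. (cinner f e / cinner e e) *\<^sub>C e) \<in> Mult ?B ` Hardy"
      by (elim exE conjE) (rule that)
    have N_M: "cinner h e = 0" if "e \<in> N" "h \<in> M" for e h
      using that N(6) by (auto simp: M_eq)
    note complement = N(1,3,4) N(5)[rule_format] N_M N(7)[rule_format, folded M_eq]
    have "fin_codim M Hardy"
      by (rule fin_codim_complement[OF M M_Hardy complement])
    moreover have "codim M Hardy = card N"
      by (rule codim_complement[OF M M_Hardy complement])
    moreover have "(\<lambda>f. P_plus f - orth_proj M f) \<in> compact_ops"
      by (rule P_plus_diff_compact[OF M M_Hardy complement])
    ultimately show ?thesis
      using zero_count_blaschke[OF c as eq] N(2) by simp
  qed
  have "finite_blaschke_product \<phi> \<longleftrightarrow> P_inner \<phi> \<in> Gr_res"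
    using blaschke blaschke_if_poly fin_codim_imp_poly[OF M M_Hardy]
    unfolding P Gr_res_iff[OF M M_Hardy] by blast
  moreover have "P_inner \<phi> \<in> Gr_res_index (- int (zero_count \<phi>))" if "finite_blaschke_product \<phi>"
    using blaschke[OF that] Gr_spaces_iff[OF M M_Hardy] fredholm_index_M[OF M M_Hardy]
    unfolding P Gr_res_index_def by (intro imageI) simp
  moreover have "\<not> finite_blaschke_product \<phi> \<longleftrightarrow> P_inner \<phi> \<in> essential_class_1"
    using blaschke blaschke_if_poly compact_diff_imp_poly[OF M M_Hardy]
    unfolding P essential_class_1_iff[OF M M_Hardy nc] by blast
  ultimately show ?thesis by blast
qed

end
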